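(* Let $(G,P,\theta)$ be an algebraic dynamical system. There is an isomorphism $\varphi:\mathcal A[G,P,\theta]\to C^*(G\rtimes_\theta P)$ satisfying $$\varphi(u_g)=v_{(g,1)}\quad\text{and}\quad\varphi(s_p)=v_{(1,p)}\qquad\text{for all }g\in G,\ p\in P .$$
   Context: A semigroup $P$ with identity $1$ is right LCM if it is left cancellative and, for all $p,q\in P$, the set $pP\cap qP$ is either empty or equal to $rP$ for some $r\in P$. An algebraic dynamical system is a triple $(G,P,\theta)$ consisting of a countable discrete group $G$, a countable right LCM semigroup $P$ with identity, and an action $\theta$ of $P$ by injective group endomorphisms of $G$ (so $\theta_1=\mathrm{id}$, $\theta_{pq}=\theta_p\theta_q$) such that $\theta_p(G)\cap\theta_q(G)=\theta_r(G)$ whenever $p,q,r\in P$ satisfy $pP\cap qP=rP$. $\mathcal A[G,P,\theta]$ is the universal $C^*$-algebra generated by a unitary representation $u$ of $G$ and a representation $s$ of $P$ by isometries satisfying (A1) $s_pu_g=u_{\theta_p(g)}s_p$ for all $p\in P$, $g\in G$; (A2) for all $p,q\in P$, $g\in G$: $s_p^*u_gs_q=u_ks_{p'}s_{q'}^*u_\ell^*$ if $pP\cap qP=rP$ with $pp'=qq'=r$ and $g=\theta_p(k)\theta_q(\ell^{-1})$ for some $k,\ell\in G$; and $s_p^*u_gs_q=0$ otherwise. (This does not depend on the choices.) $G\rtimes_\theta P$ is the set $G\times P$ with multiplication $(g,p)(h,q)=(g\theta_p(h),pq)$; it is a right LCM semigroup with identity. For a left cancellative semigroup $S$ with identity, the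 family $\mathcal J(S)$ of constructible right ideals is the smallest family of right ideals of $S$ containing $S$ and $\emptyset$ and closed under $X\mapsto pX=\{px\mid x\in X\}$ and $X\mapsto p^{-1}X=\{y\in S\mid py\in X\}$ for $p\in S$. The full semigroup $C^*$-algebra $C^*(S)$ is the universal $C^*$-algebra generated by isometries $(v_p)_{p\in S}$ and projections $(e_X)_{X\in\mathcal J(S)}$ satisfying, for all $p,q\in S$, $X,Y\in\mathcal J(S)$: $v_pv_q=v_{pq}$; $v_pe_Xv_p^*=e_{pX}$; $e_\emptyset=0$, $e_S=1$; $e_Xe_Y=e_{X\cap Y}$. *)

theory Defs
  imports
    Complex_Main
    "HOL-Library.Poly_Mapping"
    "HOL-Library.Countable_Set"
    "HOL-Algebra.Coset"
    "HOL-Algebra.QuotRing"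
    "HOL-Algebra.Module"
begin

section \<open>Unital C*-algebras\<close>

record 'a star_algebra = "(complex, 'a) module" +
  adj :: "'a \<Rightarrow> 'a"

record 'a cstar_algebra = "'a star_algebra" +
  nrm :: "'a \<Rightarrow> real"

locale cstar_algebra = ring A for A :: "('a, 'm) cstar_algebra_scheme" (structure) +
  assumes smult_closed: "x \<in> carrier A \<Longrightarrow> c \<odot> x \<in> carrier A"
    and smult_add_left: "x \<in> carrier A \<Longrightarrow> (c + d) \<odot> x = c \<odot> x \<oplus> d \<odot> x"
    and smult_add_right: "x \<in> carrier A \<Longrightarrow> y \<in> carrier A \<Longrightarrow> c \<odot> (x \<oplus> y) = c \<odot> x \<oplus> c \<odot> y"
    and smult_smult: "x \<in> carrier A \<Longrightarrow> c \<odot> (d \<odot> x) = (c * d) \<odot> x"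
    and smult_one: "x \<in> carrier A \<Longrightarrow> 1 \<odot> x = x"
    and smult_mult_left: "x \<in> carrier A \<Longrightarrow> y \<in> carrier A \<Longrightarrow> (c \<odot> x) \<otimes> y = c \<odot> (x \<otimes> y)"
    and smult_mult_right: "x \<in> carrier A \<Longrightarrow> y \<in> carrier A \<Longrightarrow> x \<otimes> (c \<odot> y) = c \<odot> (x \<otimes> y)"
    and adj_closed: "x \<in> carrier A \<Longrightarrow> adj A x \<in> carrier A"
    and adj_adj: "x \<in> carrier A \<Longrightarrow> adj A (adj A x) = x"
    and adj_add: "x \<in> carrier A \<Longrightarrow> y \<in> carrier A \<Longrightarrow> adj A (x \<oplus> y) = adj A x \<oplus> adj A y"
    and adj_smult: "x \<in> carrier A \<Longrightarrow> adj A (c \<odot> x) = cnj c \<odot> adj A x"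
    and adj_mult: "x \<in> carrier A \<Longrightarrow> y \<in> carrier A \<Longrightarrow> adj A (x \<otimes> y) = adj A y \<otimes> adj A x"
    and nrm_nonneg: "x \<in> carrier A \<Longrightarrow> 0 \<le> nrm A x"
    and nrm_eq_0_iff: "x \<in> carrier A \<Longrightarrow> nrm A x = 0 \<longleftrightarrow> x = \<zero>"
    and nrm_add: "x \<in> carrier A \<Longrightarrow> y \<in> carrier A \<Longrightarrow> nrm A (x \<oplus> y) \<le> nrm A x + nrm A y"
    and nrm_smult: "x \<in> carrier A \<Longrightarrow> nrm A (c \<odot> x) = cmod c * nrm A x"
    and nrm_mult: "x \<in> carrier A \<Longrightarrow> y \<in> carrier A \<Longrightarrow> nrm A (x \<otimes> y) \<le> nrm A x * nrm A y"
    and nrm_adj_mult: "x \<in> carrier A \<Longrightarrow> nrm A (adj A x \<otimes> x) = (nrm A x)\<^sup>2"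
    and complete: "(\<And>n. X n \<in> carrier A) \<Longrightarrow>
        (\<And>e. 0 < e \<Longrightarrow> \<exists>M. \<forall>m\<ge>M. \<forall>n\<ge>M. nrm A (X m \<ominus> X n) < e) \<Longrightarrow>
        \<exists>x\<in>carrier A. (\<lambda>n. nrm A (X n \<ominus> x)) \<longlonglongrightarrow> 0"

definition star_hom ::
    "('a, 'm) star_algebra_scheme \<Rightarrow> ('b, 'n) star_algebra_scheme \<Rightarrow> ('a \<Rightarrow> 'b) set" where
  "star_hom A B = {\<phi> \<in> ring_hom A B.
     (\<forall>c. \<forall>x\<in>carrier A. \<phi> (c \<odot>\<^bsub>A\<^esub> x) = c \<odot>\<^bsub>B\<^esub> \<phi> x) \<and>
     (\<forall>x\<in>carrier A. \<phi> (adj A x) = adj B (\<phi> x))}"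

definition star_iso ::
    "('a, 'm) star_algebra_scheme \<Rightarrow> ('b, 'n) star_algebra_scheme \<Rightarrow> ('a \<Rightarrow> 'b) set" where
  "star_iso A B = {\<phi> \<in> star_hom A B. bij_betw \<phi> (carrier A) (carrier B)}"


section \<open>The free unital *-algebra on a set of generators\<close>

text \<open>A letter \<open>(x, False)\<close> stands for the generator \<open>x\<close> and \<open>(x, True)\<close> for its adjoint. The free
  unital *-algebra is the monoid algebra over the complex numbers of the free monoid of words in
  these letters. The monoid is written additively because that is what the convolution product of
  \<open>Poly_Mapping\<close> expects.\<close>

datatype 'x star_word = Word (letters: "('x \<times> bool) list")

instantiation star_word :: (type) monoid_add
begin

definition "0 = Word []"
definition "v + w = Word (letters v @ letters w)"

instance
  by standard (auto simp: zero_star_word_def plus_star_word_def)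

end

type_synonym 'x free_star = "'x star_word \<Rightarrow>\<^sub>0 complex"

definition word_star :: "'x star_word \<Rightarrow> 'x star_word" where
  "word_star w = Word (rev (map (map_prod id Not) (letters w)))"

definition fgen :: "'x \<Rightarrow> 'x free_star" where
  "fgen x = Poly_Mapping.single (Word [(x, False)]) 1"

definition fscale :: "complex \<Rightarrow> 'x free_star \<Rightarrow> 'x free_star" where
  "fscale c f = Poly_Mapping.single 0 c * f"

text \<open>The conjugate-linear extension of the reversal of words.\<close>

definition fstar :: "'x free_star \<Rightarrow> 'x free_star" where
  "fstar f = (\<Sum>w\<in>Poly_Mapping.keys f.
     Poly_Mapping.single (word_star w) (cnj (Poly_Mapping.lookup f w)))"

definition free_carrier :: "'x set \<Rightarrow> 'x free_star set" where
  "free_carrier X = {f. \<forall>w\<in>Poly_Mapping.keys f. fst ` set (letters w) \<subseteq> X}"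

definition free_star_algebra :: "'x set \<Rightarrow> 'x free_star star_algebra" where
  "free_star_algebra X = \<lparr>carrier = free_carrier X, monoid.mult = (*), one = 1, zero = 0,
     add = (+), smult = fscale, adj = fstar\<rparr>"


section \<open>Universal C*-algebras given by generators and relations\<close>

text \<open>The universal unital C*-algebra with generators \<open>X\<close> and relations \<open>r = 0\<close> for \<open>r \<in> R\<close> is the
  Hausdorff completion of the free unital *-algebra on \<open>X\<close> in the supremum of all C*-seminorms
  that vanish on \<open>R\<close>. The supremum is only meaningful if these seminorms are pointwise bounded,
  i.e. bounded on each generator. In that case the result is indeed a C*-algebra with the expected
  universal property (\<open>cstar_algebra_universal_cstar\<close>, \<open>universal_map_relation\<close>,
  \<open>universal_map_dense\<close>, \<open>universal_cstar_universal\<close> below), and both presentations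
  considered here are bounded (\<open>bounded_ads\<close>, \<open>bounded_semigroup\<close>).\<close>

definition cstar_seminorm :: "'x set \<Rightarrow> ('x free_star \<Rightarrow> real) \<Rightarrow> bool" where
  "cstar_seminorm X p \<longleftrightarrow>
     (\<forall>f\<in>free_carrier X. 0 \<le> p f) \<and>
     (\<forall>f\<in>free_carrier X. \<forall>g\<in>free_carrier X. p (f + g) \<le> p f + p g) \<and>
     (\<forall>c. \<forall>f\<in>free_carrier X. p (fscale c f) = cmod c * p f) \<and>
     (\<forall>f\<in>free_carrier X. \<forall>g\<in>free_carrier X. p (f * g) \<le> p f * p g) \<and>
     (\<forall>f\<in>free_carrier X. p (fstar f * f) = (p f)\<^sup>2)"

definition admissible_seminorms :: "'x set \<Rightarrow> 'x free_star set \<Rightarrow> ('x free_star \<Rightarrow> real) set" where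
  "admissible_seminorms X R = {p. cstar_seminorm X p \<and> (\<forall>r\<in>R. p r = 0)}"

definition universal_seminorm :: "'x set \<Rightarrow> 'x free_star set \<Rightarrow> 'x free_star \<Rightarrow> real" where
  "universal_seminorm X R f = (SUP p\<in>admissible_seminorms X R. p f)"

definition cauchy_seqs ::
    "'x set \<Rightarrow> ('x free_star \<Rightarrow> real) \<Rightarrow> (nat \<Rightarrow> 'x free_star) set" where
  "cauchy_seqs X p = {x. (\<forall>n. x n \<in> free_carrier X) \<and>
     (\<forall>e>0. \<exists>M. \<forall>m\<ge>M. \<forall>n\<ge>M. p (x m - x n) < e)}"

definition cauchy_class ::
    "'x set \<Rightarrow> ('x free_star \<Rightarrow> real) \<Rightarrow> (nat \<Rightarrow> 'x free_star) \<Rightarrow> (nat \<Rightarrow> 'x free_star) set" where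
  "cauchy_class X p x = {y \<in> cauchy_seqs X p. (\<lambda>n. p (x n - y n)) \<longlonglongrightarrow> 0}"

definition class_rep :: "(nat \<Rightarrow> 'x free_star) set \<Rightarrow> nat \<Rightarrow> 'x free_star" where
  "class_rep a = (SOME x. x \<in> a)"

definition completion ::
    "'x set \<Rightarrow> ('x free_star \<Rightarrow> real) \<Rightarrow> (nat \<Rightarrow> 'x free_star) set cstar_algebra" where
  "completion X p = \<lparr>
     carrier = cauchy_class X p ` cauchy_seqs X p,
     monoid.mult = (\<lambda>a b. cauchy_class X p (\<lambda>n. class_rep a n * class_rep b n)),
     one = cauchy_class X p (\<lambda>n. 1),
     zero = cauchy_class X p (\<lambda>n. 0),
     add = (\<lambda>a b. cauchy_class X p (\<lambda>n. class_rep a n + class_rep b n)),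
     smult = (\<lambda>c a. cauchy_class X p (\<lambda>n. fscale c (class_rep a n))),
     adj = (\<lambda>a. cauchy_class X p (\<lambda>n. fstar (class_rep a n))),
     nrm = (\<lambda>a. lim (\<lambda>n. p (class_rep a n)))\<rparr>"

definition universal_cstar ::
    "'x set \<Rightarrow> 'x free_star set \<Rightarrow> (nat \<Rightarrow> 'x free_star) set cstar_algebra" where
  "universal_cstar X R = completion X (universal_seminorm X R)"

text \<open>The canonical *-homomorphism from the free unital *-algebra.\<close>

definition universal_map ::
    "'x set \<Rightarrow> 'x free_star set \<Rightarrow> 'x free_star \<Rightarrow> (nat \<Rightarrow> 'x free_star) set" where
  "universal_map X R f = cauchy_class X (universal_seminorm X R) (\<lambda>n. f)"


section \<open>Right LCM semigroups and algebraic dynamical systems\<close>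

locale left_cancellative_monoid = monoid S for S :: "('a, 'm) monoid_scheme" (structure) +
  assumes left_cancel:
    "p \<in> carrier S \<Longrightarrow> x \<in> carrier S \<Longrightarrow> y \<in> carrier S \<Longrightarrow> p \<otimes> x = p \<otimes> y \<Longrightarrow> x = y"

locale right_lcm_monoid = left_cancellative_monoid +
  assumes right_lcm:
    "p \<in> carrier S \<Longrightarrow> q \<in> carrier S \<Longrightarrow>
       (p <# carrier S) \<inter> (q <# carrier S) = {} \<or>
       (\<exists>r\<in>carrier S. (p <# carrier S) \<inter> (q <# carrier S) = r <# carrier S)"

locale algebraic_dynamical_system =
  G: group G + P: right_lcm_monoid P
  for G :: "('g, 'm) monoid_scheme" and P :: "('p, 'n) monoid_scheme"
    and \<theta> :: "'p \<Rightarrow> 'g \<Rightarrow> 'g" +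
  assumes countable_G: "countable (carrier G)"
    and countable_P: "countable (carrier P)"
    and action_hom: "p \<in> carrier P \<Longrightarrow> \<theta> p \<in> hom G G"
    and action_inj: "p \<in> carrier P \<Longrightarrow> inj_on (\<theta> p) (carrier G)"
    and action_one: "g \<in> carrier G \<Longrightarrow> \<theta> \<one>\<^bsub>P\<^esub> g = g"
    and action_mult: "p \<in> carrier P \<Longrightarrow> q \<in> carrier P \<Longrightarrow> g \<in> carrier G \<Longrightarrow>
        \<theta> (p \<otimes>\<^bsub>P\<^esub> q) g = \<theta> p (\<theta> q g)"
    and action_lcm: "p \<in> carrier P \<Longrightarrow> q \<in> carrier P \<Longrightarrow> r \<in> carrier P \<Longrightarrow>
        (p <#\<^bsub>P\<^esub> carrier P) \<inter> (q <#\<^bsub>P\<^esub> carrier P) = r <#\<^bsub>P\<^esub> carrier P \<Longrightarrow>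
        \<theta> p ` carrier G \<inter> \<theta> q ` carrier G = \<theta> r ` carrier G"

definition semidirect ::
    "('g, 'm) monoid_scheme \<Rightarrow> ('p, 'n) monoid_scheme \<Rightarrow> ('p \<Rightarrow> 'g \<Rightarrow> 'g) \<Rightarrow> ('g \<times> 'p) monoid" where
  "semidirect G P \<theta> = \<lparr>carrier = carrier G \<times> carrier P,
     monoid.mult = (\<lambda>(g, p) (h, q). (g \<otimes>\<^bsub>G\<^esub> \<theta> p h, p \<otimes>\<^bsub>P\<^esub> q)),
     one = (\<one>\<^bsub>G\<^esub>, \<one>\<^bsub>P\<^esub>)\<rparr>"


section \<open>The C*-algebra of an algebraic dynamical system\<close>

datatype ('g, 'p) ads_gen = UGen 'g | SGen 'p

abbreviation fu :: "'g \<Rightarrow> ('g, 'p) ads_gen free_star" where "fu g \<equiv> fgen (UGen g)"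
abbreviation fs :: "'p \<Rightarrow> ('g, 'p) ads_gen free_star" where "fs p \<equiv> fgen (SGen p)"

definition ads_gens ::
    "('g, 'm) monoid_scheme \<Rightarrow> ('p, 'n) monoid_scheme \<Rightarrow> ('g, 'p) ads_gen set" where
  "ads_gens G P = UGen ` carrier G \<union> SGen ` carrier P"

definition lcm_factorization ::
    "('g, 'm) monoid_scheme \<Rightarrow> ('p, 'n) monoid_scheme \<Rightarrow> ('p \<Rightarrow> 'g \<Rightarrow> 'g) \<Rightarrow>
     'p \<Rightarrow> 'p \<Rightarrow> 'g \<Rightarrow> 'g \<Rightarrow> 'p \<Rightarrow> 'p \<Rightarrow> 'g \<Rightarrow> bool" where
  "lcm_factorization G P \<theta> p q g k p' q' l \<longleftrightarrow>
     p' \<in> carrier P \<and> q' \<in> carrier P \<and> k \<in> carrier G \<and> l \<in> carrier G \<and>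
     (\<exists>r\<in>carrier P. (p <#\<^bsub>P\<^esub> carrier P) \<inter> (q <#\<^bsub>P\<^esub> carrier P) = r <#\<^bsub>P\<^esub> carrier P \<and>
        p \<otimes>\<^bsub>P\<^esub> p' = r \<and> q \<otimes>\<^bsub>P\<^esub> q' = r) \<and>
     g = \<theta> p k \<otimes>\<^bsub>G\<^esub> \<theta> q (inv\<^bsub>G\<^esub> l)"

text \<open>The first three sets say that \<open>u\<close> is a unitary representation (\<open>u\<close> of the identity is then
  automatically 1), the next two that \<open>s\<close> is a representation by isometries, and the last three are
  (A1) and the two cases of (A2). The relation (A2) is imposed for every choice of the auxiliary
  elements.\<close>

definition ads_relations ::
    "('g, 'm) monoid_scheme \<Rightarrow> ('p, 'n) monoid_scheme \<Rightarrow> ('p \<Rightarrow> 'g \<Rightarrow> 'g) \<Rightarrow>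
     ('g, 'p) ads_gen free_star set" where
  "ads_relations G P \<theta> =
     {fu g * fu h - fu (g \<otimes>\<^bsub>G\<^esub> h) | g h. g \<in> carrier G \<and> h \<in> carrier G} \<union>
     {fstar (fu g) * fu g - 1 | g. g \<in> carrier G} \<union>
     {fu g * fstar (fu g) - 1 | g. g \<in> carrier G} \<union>
     {fs p * fs q - fs (p \<otimes>\<^bsub>P\<^esub> q) | p q. p \<in> carrier P \<and> q \<in> carrier P} \<union>
     {fstar (fs p) * fs p - 1 | p. p \<in> carrier P} \<union>
     {fs p * fu g - fu (\<theta> p g) * fs p | p g. p \<in> carrier P \<and> g \<in> carrier G} \<union>
     {fstar (fs p) * fu g * fs q - fu k * fs p' * fstar (fs q') * fstar (fu l) | p q g k p' q' l.
        p \<in> carrier P \<and> q \<in> carrier P \<and> g \<in> carrier G \<and>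
        lcm_factorization G P \<theta> p q g k p' q' l} \<union>
     {fstar (fs p) * fu g * fs q | p q g.
        p \<in> carrier P \<and> q \<in> carrier P \<and> g \<in> carrier G \<and>
        (\<nexists>k p' q' l. lcm_factorization G P \<theta> p q g k p' q' l)}"

definition ads_cstar where
  "ads_cstar G P \<theta> = universal_cstar (ads_gens G P) (ads_relations G P \<theta>)"

definition ads_u where
  "ads_u G P \<theta> g = universal_map (ads_gens G P) (ads_relations G P \<theta>) (fu g)"

definition ads_s where
  "ads_s G P \<theta> p = universal_map (ads_gens G P) (ads_relations G P \<theta>) (fs p)"


section \<open>The full C*-algebra of a left cancellative semigroup\<close>

inductive_set constructible_ideals :: "('a, 'm) monoid_scheme \<Rightarrow> 'a set set"
  for S :: "('a, 'm) monoid_scheme" where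
  carrier: "carrier S \<in> constructible_ideals S"
| empty: "{} \<in> constructible_ideals S"
| image: "p \<in> carrier S \<Longrightarrow> X \<in> constructible_ideals S \<Longrightarrow> p <#\<^bsub>S\<^esub> X \<in> constructible_ideals S"
| preimage: "p \<in> carrier S \<Longrightarrow> X \<in> constructible_ideals S \<Longrightarrow>
    {y \<in> carrier S. p \<otimes>\<^bsub>S\<^esub> y \<in> X} \<in> constructible_ideals S"

datatype 'a semigroup_gen = VGen 'a | EGen "'a set"

abbreviation fv :: "'a \<Rightarrow> 'a semigroup_gen free_star" where "fv p \<equiv> fgen (VGen p)"
abbreviation fe :: "'a set \<Rightarrow> 'a semigroup_gen free_star" where "fe X \<equiv> fgen (EGen X)"

definition semigroup_gens :: "('a, 'm) monoid_scheme \<Rightarrow> 'a semigroup_gen set" where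
  "semigroup_gens S = VGen ` carrier S \<union> EGen ` constructible_ideals S"

text \<open>The first three sets say that the \<open>v\<close> are isometries and the \<open>e\<close> are projections.\<close>

definition semigroup_relations :: "('a, 'm) monoid_scheme \<Rightarrow> 'a semigroup_gen free_star set" where
  "semigroup_relations S =
     {fstar (fv p) * fv p - 1 | p. p \<in> carrier S} \<union>
     {fstar (fe X) - fe X | X. X \<in> constructible_ideals S} \<union>
     {fe X * fe X - fe X | X. X \<in> constructible_ideals S} \<union>
     {fv p * fv q - fv (p \<otimes>\<^bsub>S\<^esub> q) | p q. p \<in> carrier S \<and> q \<in> carrier S} \<union>
     {fv p * fe X * fstar (fv p) - fe (p <#\<^bsub>S\<^esub> X) | p X.
        p \<in> carrier S \<and> X \<in> constructible_ideals S} \<union>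
     {fe {}, fe (carrier S) - 1} \<union>
     {fe X * fe Y - fe (X \<inter> Y) | X Y.
        X \<in> constructible_ideals S \<and> Y \<in> constructible_ideals S}"

definition semigroup_cstar where
  "semigroup_cstar S = universal_cstar (semigroup_gens S) (semigroup_relations S)"

definition semigroup_v where
  "semigroup_v S p = universal_map (semigroup_gens S) (semigroup_relations S) (fv p)"


section \<open>The free unital *-algebra: basic facts\<close>

lemma word_star_word_star [simp]: "word_star (word_star w) = w"
  by (cases w) (simp add: word_star_def rev_map [symmetric] o_def map_prod_def case_prod_beta)

lemma word_star_0 [simp]: "word_star 0 = 0"
  by (simp add: word_star_def zero_star_word_def)

lemma word_star_plus: "word_star (v + w) = word_star w + word_star v"
  by (simp add: word_star_def plus_star_word_def)

lemma free_induct [case_names single add]: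
  fixes f :: "'x free_star"
  assumes single: "\<And>w c. P (Poly_Mapping.single w c)"
    and add: "\<And>f g. P f \<Longrightarrow> P g \<Longrightarrow> P (f + g)"
  shows "P f"
proof (induction f rule: update_induct)
  case const
  show ?case using single [of undefined 0] by simp
next
  case (update f a b)
  have "Poly_Mapping.update a b f = f + Poly_Mapping.single a b"
    using update.hyps by (intro poly_mapping_eqI)
      (auto simp: lookup_update lookup_add lookup_single in_keys_iff when_def)
  then show ?case using update single add by simp
qed

lemma lookup_fstar: "Poly_Mapping.lookup (fstar f) w = cnj (Poly_Mapping.lookup f (word_star w))"
proof -
  have eq: "word_star v = w \<longleftrightarrow> v = word_star w" for v
    by auto
  show ?thesis
    by (cases "word_star w \<in> Poly_Mapping.keys f")
       (auto simp: fstar_def lookup_sum lookup_single when_def eq in_keys_iff sum.delta)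
qed

lemma fstar_add: "fstar (f + g) = fstar f + fstar g"
  by (rule poly_mapping_eqI) (simp add: lookup_fstar lookup_add)

lemma fstar_diff: "fstar (f - g) = fstar f - fstar g"
  by (rule poly_mapping_eqI) (simp add: lookup_fstar lookup_minus)

lemma fstar_fstar: "fstar (fstar f) = f"
  by (rule poly_mapping_eqI) (simp add: lookup_fstar)

lemma fstar_single:
  "fstar (Poly_Mapping.single w c) = Poly_Mapping.single (word_star w) (cnj c)"
proof -
  have eq: "w = word_star v \<longleftrightarrow> word_star w = v" for v
    by auto
  show ?thesis
    by (rule poly_mapping_eqI) (simp add: lookup_fstar lookup_single when_def eq)
qed

lemma fstar_1: "fstar 1 = 1"
proof -
  have "fstar (Poly_Mapping.single 0 1) = Poly_Mapping.single 0 1"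
    by (simp only: fstar_single word_star_0 complex_cnj_one)
  then show ?thesis by simp
qed

lemma fstar_mult: "fstar (f * g) = fstar g * fstar f"
proof (induction f rule: free_induct)
  case (single v c)
  show ?case
  proof (induction g rule: free_induct)
    case (single w d)
    show ?case by (simp add: fstar_single mult_single word_star_plus mult.commute)
  next
    case (add f g)
    then show ?case by (simp add: fstar_add algebra_simps)
  qed
next
  case (add f g)
  then show ?case by (simp add: fstar_add algebra_simps)
qed

lemma single_0_commute: "f * Poly_Mapping.single 0 c = Poly_Mapping.single 0 c * (f :: 'x free_star)"
  by (induction f rule: free_induct) (simp_all add: mult_single mult.commute algebra_simps)

lemma fscale_add: "fscale c (f + g) = fscale c f + fscale c g"
  by (simp add: fscale_def algebra_simps)

lemma fscale_diff: "fscale c (f - g) = fscale c f - fscale c g"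
  by (simp add: fscale_def algebra_simps)

lemma fscale_add_left: "fscale (c + d) f = fscale c f + fscale d f"
  by (simp add: fscale_def algebra_simps single_add)

lemma fscale_fscale: "fscale c (fscale d f) = fscale (c * d) f"
  by (simp add: fscale_def mult_single flip: mult.assoc)

lemma fscale_1: "fscale 1 f = f"
  by (simp add: fscale_def)

lemma fscale_minus_1: "fscale (-1) f = - f"
  by (simp add: fscale_def single_uminus)

lemma fscale_mult_left: "fscale c f * g = fscale c (f * g)"
  by (simp add: fscale_def mult.assoc)

lemma fscale_mult_right: "f * fscale c g = fscale c (f * g)"
  by (simp add: fscale_def single_0_commute flip: mult.assoc)

lemma fstar_fscale: "fstar (fscale c f) = fscale (cnj c) (fstar f)"
  by (simp add: fscale_def fstar_mult fstar_single single_0_commute)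

lemma free_0: "0 \<in> free_carrier X"
  by (simp add: free_carrier_def)

lemma free_single: "fst ` set (letters w) \<subseteq> X \<Longrightarrow> Poly_Mapping.single w c \<in> free_carrier X"
  by (simp add: free_carrier_def)

lemma free_fgen: "x \<in> X \<Longrightarrow> fgen x \<in> free_carrier X"
  by (simp add: free_carrier_def fgen_def)

lemma free_1: "1 \<in> free_carrier X"
  by (simp add: free_carrier_def zero_star_word_def)

lemma free_add: "f \<in> free_carrier X \<Longrightarrow> g \<in> free_carrier X \<Longrightarrow> f + g \<in> free_carrier X"
  unfolding free_carrier_def using Poly_Mapping.keys_add [of f g] by blast

lemma free_mult:
  assumes "f \<in> free_carrier X" "g \<in> free_carrier X" shows "f * g \<in> free_carrier X"
proof -
  have "fst ` set (letters w) \<subseteq> X" if w: "w \<in> Poly_Mapping.keys (f * g)" for w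
  proof -
    obtain a b where "w = a + b" "a \<in> Poly_Mapping.keys f" "b \<in> Poly_Mapping.keys g"
      using keys_mult [of f g] w by blast
    then show ?thesis
      using assms unfolding free_carrier_def plus_star_word_def
      by (simp add: image_Un)
  qed
  then show ?thesis by (simp add: free_carrier_def)
qed

lemma free_fscale: "f \<in> free_carrier X \<Longrightarrow> fscale c f \<in> free_carrier X"
  unfolding fscale_def by (intro free_mult free_single) (simp add: zero_star_word_def)

lemma free_minus: "f \<in> free_carrier X \<Longrightarrow> - f \<in> free_carrier X"
  using free_fscale [of f X "-1"] by (simp add: fscale_minus_1)

lemma free_diff: "f \<in> free_carrier X \<Longrightarrow> g \<in> free_carrier X \<Longrightarrow> f - g \<in> free_carrier X"
  using free_add [of f X "- g"] free_minus by auto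

lemma free_fstar:
  assumes "f \<in> free_carrier X" shows "fstar f \<in> free_carrier X"
proof -
  have "fst ` set (letters w) \<subseteq> X" if "w \<in> Poly_Mapping.keys (fstar f)" for w
  proof -
    have "word_star w \<in> Poly_Mapping.keys f"
      using that by (simp add: in_keys_iff lookup_fstar)
    then have "fst ` set (letters (word_star w)) \<subseteq> X"
      using assms by (simp add: free_carrier_def)
    then show ?thesis
      by (simp add: word_star_def image_image)
  qed
  then show ?thesis by (simp add: free_carrier_def)
qed

lemmas free_closed = free_0 free_1 free_fgen free_add free_diff free_minus free_mult free_fscale
  free_fstar

lemma free_carrier_induct [consumes 1, case_names gen one zero add mult fscale fstar]:
  assumes f: "f \<in> free_carrier X"
    and gen: "\<And>x. x \<in> X \<Longrightarrow> P (fgen x)"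
    and one: "P 1" and zero: "P 0"
    and add: "\<And>f g. f \<in> free_carrier X \<Longrightarrow> g \<in> free_carrier X \<Longrightarrow> P f \<Longrightarrow> P g \<Longrightarrow> P (f + g)"
    and mult: "\<And>f g. f \<in> free_carrier X \<Longrightarrow> g \<in> free_carrier X \<Longrightarrow> P f \<Longrightarrow> P g \<Longrightarrow> P (f * g)"
    and fscale: "\<And>c f. f \<in> free_carrier X \<Longrightarrow> P f \<Longrightarrow> P (fscale c f)"
    and fstar: "\<And>f. f \<in> free_carrier X \<Longrightarrow> P f \<Longrightarrow> P (fstar f)"
  shows "P f"
proof -
  have word: "P (Poly_Mapping.single (Word l) 1)" if "fst ` set l \<subseteq> X" for l
    using that
  proof (induction l)
    case Nil
    then show ?case using one by (simp flip: zero_star_word_def)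
  next
    case (Cons a l)
    obtain x b where a: "a = (x, b)" by fastforce
    have x: "x \<in> X" and l: "Poly_Mapping.single (Word l) 1 \<in> free_carrier X"
      using Cons.prems a by (simp_all add: free_single)
    define h :: "'a free_star" where "h = (if b then fstar (fgen x) else fgen x)"
    have h: "h \<in> free_carrier X" "P h"
      using x gen fstar by (auto simp: h_def free_closed)
    have "h = Poly_Mapping.single (Word [a]) 1"
      by (simp add: h_def a fgen_def fstar_single word_star_def)
    then have "Poly_Mapping.single (Word (a # l)) 1 = h * Poly_Mapping.single (Word l) 1"
      by (simp add: mult_single plus_star_word_def)
    then show ?case
      using mult [OF h(1) l h(2)] Cons by simp
  qed
  have mono: "Poly_Mapping.single w c \<in> free_carrier X \<and> P (Poly_Mapping.single w c)"
    if "fst ` set (letters w) \<subseteq> X" for w c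
  proof -
    have "Poly_Mapping.single w c = fscale c (Poly_Mapping.single (Word (letters w)) 1)"
      by (simp add: fscale_def mult_single)
    moreover have "Poly_Mapping.single (Word (letters w)) 1 \<in> free_carrier X"
      using that by (intro free_single) simp
    ultimately show ?thesis
      using fscale [of "Poly_Mapping.single w 1" c] word [of "letters w"] that
      by (simp add: free_fscale)
  qed
  have sum: "(\<Sum>w\<in>A. Poly_Mapping.single w (c w)) \<in> free_carrier X \<and>
      P (\<Sum>w\<in>A. Poly_Mapping.single w (c w))"
    if "finite A" "A \<subseteq> Poly_Mapping.keys f" for A and c :: "'a star_word \<Rightarrow> complex"
    using that
  proof (induction A rule: finite_induct)
    case empty
    then show ?case by (simp add: zero free_0)
  next
    case (insert w A)
    then have "fst ` set (letters w) \<subseteq> X"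
      using f by (auto simp: free_carrier_def)
    from mono [OF this] insert show ?case
      by (auto intro: add free_add)
  qed
  have "f = (\<Sum>w\<in>Poly_Mapping.keys f. Poly_Mapping.single w (Poly_Mapping.lookup f w))"
    by (rule poly_mapping_eqI) (auto simp: lookup_sum lookup_single when_def sum.delta in_keys_iff)
  then show ?thesis
    using sum [OF finite_keys order_refl, of "Poly_Mapping.lookup f"] by simp
qed


section \<open>The completion is a C*-algebra\<close>

locale cstar_seminormed =
  fixes X :: "'x set" and p :: "'x free_star \<Rightarrow> real"
  assumes seminorm: "cstar_seminorm X p"
begin

abbreviation "F \<equiv> free_carrier X"

lemma p_nonneg: "f \<in> F \<Longrightarrow> 0 \<le> p f"
  and p_add: "f \<in> F \<Longrightarrow> g \<in> F \<Longrightarrow> p (f + g) \<le> p f + p g"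
  and p_fscale: "f \<in> F \<Longrightarrow> p (fscale c f) = cmod c * p f"
  and p_mult: "f \<in> F \<Longrightarrow> g \<in> F \<Longrightarrow> p (f * g) \<le> p f * p g"
  and p_cstar: "f \<in> F \<Longrightarrow> p (fstar f * f) = (p f)\<^sup>2"
  using seminorm unfolding cstar_seminorm_def by blast+

lemma p_0 [simp]: "p 0 = 0"
  using p_fscale [of 0 0] by (simp add: fscale_def free_0)

lemma p_minus: "f \<in> F \<Longrightarrow> p (- f) = p f"
  using p_fscale [of f "-1"] by (simp add: fscale_minus_1)

lemma p_diff: "f \<in> F \<Longrightarrow> g \<in> F \<Longrightarrow> p (f - g) \<le> p f + p g"
  using p_add [of f "- g"] by (simp add: p_minus free_minus)

lemma p_diff_commute: "f \<in> F \<Longrightarrow> g \<in> F \<Longrightarrow> p (f - g) = p (g - f)"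
  using p_minus [of "f - g"] by (simp add: free_diff)

lemma p_triangle: "f \<in> F \<Longrightarrow> g \<in> F \<Longrightarrow> h \<in> F \<Longrightarrow> p (f - h) \<le> p (f - g) + p (g - h)"
  using p_add [of "f - g" "g - h"] by (simp add: free_diff)

lemma p_abs_diff: "f \<in> F \<Longrightarrow> g \<in> F \<Longrightarrow> \<bar>p f - p g\<bar> \<le> p (f - g)"
  using p_add [of "f - g" g] p_add [of "g - f" f] by (simp add: free_diff p_diff_commute [of g f])

lemma p_fstar: "f \<in> F \<Longrightarrow> p (fstar f) = p f"
proof -
  have le: "p f \<le> p (fstar f)" if "f \<in> F" for f
  proof -
    have "p f * p f \<le> p (fstar f) * p f"
      using p_cstar [OF that] p_mult [of "fstar f" f] that by (simp add: free_fstar power2_eq_square)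
    then show ?thesis
      using p_nonneg [OF that] p_nonneg [OF free_fstar [OF that]]
      by (cases "p f = 0") (auto simp: mult_le_cancel_right)
  qed
  assume "f \<in> F"
  then show ?thesis
    using le [of f] le [of "fstar f"] by (simp add: free_fstar fstar_fstar)
qed

abbreviation "C \<equiv> cauchy_seqs X p"
abbreviation "cls \<equiv> cauchy_class X p"
abbreviation "eqv x y \<equiv> (\<lambda>n. p (x n - y n)) \<longlonglongrightarrow> 0"
abbreviation "K \<equiv> completion X p"

lemma C_free: "x \<in> C \<Longrightarrow> x n \<in> F"
  by (simp add: cauchy_seqs_def)

lemma C_I:
  assumes "\<And>n. x n \<in> F" "\<And>e. 0 < e \<Longrightarrow> \<exists>M. \<forall>m\<ge>M. \<forall>n\<ge>M. p (x m - x n) < e"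
  shows "x \<in> C"
  using assms by (simp add: cauchy_seqs_def)

lemma C_D:
  assumes "x \<in> C" "0 < e"
  obtains M where "\<And>m n. m \<ge> M \<Longrightarrow> n \<ge> M \<Longrightarrow> p (x m - x n) < e"
  using assms unfolding cauchy_seqs_def by blast

lemma C_const: "f \<in> F \<Longrightarrow> (\<lambda>n. f) \<in> C"
  by (rule C_I) auto

lemma C_bounded:
  assumes "x \<in> C"
  obtains B where "0 < B" "\<And>n. p (x n) \<le> B"
proof -
  obtain M where M: "\<And>m n. m \<ge> M \<Longrightarrow> n \<ge> M \<Longrightarrow> p (x m - x n) < 1"
    using C_D [OF assms] by (metis zero_less_one)
  have 1: "p (x n) \<le> 1 + p (x M)" if "n \<ge> M" for n
    using p_abs_diff [OF C_free C_free, OF assms assms, of n M] M [OF that order_refl] by linarith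
  define B where "B = 1 + p (x M) + (\<Sum>n<M. p (x n))"
  have s: "0 \<le> (\<Sum>n<M. p (x n))"
    by (intro sum_nonneg p_nonneg C_free assms)
  show ?thesis
  proof
    show "0 < B"
      using p_nonneg [OF C_free [OF assms, of M]] s by (simp add: B_def)
    show "p (x n) \<le> B" for n
    proof (cases "n < M")
      case True
      then have "p (x n) \<le> (\<Sum>n<M. p (x n))"
        by (intro member_le_sum p_nonneg C_free assms) auto
      then show ?thesis
        using p_nonneg [OF C_free [OF assms, of M]] by (simp add: B_def)
    next
      case False
      then show ?thesis using 1 [of n] s by (simp add: B_def)
    qed
  qed
qed

lemma C_dominated:
  assumes x: "x \<in> C" and y: "y \<in> C" and zF: "\<And>n. z n \<in> F"
    and le: "\<And>m n. p (z m - z n) \<le> B * p (x m - x n) + D * p (y m - y n)"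
    and "0 < B" "0 < D"
  shows "z \<in> C"
proof (rule C_I [OF zF])
  fix e :: real
  assume "0 < e"
  obtain M1 where M1: "\<And>m n. m \<ge> M1 \<Longrightarrow> n \<ge> M1 \<Longrightarrow> p (x m - x n) < e / (2 * B)"
    using C_D [OF x, of "e / (2 * B)"] \<open>0 < e\<close> \<open>0 < B\<close> by auto
  obtain M2 where M2: "\<And>m n. m \<ge> M2 \<Longrightarrow> n \<ge> M2 \<Longrightarrow> p (y m - y n) < e / (2 * D)"
    using C_D [OF y, of "e / (2 * D)"] \<open>0 < e\<close> \<open>0 < D\<close> by auto
  have "p (z m - z n) < e" if "m \<ge> max M1 M2" "n \<ge> max M1 M2" for m n
  proof -
    have "B * p (x m - x n) < e / 2" "D * p (y m - y n) < e / 2"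
      using M1 [of m n] M2 [of m n] that \<open>0 < B\<close> \<open>0 < D\<close> by (auto simp: field_simps)
    then show ?thesis using le [of m n] by linarith
  qed
  then show "\<exists>M. \<forall>m\<ge>M. \<forall>n\<ge>M. p (z m - z n) < e" by blast
qed

lemma C_add:
  assumes "x \<in> C" "y \<in> C"
  shows "(\<lambda>n. x n + y n) \<in> C"
proof (rule C_dominated [OF assms, where B = 1 and D = 1])
  show "p (x m + y m - (x n + y n)) \<le> 1 * p (x m - x n) + 1 * p (y m - y n)" for m n
    using p_add [of "x m - x n" "y m - y n"] assms by (simp add: C_free free_closed add_diff_add)
qed (use assms in \<open>auto simp: C_free free_closed\<close>)

lemma p_mult_diff:
  assumes "a \<in> F" "b \<in> F" "c \<in> F" "d \<in> F"
  shows "p (a * b - c * d) \<le> p a * p (b - d) + p (a - c) * p d"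
proof -
  have "a * b - c * d = a * (b - d) + (a - c) * d"
    by (simp add: algebra_simps)
  then show ?thesis
    using p_add [of "a * (b - d)" "(a - c) * d"] p_mult [of a "b - d"] p_mult [of "a - c" d] assms
    by (simp add: free_closed)
qed

lemma C_mult:
  assumes "x \<in> C" "y \<in> C"
  shows "(\<lambda>n. x n * y n) \<in> C"
proof -
  obtain B where B: "0 < B" "\<And>n. p (x n) \<le> B" using C_bounded [OF assms(1)] by blast
  obtain D where D: "0 < D" "\<And>n. p (y n) \<le> D" using C_bounded [OF assms(2)] by blast
  show ?thesis
  proof (rule C_dominated [OF assms, where B = D and D = B])
    fix m n
    have F: "x m \<in> F" "x n \<in> F" "y m \<in> F" "y n \<in> F"
      using assms by (auto simp: C_free)
    have "p (x m) * p (y m - y n) \<le> B * p (y m - y n)"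
      "p (x m - x n) * p (y n) \<le> p (x m - x n) * D"
      using B D F by (auto intro!: mult_right_mono mult_left_mono p_nonneg free_diff)
    then show "p (x m * y m - x n * y n) \<le> D * p (x m - x n) + B * p (y m - y n)"
      using p_mult_diff [of "x m" "y m" "x n" "y n"] F by (simp add: mult.commute)
  qed (use assms B D in \<open>auto simp: C_free free_closed\<close>)
qed

lemma C_fscale: "x \<in> C \<Longrightarrow> (\<lambda>n. fscale c (x n)) \<in> C"
  using C_mult [OF C_const [of "fscale c 1"], of x]
  by (simp add: free_closed fscale_mult_left)

lemma C_fstar: "x \<in> C \<Longrightarrow> (\<lambda>n. fstar (x n)) \<in> C"
  unfolding cauchy_seqs_def by (simp add: free_fstar p_fstar free_diff flip: fstar_diff)

lemma C_minus: "x \<in> C \<Longrightarrow> (\<lambda>n. - x n) \<in> C"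
  using C_fscale [of x "-1"] by (simp add: fscale_minus_1)

lemma C_diff: "x \<in> C \<Longrightarrow> y \<in> C \<Longrightarrow> (\<lambda>n. x n - y n) \<in> C"
  using C_add [OF _ C_minus, of x y] by simp

lemmas C_closed = C_const C_add C_mult C_fscale C_fstar C_minus C_diff

lemma eqv_refl: "eqv x x"
  by simp

lemma C_diff_commute: "x \<in> C \<Longrightarrow> y \<in> C \<Longrightarrow> p (x n - y n) = p (y n - x n)"
  by (intro p_diff_commute C_free)

lemma eqv_sym:
  assumes "x \<in> C" "y \<in> C" "eqv x y"
  shows "eqv y x"
  using assms(3) C_diff_commute [OF assms(1,2)] by (simp only:)

lemma null_dominated:
  assumes "\<And>n. f n \<in> F" "\<And>n. p (f n) \<le> b n" "b \<longlonglongrightarrow> 0"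
  shows "(\<lambda>n. p (f n)) \<longlonglongrightarrow> 0"
proof (rule tendsto_sandwich [OF _ _ tendsto_const assms(3)])
  show "\<forall>\<^sub>F n in sequentially. 0 \<le> p (f n)"
    using p_nonneg [OF assms(1)] by simp
  show "\<forall>\<^sub>F n in sequentially. p (f n) \<le> b n"
    using assms(2) by simp
qed

lemma eqv_trans:
  assumes "x \<in> C" "y \<in> C" "z \<in> C" "eqv x y" "eqv y z"
  shows "eqv x z"
proof (rule null_dominated [OF _ _ tendsto_add_zero [OF assms(4,5)]])
  show "x n - z n \<in> F" for n
    by (intro free_diff C_free assms)
  show "p (x n - z n) \<le> p (x n - y n) + p (y n - z n)" for n
    by (intro p_triangle C_free assms)
qed

lemma eqv_add:
  assumes "x \<in> C" "y \<in> C" "x' \<in> C" "y' \<in> C" "eqv x x'" "eqv y y'"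
  shows "eqv (\<lambda>n. x n + y n) (\<lambda>n. x' n + y' n)"
proof (rule null_dominated [OF _ _ tendsto_add_zero [OF assms(5,6)]])
  show "p (x n + y n - (x' n + y' n)) \<le> p (x n - x' n) + p (y n - y' n)" for n
    using p_add [of "x n - x' n" "y n - y' n"] assms by (simp add: C_free free_closed add_diff_add)
qed (use assms in \<open>auto simp: C_free free_closed\<close>)

lemma eqv_mult:
  assumes "x \<in> C" "y \<in> C" "x' \<in> C" "y' \<in> C" "eqv x x'" "eqv y y'"
  shows "eqv (\<lambda>n. x n * y n) (\<lambda>n. x' n * y' n)"
proof -
  obtain B where B: "0 < B" "\<And>n. p (x n) \<le> B" using C_bounded [OF assms(1)] by blast
  obtain D where D: "0 < D" "\<And>n. p (y' n) \<le> D" using C_bounded [OF assms(4)] by blast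
  show ?thesis
  proof (rule null_dominated [where b = "\<lambda>n. B * p (y n - y' n) + p (x n - x' n) * D"])
    fix n
    have F: "x n \<in> F" "x' n \<in> F" "y n \<in> F" "y' n \<in> F"
      using assms by (auto simp: C_free)
    show "x n * y n - x' n * y' n \<in> F"
      using F by (simp add: free_closed)
    have "p (x n) * p (y n - y' n) \<le> B * p (y n - y' n)"
      "p (x n - x' n) * p (y' n) \<le> p (x n - x' n) * D"
      using B D F by (auto intro!: mult_right_mono mult_left_mono p_nonneg free_diff)
    then show "p (x n * y n - x' n * y' n) \<le> B * p (y n - y' n) + p (x n - x' n) * D"
      using p_mult_diff [of "x n" "y n" "x' n" "y' n"] F by simp
  next
    show "(\<lambda>n. B * p (y n - y' n) + p (x n - x' n) * D) \<longlonglongrightarrow> 0"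
      using tendsto_add_zero [OF tendsto_mult_right_zero [OF assms(6)] tendsto_mult_left_zero [OF assms(5)]] .
  qed
qed

lemma eqv_fscale:
  assumes "x \<in> C" "x' \<in> C" "eqv x x'"
  shows "eqv (\<lambda>n. fscale c (x n)) (\<lambda>n. fscale c (x' n))"
proof -
  have "p (fscale c (x n) - fscale c (x' n)) = cmod c * p (x n - x' n)" for n
    using assms by (simp add: p_fscale C_free free_diff flip: fscale_diff)
  then show ?thesis
    using tendsto_mult_right_zero [OF assms(3), of "cmod c"] by (simp only:)
qed

lemma eqv_fstar:
  assumes "x \<in> C" "x' \<in> C" "eqv x x'"
  shows "eqv (\<lambda>n. fstar (x n)) (\<lambda>n. fstar (x' n))"
proof -
  have "p (fstar (x n) - fstar (x' n)) = p (x n - x' n)" for n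
    using assms by (simp add: p_fstar C_free free_diff flip: fstar_diff)
  then show ?thesis
    using assms(3) by (simp only:)
qed

lemma cls_eq_iff:
  assumes "x \<in> C" "y \<in> C"
  shows "cls x = cls y \<longleftrightarrow> eqv x y"
proof
  assume eq: "cls x = cls y"
  have "y \<in> cls y"
    using assms by (simp add: cauchy_class_def)
  then have "y \<in> cls x"
    by (simp only: eq)
  then show "eqv x y"
    by (simp add: cauchy_class_def)
next
  assume xy: "eqv x y"
  have "eqv x z \<longleftrightarrow> eqv y z" if "z \<in> C" for z
    using eqv_trans [OF assms that xy] eqv_trans [OF assms(2,1) that eqv_sym [OF assms xy]] by blast
  then show "cls x = cls y"
    unfolding cauchy_class_def by blast
qed

lemma class_rep_cls:
  assumes "x \<in> C"
  shows "class_rep (cls x) \<in> C" "eqv x (class_rep (cls x))"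
proof -
  have "x \<in> cls x"
    using assms by (simp add: cauchy_class_def)
  then have "class_rep (cls x) \<in> cls x"
    unfolding class_rep_def by (rule someI [of "\<lambda>z. z \<in> cls x"])
  then show "class_rep (cls x) \<in> C" "eqv x (class_rep (cls x))"
    by (auto simp: cauchy_class_def)
qed

lemma carrier_K: "carrier K = cls ` C"
  and one_K: "\<one>\<^bsub>K\<^esub> = cls (\<lambda>n. 1)"
  and zero_K: "\<zero>\<^bsub>K\<^esub> = cls (\<lambda>n. 0)"
  by (simp_all add: completion_def)

lemma add_K:
  assumes "x \<in> C" "y \<in> C"
  shows "cls x \<oplus>\<^bsub>K\<^esub> cls y = cls (\<lambda>n. x n + y n)"
proof -
  have "cls (\<lambda>n. x n + y n) = cls (\<lambda>n. class_rep (cls x) n + class_rep (cls y) n)"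
    by (intro cls_eq_iff [THEN iffD2] C_add eqv_add class_rep_cls assms)
  then show ?thesis by (simp add: completion_def)
qed

lemma mult_K:
  assumes "x \<in> C" "y \<in> C"
  shows "cls x \<otimes>\<^bsub>K\<^esub> cls y = cls (\<lambda>n. x n * y n)"
proof -
  have "cls (\<lambda>n. x n * y n) = cls (\<lambda>n. class_rep (cls x) n * class_rep (cls y) n)"
    by (intro cls_eq_iff [THEN iffD2] C_mult eqv_mult class_rep_cls assms)
  then show ?thesis by (simp add: completion_def)
qed

lemma smult_K:
  assumes "x \<in> C"
  shows "c \<odot>\<^bsub>K\<^esub> cls x = cls (\<lambda>n. fscale c (x n))"
proof -
  have "cls (\<lambda>n. fscale c (x n)) = cls (\<lambda>n. fscale c (class_rep (cls x) n))"
    by (intro cls_eq_iff [THEN iffD2] C_fscale eqv_fscale class_rep_cls assms)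
  then show ?thesis by (simp add: completion_def)
qed

lemma adj_K:
  assumes "x \<in> C"
  shows "adj K (cls x) = cls (\<lambda>n. fstar (x n))"
proof -
  have "cls (\<lambda>n. fstar (x n)) = cls (\<lambda>n. fstar (class_rep (cls x) n))"
    by (intro cls_eq_iff [THEN iffD2] C_fstar eqv_fstar class_rep_cls assms)
  then show ?thesis by (simp add: completion_def)
qed

lemma nrm_K:
  assumes "x \<in> C"
  shows "(\<lambda>n. p (x n)) \<longlonglongrightarrow> nrm K (cls x)"
proof -
  define y where "y = class_rep (cls x)"
  have y: "y \<in> C" "eqv x y"
    using class_rep_cls [OF assms] by (auto simp: y_def)
  have "Cauchy (\<lambda>n. p (y n))"
  proof (rule CauchyI)
    fix e :: real
    assume "0 < e"
    then obtain M where M: "\<And>m n. m \<ge> M \<Longrightarrow> n \<ge> M \<Longrightarrow> p (y m - y n) < e"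
      using C_D [OF y(1)] by blast
    then have "norm (p (y m) - p (y n)) < e" if "m \<ge> M" "n \<ge> M" for m n
      using p_abs_diff [of "y m" "y n"] M [OF that] y(1) by (simp add: C_free)
    then show "\<exists>M. \<forall>m\<ge>M. \<forall>n\<ge>M. norm (p (y m) - p (y n)) < e" by blast
  qed
  then have "(\<lambda>n. p (y n)) \<longlonglongrightarrow> nrm K (cls x)"
    by (simp add: completion_def Cauchy_convergent_iff convergent_LIMSEQ_iff flip: y_def)
  moreover have "(\<lambda>n. p (x n) - p (y n)) \<longlonglongrightarrow> 0"
  proof (rule tendsto_0_le [OF y(2), where K = 1])
    have "\<bar>p (x n) - p (y n)\<bar> \<le> p (x n - y n)" for n
      by (intro p_abs_diff C_free assms y)
    then show "\<forall>\<^sub>F n in sequentially. norm (p (x n) - p (y n)) \<le> norm (p (x n - y n)) * 1"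
      by (auto intro!: always_eventually order_trans [OF _ abs_ge_self])
  qed
  ultimately show ?thesis
    using tendsto_add by fastforce
qed

lemma nrm_K_eq: "x \<in> C \<Longrightarrow> (\<lambda>n. p (x n)) \<longlonglongrightarrow> l \<Longrightarrow> nrm K (cls x) = l"
  using nrm_K LIMSEQ_unique by blast

lemma ring_K: "ring K"
proof (rule ringI)
  show "abelian_group K"
  proof (rule abelian_groupI)
    show "\<exists>b\<in>carrier K. b \<oplus>\<^bsub>K\<^esub> a = \<zero>\<^bsub>K\<^esub>" if "a \<in> carrier K" for a
    proof -
      obtain x where x: "x \<in> C" "a = cls x" using \<open>a \<in> carrier K\<close> by (auto simp: carrier_K)
      then have "cls (\<lambda>n. - x n) \<oplus>\<^bsub>K\<^esub> a = \<zero>\<^bsub>K\<^esub>"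
        by (simp add: add_K zero_K C_closed)
      then show ?thesis using x by (auto simp: carrier_K C_closed)
    qed
  qed (auto simp: carrier_K add_K zero_K C_closed free_0 algebra_simps)
  show "monoid K"
    by (rule monoidI) (auto simp: carrier_K mult_K one_K C_closed free_1 algebra_simps)
qed (auto simp: carrier_K add_K mult_K C_closed algebra_simps)

lemma minus_K:
  assumes "x \<in> C" "y \<in> C"
  shows "cls x \<ominus>\<^bsub>K\<^esub> cls y = cls (\<lambda>n. x n - y n)"
proof -
  interpret K: ring K by (rule ring_K)
  have "\<ominus>\<^bsub>K\<^esub> cls y = cls (\<lambda>n. - y n)"
    by (rule K.minus_equality) (use assms in \<open>auto simp: carrier_K add_K zero_K C_closed\<close>)
  then show ?thesis
    using assms by (simp add: a_minus_def add_K C_closed)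
qed

lemma nrm_const: "f \<in> F \<Longrightarrow> nrm K (cls (\<lambda>n. f)) = p f"
  by (rule nrm_K_eq) (auto simp: C_const)

lemma nrm_triangle:
  assumes "x \<in> C" "y \<in> C" "z \<in> C"
  shows "nrm K (cls x \<ominus>\<^bsub>K\<^esub> cls z) \<le> nrm K (cls x \<ominus>\<^bsub>K\<^esub> cls y) + nrm K (cls y \<ominus>\<^bsub>K\<^esub> cls z)"
proof -
  have "nrm K (cls (\<lambda>n. x n - z n)) \<le> nrm K (cls (\<lambda>n. x n - y n)) + nrm K (cls (\<lambda>n. y n - z n))"
  proof (rule LIMSEQ_le)
    show "(\<lambda>n. p (x n - z n)) \<longlonglongrightarrow> nrm K (cls (\<lambda>n. x n - z n))"
      using assms by (intro nrm_K C_diff)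
    show "(\<lambda>n. p (x n - y n) + p (y n - z n)) \<longlonglongrightarrow>
      nrm K (cls (\<lambda>n. x n - y n)) + nrm K (cls (\<lambda>n. y n - z n))"
      using assms by (intro tendsto_add nrm_K C_diff)
    show "\<exists>N. \<forall>n\<ge>N. p (x n - z n) \<le> p (x n - y n) + p (y n - z n)"
      using assms p_triangle by (auto simp: C_free)
  qed
  then show ?thesis using assms by (simp add: minus_K)
qed

lemma nrm_minus_commute:
  assumes "x \<in> C" "y \<in> C"
  shows "nrm K (cls x \<ominus>\<^bsub>K\<^esub> cls y) = nrm K (cls y \<ominus>\<^bsub>K\<^esub> cls x)"
proof -
  have "(\<lambda>n. p (y n - x n)) \<longlonglongrightarrow> nrm K (cls (\<lambda>n. x n - y n))"
    using nrm_K [OF C_diff [OF assms]] C_diff_commute [OF assms] by (simp only:)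
  from nrm_K_eq [OF C_diff [OF assms(2,1)] this] show ?thesis
    using assms by (simp add: minus_K)
qed

lemma complete_K:
  assumes A: "\<And>n. A n \<in> carrier K"
    and cauchy: "\<And>e. 0 < e \<Longrightarrow> \<exists>M. \<forall>m\<ge>M. \<forall>n\<ge>M. nrm K (A m \<ominus>\<^bsub>K\<^esub> A n) < e"
  shows "\<exists>a\<in>carrier K. (\<lambda>n. nrm K (A n \<ominus>\<^bsub>K\<^esub> a)) \<longlonglongrightarrow> 0"
proof -
  have "\<forall>k. \<exists>x. x \<in> C \<and> A k = cls x"
    using A by (auto simp: carrier_K)
  then obtain x where x: "\<And>k. x k \<in> C" and Ax: "\<And>k. A k = cls (x k)" by metis
  have "\<forall>k. \<exists>M. \<forall>m\<ge>M. \<forall>n\<ge>M. p (x k m - x k n) < 1 / real (Suc k)"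
    using C_D [OF x] by (metis of_nat_0_less_iff zero_less_Suc zero_less_divide_1_iff)
  then obtain M where M: "\<And>k m n. m \<ge> M k \<Longrightarrow> n \<ge> M k \<Longrightarrow> p (x k m - x k n) < 1 / real (Suc k)"
    by metis
  define y where "y k = x k (M k)" for k
  have yF: "y k \<in> F" for k
    unfolding y_def using x by (simp add: C_free)
  define Y where "Y k = cls (\<lambda>n. y k)" for k
  have dAY: "nrm K (A k \<ominus>\<^bsub>K\<^esub> Y k) \<le> 1 / real (Suc k)" for k
  proof -
    have "(\<lambda>n. p (x k n - y k)) \<longlonglongrightarrow> nrm K (A k \<ominus>\<^bsub>K\<^esub> Y k)"
      using nrm_K [OF C_diff [OF x C_const [OF yF]]] x yF by (simp add: Ax Y_def minus_K C_const)
    then show ?thesis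
      by (rule LIMSEQ_le_const2) (use M in \<open>auto simp: y_def intro!: exI [of _ "M k"] less_imp_le\<close>)
  qed
  have py: "p (y k - y l) = nrm K (Y k \<ominus>\<^bsub>K\<^esub> Y l)" for k l
    using yF by (simp add: Y_def minus_K C_const nrm_const free_diff)
  have small: "\<exists>N. \<forall>n\<ge>N. 1 / real (Suc n) < e" if "0 < e" for e :: real
    using order_tendstoD(2) [OF LIMSEQ_inverse_real_of_nat that]
    by (simp add: eventually_sequentially inverse_eq_divide)
  have yC: "y \<in> C"
  proof (rule C_I [OF yF])
    fix e :: real
    assume "0 < e"
    then obtain N1 where N1: "\<And>m n. m \<ge> N1 \<Longrightarrow> n \<ge> N1 \<Longrightarrow> nrm K (A m \<ominus>\<^bsub>K\<^esub> A n) < e / 3"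
      using cauchy [of "e / 3"] by auto
    obtain N2 where N2: "\<And>n. n \<ge> N2 \<Longrightarrow> 1 / real (Suc n) < e / 3"
      using small [of "e / 3"] \<open>0 < e\<close> by auto
    have "p (y k - y l) < e" if "k \<ge> max N1 N2" "l \<ge> max N1 N2" for k l
    proof -
      have "nrm K (Y k \<ominus>\<^bsub>K\<^esub> Y l) \<le> nrm K (Y k \<ominus>\<^bsub>K\<^esub> A k) + nrm K (A k \<ominus>\<^bsub>K\<^esub> Y l)"
        unfolding Y_def Ax by (intro nrm_triangle x C_const yF)
      also have "nrm K (A k \<ominus>\<^bsub>K\<^esub> Y l) \<le> nrm K (A k \<ominus>\<^bsub>K\<^esub> A l) + nrm K (A l \<ominus>\<^bsub>K\<^esub> Y l)"
        unfolding Y_def Ax by (intro nrm_triangle x C_const yF)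
      also have "nrm K (Y k \<ominus>\<^bsub>K\<^esub> A k) = nrm K (A k \<ominus>\<^bsub>K\<^esub> Y k)"
        unfolding Y_def Ax by (intro nrm_minus_commute x C_const yF)
      finally show ?thesis
        using dAY [of k] dAY [of l] N1 [of k l] N2 [of k] N2 [of l] that py by fastforce
    qed
    then show "\<exists>M. \<forall>m\<ge>M. \<forall>n\<ge>M. p (y m - y n) < e" by blast
  qed
  have nonneg: "0 \<le> nrm K (cls z)" if "z \<in> C" for z
    by (rule LIMSEQ_le_const [OF nrm_K [OF that]]) (use that p_nonneg C_free in auto)
  have "(\<lambda>k. nrm K (A k \<ominus>\<^bsub>K\<^esub> cls y)) \<longlonglongrightarrow> 0"
  proof (rule LIMSEQ_I)
    fix e :: real
    assume "0 < e"
    then obtain N1 where N1: "\<And>m n. m \<ge> N1 \<Longrightarrow> n \<ge> N1 \<Longrightarrow> p (y m - y n) < e / 3"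
      using C_D [OF yC, of "e / 3"] by auto
    obtain N2 where N2: "\<And>n. n \<ge> N2 \<Longrightarrow> 1 / real (Suc n) < e / 3"
      using small [of "e / 3"] \<open>0 < e\<close> by auto
    have "norm (nrm K (A k \<ominus>\<^bsub>K\<^esub> cls y) - 0) < e" if "k \<ge> max N1 N2" for k
    proof -
      have "nrm K (A k \<ominus>\<^bsub>K\<^esub> cls y) \<le> nrm K (A k \<ominus>\<^bsub>K\<^esub> Y k) + nrm K (Y k \<ominus>\<^bsub>K\<^esub> cls y)"
        unfolding Y_def Ax by (intro nrm_triangle x C_const yF yC)
      moreover have "(\<lambda>n. p (y k - y n)) \<longlonglongrightarrow> nrm K (Y k \<ominus>\<^bsub>K\<^esub> cls y)"
        using nrm_K [OF C_diff [OF C_const [OF yF] yC]] yF yC by (simp add: Y_def minus_K C_const)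
      then have "nrm K (Y k \<ominus>\<^bsub>K\<^esub> cls y) \<le> e / 3"
        by (rule LIMSEQ_le_const2) (use N1 that in \<open>auto intro!: exI [of _ N1] less_imp_le\<close>)
      moreover have "0 \<le> nrm K (A k \<ominus>\<^bsub>K\<^esub> cls y)"
        unfolding Ax minus_K [OF x yC] by (intro nonneg C_diff x yC)
      ultimately show ?thesis
        using dAY [of k] N2 [of k] that \<open>0 < e\<close> by simp
    qed
    then show "\<exists>N. \<forall>k\<ge>N. norm (nrm K (A k \<ominus>\<^bsub>K\<^esub> cls y) - 0) < e" by blast
  qed
  then show ?thesis using yC by (auto simp: carrier_K)
qed

lemma cstar_algebra_K: "cstar_algebra K"
proof -
  interpret K: ring K by (rule ring_K)
  have E: "\<exists>x\<in>C. a = cls x" if "a \<in> carrier K" for a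
    using that by (auto simp: carrier_K)
  show ?thesis
  proof unfold_locales
    fix a assume "a \<in> carrier K"
    then obtain x where x: "x \<in> C" "a = cls x" using E by blast
    show "c \<odot>\<^bsub>K\<^esub> a \<in> carrier K" for c
      using x by (simp add: smult_K carrier_K C_closed)
    show "(c + d) \<odot>\<^bsub>K\<^esub> a = c \<odot>\<^bsub>K\<^esub> a \<oplus>\<^bsub>K\<^esub> d \<odot>\<^bsub>K\<^esub> a" for c d
      using x by (simp add: smult_K add_K C_closed fscale_add_left)
    show "c \<odot>\<^bsub>K\<^esub> (d \<odot>\<^bsub>K\<^esub> a) = (c * d) \<odot>\<^bsub>K\<^esub> a" for c d
      using x by (simp add: smult_K C_closed fscale_fscale)
    show "1 \<odot>\<^bsub>K\<^esub> a = a"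
      using x by (simp add: smult_K fscale_1)
    show "adj K a \<in> carrier K"
      using x by (simp add: adj_K carrier_K C_closed)
    show "adj K (adj K a) = a"
      using x by (simp add: adj_K C_closed fstar_fstar)
    show "adj K (c \<odot>\<^bsub>K\<^esub> a) = cnj c \<odot>\<^bsub>K\<^esub> adj K a" for c
      using x by (simp add: adj_K smult_K C_closed fstar_fscale)
    show "0 \<le> nrm K a"
      using x by (auto intro!: LIMSEQ_le_const [OF nrm_K] simp: p_nonneg C_free)
    show "nrm K a = 0 \<longleftrightarrow> a = \<zero>\<^bsub>K\<^esub>"
      using x nrm_K [of x] nrm_K_eq [of x 0] by (auto simp: zero_K cls_eq_iff C_const free_0)
    show "nrm K (c \<odot>\<^bsub>K\<^esub> a) = cmod c * nrm K a" for c
      using x tendsto_mult_left [OF nrm_K [OF x(1)], of "cmod c"]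
      by (auto simp: smult_K C_closed p_fscale C_free intro!: nrm_K_eq)
    show "nrm K (adj K a \<otimes>\<^bsub>K\<^esub> a) = (nrm K a)\<^sup>2"
      using x tendsto_power [OF nrm_K [OF x(1)], of 2]
      by (auto simp: adj_K mult_K C_closed p_cstar C_free intro!: nrm_K_eq)
    fix b assume "b \<in> carrier K"
    then obtain y where y: "y \<in> C" "b = cls y" using E by blast
    show "c \<odot>\<^bsub>K\<^esub> (a \<oplus>\<^bsub>K\<^esub> b) = c \<odot>\<^bsub>K\<^esub> a \<oplus>\<^bsub>K\<^esub> c \<odot>\<^bsub>K\<^esub> b" for c
      using x y by (simp add: smult_K add_K C_closed fscale_add)
    show "(c \<odot>\<^bsub>K\<^esub> a) \<otimes>\<^bsub>K\<^esub> b = c \<odot>\<^bsub>K\<^esub> (a \<otimes>\<^bsub>K\<^esub> b)" for c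
      using x y by (simp add: smult_K mult_K C_closed fscale_mult_left)
    show "a \<otimes>\<^bsub>K\<^esub> (c \<odot>\<^bsub>K\<^esub> b) = c \<odot>\<^bsub>K\<^esub> (a \<otimes>\<^bsub>K\<^esub> b)" for c
      using x y by (simp add: smult_K mult_K C_closed fscale_mult_right)
    show "adj K (a \<oplus>\<^bsub>K\<^esub> b) = adj K a \<oplus>\<^bsub>K\<^esub> adj K b"
      using x y by (simp add: adj_K add_K C_closed fstar_add)
    show "adj K (a \<otimes>\<^bsub>K\<^esub> b) = adj K b \<otimes>\<^bsub>K\<^esub> adj K a"
      using x y by (simp add: adj_K mult_K C_closed fstar_mult)
    show "nrm K (a \<oplus>\<^bsub>K\<^esub> b) \<le> nrm K a + nrm K b"
      using x y by (auto simp: add_K p_add C_free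
          intro!: LIMSEQ_le [OF nrm_K [OF C_add] tendsto_add [OF nrm_K nrm_K]])
    show "nrm K (a \<otimes>\<^bsub>K\<^esub> b) \<le> nrm K a * nrm K b"
      using x y by (auto simp: mult_K p_mult C_free
          intro!: LIMSEQ_le [OF nrm_K [OF C_mult] tendsto_mult [OF nrm_K nrm_K]])
  qed (use complete_K in blast)
qed

end

context cstar_seminormed
begin

lemma p_eqI: "f \<in> F \<Longrightarrow> g \<in> F \<Longrightarrow> p (f - g) = 0 \<Longrightarrow> p f = p g"
  using p_abs_diff [of f g] by simp

lemma p_1_le: "p 1 \<le> 1"
proof -
  have "(p 1)\<^sup>2 = p 1"
    using p_cstar [OF free_1, symmetric] by (simp only: fstar_1 mult_1)
  then have "p 1 = 0 \<or> p 1 = 1"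
    by (simp add: power2_eq_square)
  then show ?thesis by auto
qed

lemma p_isometry_le: "f \<in> F \<Longrightarrow> p (fstar f * f - 1) = 0 \<Longrightarrow> p f \<le> 1"
proof -
  assume f: "f \<in> F" and "p (fstar f * f - 1) = 0"
  then have "(p f)\<^sup>2 = p 1"
    using p_eqI [of "fstar f * f" 1] by (simp add: free_closed p_cstar)
  then show ?thesis
    using p_1_le by (auto intro: power2_le_imp_le [where y = 1])
qed

lemma p_projection_le:
  assumes f: "f \<in> F" and "p (fstar f - f) = 0" "p (f * f - f) = 0"
  shows "p f \<le> 1"
proof -
  have "p (fstar f * f - f * f) = 0"
    using p_mult [of "fstar f - f" f] p_nonneg [of "(fstar f - f) * f"] assms
    by (simp add: free_closed left_diff_distrib)
  then have "(p f)\<^sup>2 = p f"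
    using p_eqI [of "fstar f * f" "f * f"] p_eqI [of "f * f" f] assms
    by (simp add: free_closed p_cstar)
  then have "p f = 0 \<or> p f = 1"
    by (simp add: power2_eq_square)
  then show ?thesis by auto
qed

end


section \<open>The universal property\<close>

lemma sup_seminorm:
  assumes adm: "\<And>q. q \<in> A \<Longrightarrow> cstar_seminorm X q" and ne: "A \<noteq> {}"
    and bdd: "\<And>f. f \<in> free_carrier X \<Longrightarrow> bdd_above ((\<lambda>q. q f) ` A)"
  shows "cstar_seminorm X (\<lambda>f. SUP q\<in>A. q f)"
proof -
  define N where "N f = (SUP q\<in>A. q f)" for f
  have upper: "q f \<le> N f" if "q \<in> A" "f \<in> free_carrier X" for q f
    unfolding N_def by (intro cSUP_upper that bdd)
  have least: "N f \<le> b" if "\<And>q. q \<in> A \<Longrightarrow> q f \<le> b" for f b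
    unfolding N_def by (intro cSUP_least ne that)
  have q: "cstar_seminormed X q" if "q \<in> A" for q
    using adm [OF that] by (simp add: cstar_seminormed_def)
  note [simp] = free_closed
  obtain q0 where q0: "q0 \<in> A" using ne by blast
  have nonneg: "0 \<le> N f" if "f \<in> free_carrier X" for f
    using cstar_seminormed.p_nonneg [OF q [OF q0] that] upper [OF q0 that] by simp
  have "N (fscale c f) = cmod c * N f" if f: "f \<in> free_carrier X" for c f
  proof -
    have le: "N (fscale c f) \<le> cmod c * N f" if "f \<in> free_carrier X" for c f
      using that by (intro least)
        (simp add: cstar_seminormed.p_fscale [OF q] upper mult_left_mono)
    show ?thesis
    proof (cases "c = 0")
      case True
      then show ?thesis
        using le [OF f, of 0] nonneg [of "fscale 0 f"] f by simp
    next
      case False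
      have "N f \<le> cmod (inverse c) * N (fscale c f)"
        using le [of "fscale c f" "inverse c"] f False by (simp add: fscale_fscale fscale_1)
      then have "cmod c * N f \<le> cmod c * (cmod (inverse c) * N (fscale c f))"
        by (rule mult_left_mono) simp
      also have "\<dots> = N (fscale c f)"
        using False by (simp add: norm_inverse)
      finally show ?thesis using le [OF f, of c] by simp
    qed
  qed
  moreover have "N (f + g) \<le> N f + N g" if "f \<in> free_carrier X" "g \<in> free_carrier X" for f g
  proof (rule least)
    fix r assume r: "r \<in> A"
    show "r (f + g) \<le> N f + N g"
      using cstar_seminormed.p_add [OF q [OF r] that] upper [OF r that(1)] upper [OF r that(2)]
      by linarith
  qed
  moreover have "N (f * g) \<le> N f * N g" if "f \<in> free_carrier X" "g \<in> free_carrier X" for f g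
  proof (rule least)
    fix r assume r: "r \<in> A"
    have "r f * r g \<le> N f * N g"
      using r that cstar_seminormed.p_nonneg [OF q [OF r]]
      by (intro mult_mono upper nonneg) auto
    then show "r (f * g) \<le> N f * N g"
      using cstar_seminormed.p_mult [OF q [OF r] that] by linarith
  qed
  moreover have "N (fstar f * f) = (N f)\<^sup>2" if f: "f \<in> free_carrier X" for f
  proof (rule antisym)
    show "N (fstar f * f) \<le> (N f)\<^sup>2"
    proof (rule least)
      fix r assume r: "r \<in> A"
      show "r (fstar f * f) \<le> (N f)\<^sup>2"
        using cstar_seminormed.p_cstar [OF q [OF r] f] upper [OF r f]
          cstar_seminormed.p_nonneg [OF q [OF r] f] by (simp add: power_mono)
    qed
    have "N f \<le> sqrt (N (fstar f * f))"
    proof (rule least)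
      fix r assume r: "r \<in> A"
      have "(r f)\<^sup>2 \<le> N (fstar f * f)"
        using cstar_seminormed.p_cstar [OF q [OF r] f] upper [OF r, of "fstar f * f"] f by simp
      then show "r f \<le> sqrt (N (fstar f * f))"
        by (rule real_le_rsqrt)
    qed
    then have "(N f)\<^sup>2 \<le> (sqrt (N (fstar f * f)))\<^sup>2"
      using nonneg [OF f] by (rule power_mono)
    then show "(N f)\<^sup>2 \<le> N (fstar f * f)"
      using nonneg [of "fstar f * f"] f by simp
  qed
  ultimately have "cstar_seminorm X N"
    using nonneg by (simp add: cstar_seminorm_def)
  then show ?thesis by (simp add: N_def [abs_def])
qed


definition bounded_gens :: "'x set \<Rightarrow> 'x free_star set \<Rightarrow> bool" where
  "bounded_gens X R \<longleftrightarrow> (\<forall>x\<in>X. \<exists>b. \<forall>p\<in>admissible_seminorms X R. p (fgen x) \<le> b)"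

locale bounded_presentation =
  fixes X :: "'x set" and R :: "'x free_star set"
  assumes bounded: "bounded_gens X R"
begin

lemma admissible_bounded:
  assumes "f \<in> free_carrier X"
  shows "\<exists>b. \<forall>p\<in>admissible_seminorms X R. p f \<le> b"
proof -
  have q: "cstar_seminormed X q" if "q \<in> admissible_seminorms X R" for q
    using that by (simp add: admissible_seminorms_def cstar_seminormed_def)
  from assms show ?thesis
  proof (induction rule: free_carrier_induct)
    case (gen x)
    then show ?case using bounded by (simp add: bounded_gens_def)
  next
    case one
    then show ?case using cstar_seminormed.p_1_le [OF q] by blast
  next
    case zero
    have "p 0 \<le> 0" if "p \<in> admissible_seminorms X R" for p
      using cstar_seminormed.p_0 [OF q [OF that]] by simp
    then show ?case by blast
  next
    case (add f g)
    then obtain b c where "\<forall>p\<in>admissible_seminorms X R. p f \<le> b"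
      "\<forall>p\<in>admissible_seminorms X R. p g \<le> c" by blast
    then have "p (f + g) \<le> b + c" if "p \<in> admissible_seminorms X R" for p
      using cstar_seminormed.p_add [OF q [OF that] add.hyps] that by fastforce
    then show ?case by blast
  next
    case (mult f g)
    then obtain b c where bc: "\<forall>p\<in>admissible_seminorms X R. p f \<le> b"
      "\<forall>p\<in>admissible_seminorms X R. p g \<le> c" by blast
    have "p (f * g) \<le> b * c" if p: "p \<in> admissible_seminorms X R" for p
    proof -
      have "0 \<le> p f" "0 \<le> p g"
        using cstar_seminormed.p_nonneg [OF q [OF p]] mult.hyps by auto
      then have "p f * p g \<le> b * c"
        using bc p by (intro mult_mono) force+
      then show ?thesis
        using cstar_seminormed.p_mult [OF q [OF p], of f g] mult.hyps by simp
    qed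
    then show ?case by blast
  next
    case (fscale c f)
    then obtain b where b: "\<forall>p\<in>admissible_seminorms X R. p f \<le> b" by blast
    have "p (fscale c f) \<le> cmod c * b" if p: "p \<in> admissible_seminorms X R" for p
      using cstar_seminormed.p_fscale [OF q [OF p], of f c] fscale.hyps b p
      by (simp add: mult_left_mono)
    then show ?case by blast
  next
    case (fstar f)
    then obtain b where "\<forall>p\<in>admissible_seminorms X R. p f \<le> b" by blast
    then have "p (fstar f) \<le> b" if "p \<in> admissible_seminorms X R" for p
      using cstar_seminormed.p_fstar [OF q [OF that] fstar.hyps] that by simp
    then show ?case by blast
  qed
qed

lemma zero_admissible: "(\<lambda>f. 0) \<in> admissible_seminorms X R"
  by (simp add: admissible_seminorms_def cstar_seminorm_def)

lemma universal_seminorm_cstar_seminorm: "cstar_seminorm X (universal_seminorm X R)"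
proof -
  have "cstar_seminorm X (\<lambda>f. SUP p\<in>admissible_seminorms X R. p f)"
  proof (rule sup_seminorm)
    show "cstar_seminorm X p" if "p \<in> admissible_seminorms X R" for p
      using that by (simp add: admissible_seminorms_def)
    show "admissible_seminorms X R \<noteq> {}"
      using zero_admissible by blast
    show "bdd_above ((\<lambda>p. p f) ` admissible_seminorms X R)" if "f \<in> free_carrier X" for f
      using admissible_bounded [OF that] by (auto simp: bdd_above_def)
  qed
  then show ?thesis by (simp add: universal_seminorm_def [abs_def])
qed

lemma admissible_le_universal:
  assumes "p \<in> admissible_seminorms X R" "f \<in> free_carrier X"
  shows "p f \<le> universal_seminorm X R f"
  unfolding universal_seminorm_def
proof (rule cSUP_upper [OF assms(1)])
  show "bdd_above ((\<lambda>p. p f) ` admissible_seminorms X R)"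
    using admissible_bounded [OF assms(2)] by (auto simp: bdd_above_def)
qed

lemma universal_relation: "r \<in> R \<Longrightarrow> universal_seminorm X R r = 0"
  unfolding universal_seminorm_def
proof (rule antisym)
  assume r: "r \<in> R"
  have eq: "(\<lambda>p. p r) ` admissible_seminorms X R = {0}"
    using zero_admissible r by (auto simp: admissible_seminorms_def image_iff)
  show "(SUP p\<in>admissible_seminorms X R. p r) \<le> 0" "0 \<le> (SUP p\<in>admissible_seminorms X R. p r)"
    unfolding eq by simp_all
qed

sublocale N: cstar_seminormed X "universal_seminorm X R"
  by (simp add: cstar_seminormed_def universal_seminorm_cstar_seminorm)

theorem cstar_algebra_universal_cstar: "cstar_algebra (universal_cstar X R)"
  unfolding universal_cstar_def by (rule N.cstar_algebra_K)

theorem universal_map_star_hom: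
  "universal_map X R \<in> star_hom (free_star_algebra X) (universal_cstar X R)"
proof -
  have "universal_map X R f \<in> carrier (universal_cstar X R)" if "f \<in> free_carrier X" for f
    using that by (simp add: universal_map_def universal_cstar_def N.carrier_K N.C_const)
  then show ?thesis
    by (auto simp: star_hom_def ring_hom_def free_star_algebra_def universal_map_def
        universal_cstar_def N.add_K N.mult_K N.smult_K N.adj_K N.one_K N.C_const)
qed

theorem universal_map_relation:
  assumes "r \<in> R" "r \<in> free_carrier X"
  shows "universal_map X R r = \<zero>\<^bsub>universal_cstar X R\<^esub>"
  using assms universal_relation
  by (simp add: universal_map_def universal_cstar_def N.zero_K N.cls_eq_iff N.C_const free_0)

theorem universal_map_dense:
  assumes "a \<in> carrier (universal_cstar X R)" "0 < e"
  shows "\<exists>f\<in>free_carrier X.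
    nrm (universal_cstar X R) (a \<ominus>\<^bsub>universal_cstar X R\<^esub> universal_map X R f) < e"
proof -
  obtain x where x: "x \<in> N.C" "a = N.cls x"
    using assms by (auto simp: universal_cstar_def N.carrier_K)
  obtain M where M: "\<And>m n. m \<ge> M \<Longrightarrow> n \<ge> M \<Longrightarrow> universal_seminorm X R (x m - x n) < e / 2"
    using N.C_D [OF x(1), of "e / 2"] \<open>0 < e\<close> by auto
  have f: "x M \<in> free_carrier X" using x by (simp add: N.C_free)
  have "(\<lambda>n. universal_seminorm X R (x n - x M)) \<longlonglongrightarrow>
      nrm (universal_cstar X R) (a \<ominus>\<^bsub>universal_cstar X R\<^esub> universal_map X R (x M))"
    using N.nrm_K [OF N.C_diff [OF x(1) N.C_const [OF f]]] x f
    by (simp add: universal_cstar_def universal_map_def N.minus_K N.C_const)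
  then have "nrm (universal_cstar X R) (a \<ominus>\<^bsub>universal_cstar X R\<^esub> universal_map X R (x M)) \<le> e / 2"
    by (rule LIMSEQ_le_const2) (use M in \<open>auto intro!: exI [of _ M] less_imp_le\<close>)
  then show ?thesis using f \<open>0 < e\<close> by (intro bexI [of _ "x M"]) auto
qed

end

context cstar_algebra
begin

lemma smult_0: "x \<in> carrier A \<Longrightarrow> 0 \<odot> x = \<zero>"
  using smult_add_left [of x 0 0, symmetric] by (simp add: smult_closed)

lemma smult_minus_1:
  assumes "x \<in> carrier A"
  shows "(-1) \<odot> x = \<ominus> x"
proof -
  have "(-1) \<odot> x \<oplus> x = \<zero>"
    using smult_add_left [of x "-1" 1, symmetric] assms by (simp add: smult_0 smult_one)
  from minus_equality [OF this] show ?thesis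
    using assms by (simp add: smult_closed)
qed

lemma nrm_uminus: "x \<in> carrier A \<Longrightarrow> nrm A (\<ominus> x) = nrm A x"
  using nrm_smult [of x "-1"] by (simp add: smult_minus_1)

lemma nrm_minus_commute:
  assumes "x \<in> carrier A" "y \<in> carrier A"
  shows "nrm A (x \<ominus> y) = nrm A (y \<ominus> x)"
proof -
  have "y \<ominus> x = \<ominus> (x \<ominus> y)"
    using assms by (simp add: a_minus_def minus_add a_comm)
  then show ?thesis using assms by (simp add: nrm_uminus)
qed

lemma nrm_triangle:
  assumes "x \<in> carrier A" "y \<in> carrier A" "z \<in> carrier A"
  shows "nrm A (x \<ominus> z) \<le> nrm A (x \<ominus> y) + nrm A (y \<ominus> z)"
proof -
  have "x \<ominus> z = (x \<ominus> y) \<oplus> (y \<ominus> z)"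
    using assms by (simp add: a_minus_def a_assoc r_neg1)
  then show ?thesis using assms by (simp add: nrm_add)
qed

lemma nrm_adj:
  assumes "x \<in> carrier A"
  shows "nrm A (adj A x) = nrm A x"
proof -
  have le: "nrm A x \<le> nrm A (adj A x)" if "x \<in> carrier A" for x
  proof -
    have "nrm A x * nrm A x \<le> nrm A (adj A x) * nrm A x"
      using nrm_adj_mult [OF that] nrm_mult [of "adj A x" x] that
      by (simp add: adj_closed power2_eq_square)
    then show ?thesis
      using nrm_nonneg [OF that] nrm_nonneg [OF adj_closed [OF that]]
      by (cases "nrm A x = 0") (auto simp: mult_le_cancel_right)
  qed
  show ?thesis
    using le [OF assms] le [OF adj_closed [OF assms]] assms by (simp add: adj_adj)
qed

definition converges :: "(nat \<Rightarrow> 'a) \<Rightarrow> 'a \<Rightarrow> bool" where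
  "converges u a \<longleftrightarrow> (\<forall>n. u n \<in> carrier A) \<and> a \<in> carrier A \<and> (\<lambda>n. nrm A (u n \<ominus> a)) \<longlonglongrightarrow> 0"

lemma null_dominated:
  assumes "\<And>n. u n \<in> carrier A" "\<And>n. nrm A (u n) \<le> b n" "b \<longlonglongrightarrow> 0"
  shows "(\<lambda>n. nrm A (u n)) \<longlonglongrightarrow> 0"
proof (rule tendsto_sandwich [OF _ _ tendsto_const assms(3)])
  show "\<forall>\<^sub>F n in sequentially. 0 \<le> nrm A (u n)"
    using nrm_nonneg [OF assms(1)] by simp
  show "\<forall>\<^sub>F n in sequentially. nrm A (u n) \<le> b n"
    using assms(2) by simp
qed

lemma converges_unique:
  assumes "converges u a" "converges u b"
  shows "a = b"
proof -
  have c: "a \<in> carrier A" "b \<in> carrier A" "\<And>n. u n \<in> carrier A"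
    using assms by (auto simp: converges_def)
  have lim: "(\<lambda>n. nrm A (u n \<ominus> a) + nrm A (u n \<ominus> b)) \<longlonglongrightarrow> 0"
    using assms by (intro tendsto_add_zero) (simp_all add: converges_def)
  have "nrm A (a \<ominus> b) \<le> nrm A (u n \<ominus> a) + nrm A (u n \<ominus> b)" for n
    using nrm_triangle [of a "u n" b] c by (simp add: nrm_minus_commute [of a "u n"])
  then have "nrm A (a \<ominus> b) \<le> 0"
    by (intro LIMSEQ_le_const [OF lim] exI allI impI)
  then have "a \<ominus> b = \<zero>"
    using nrm_nonneg [of "a \<ominus> b"] nrm_eq_0_iff [of "a \<ominus> b"] c by simp
  then show ?thesis
    using minus_equality [of a "\<ominus> b"] c by (simp add: a_minus_def)
qed

lemma converges_nrm:
  assumes "converges u a"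
  shows "(\<lambda>n. nrm A (u n)) \<longlonglongrightarrow> nrm A a"
proof -
  have c: "a \<in> carrier A" "\<And>n. u n \<in> carrier A"
    using assms by (auto simp: converges_def)
  have "\<bar>nrm A x - nrm A y\<bar> \<le> nrm A (x \<ominus> y)" if "x \<in> carrier A" "y \<in> carrier A" for x y
  proof -
    have 1: "nrm A x \<le> nrm A (x \<ominus> y) + nrm A y" if "x \<in> carrier A" "y \<in> carrier A" for x y
      using nrm_triangle [of x y \<zero>] that by (simp add: a_minus_def)
    show ?thesis
      using 1 [OF that] 1 [OF that(2,1)] that by (simp add: nrm_minus_commute [of y x])
  qed
  then have le: "norm (nrm A (u n) - nrm A a) \<le> norm (nrm A (u n \<ominus> a)) * 1" for n
    using c nrm_nonneg [of "u n \<ominus> a"] by simp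
  have lim: "(\<lambda>n. nrm A (u n \<ominus> a)) \<longlonglongrightarrow> 0"
    using assms by (simp add: converges_def)
  have "(\<lambda>n. nrm A (u n) - nrm A a) \<longlonglongrightarrow> 0"
    by (rule tendsto_0_le [OF lim always_eventually [OF allI [OF le]]])
  then show ?thesis by (simp add: LIM_zero_iff)
qed

lemma converges_add:
  assumes "converges u a" "converges v b"
  shows "converges (\<lambda>n. u n \<oplus> v n) (a \<oplus> b)"
proof -
  have c: "a \<in> carrier A" "b \<in> carrier A" "\<And>n. u n \<in> carrier A" "\<And>n. v n \<in> carrier A"
    using assms by (auto simp: converges_def)
  have lim: "(\<lambda>n. nrm A (u n \<ominus> a) + nrm A (v n \<ominus> b)) \<longlonglongrightarrow> 0"
    using assms by (intro tendsto_add_zero) (simp_all add: converges_def)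
  have "u n \<oplus> v n \<ominus> (a \<oplus> b) = (u n \<ominus> a) \<oplus> (v n \<ominus> b)" for n
    using c by (simp add: a_minus_def minus_add a_ac)
  then have "nrm A (u n \<oplus> v n \<ominus> (a \<oplus> b)) \<le> nrm A (u n \<ominus> a) + nrm A (v n \<ominus> b)" for n
    using c by (simp add: nrm_add)
  from null_dominated [OF _ this lim] show ?thesis
    unfolding converges_def using c by auto
qed

lemma converges_mult:
  assumes "converges u a" "converges v b"
  shows "converges (\<lambda>n. u n \<otimes> v n) (a \<otimes> b)"
proof -
  have c: "a \<in> carrier A" "b \<in> carrier A" "\<And>n. u n \<in> carrier A" "\<And>n. v n \<in> carrier A"
    using assms by (auto simp: converges_def)
  have lim: "(\<lambda>n. nrm A (u n \<ominus> a) * nrm A (v n) + nrm A a * nrm A (v n \<ominus> b)) \<longlonglongrightarrow> 0"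
    using tendsto_add [OF tendsto_mult [OF _ converges_nrm [OF assms(2)]] tendsto_mult_right_zero,
        of "\<lambda>n. nrm A (u n \<ominus> a)" 0 "\<lambda>n. nrm A (v n \<ominus> b)" "nrm A a"] assms
    by (simp add: converges_def)
  have "nrm A (u n \<otimes> v n \<ominus> a \<otimes> b) \<le> nrm A (u n \<ominus> a) * nrm A (v n) + nrm A a * nrm A (v n \<ominus> b)"
    for n
  proof -
    have "nrm A (u n \<otimes> v n \<ominus> a \<otimes> b)
        \<le> nrm A (u n \<otimes> v n \<ominus> a \<otimes> v n) + nrm A (a \<otimes> v n \<ominus> a \<otimes> b)"
      using c by (intro nrm_triangle) auto
    also have "u n \<otimes> v n \<ominus> a \<otimes> v n = (u n \<ominus> a) \<otimes> v n"
      using c by (simp add: a_minus_def l_distr l_minus)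
    also have "a \<otimes> v n \<ominus> a \<otimes> b = a \<otimes> (v n \<ominus> b)"
      using c by (simp add: a_minus_def r_distr r_minus)
    finally show ?thesis
      using nrm_mult [of "u n \<ominus> a" "v n"] nrm_mult [of a "v n \<ominus> b"] c by simp
  qed
  from null_dominated [OF _ this lim] show ?thesis
    unfolding converges_def using c by auto
qed

lemma converges_smult:
  assumes "converges u a"
  shows "converges (\<lambda>n. k \<odot> u n) (k \<odot> a)"
proof -
  have c: "a \<in> carrier A" "\<And>n. u n \<in> carrier A"
    using assms by (auto simp: converges_def)
  have "\<ominus> (k \<odot> a) = k \<odot> (\<ominus> a)"
    using c by (simp add: smult_closed smult_smult flip: smult_minus_1)
  then have "k \<odot> u n \<ominus> k \<odot> a = k \<odot> (u n \<ominus> a)" for n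
    using c by (simp add: a_minus_def smult_add_right)
  then have "nrm A (k \<odot> u n \<ominus> k \<odot> a) = cmod k * nrm A (u n \<ominus> a)" for n
    using c by (simp add: nrm_smult)
  then show ?thesis
    using assms c by (simp add: converges_def smult_closed tendsto_mult_right_zero)
qed

lemma converges_adj:
  assumes "converges u a"
  shows "converges (\<lambda>n. adj A (u n)) (adj A a)"
proof -
  have c: "a \<in> carrier A" "\<And>n. u n \<in> carrier A"
    using assms by (auto simp: converges_def)
  have "\<ominus> (adj A a) = adj A (\<ominus> a)"
    using c by (simp add: adj_closed adj_smult flip: smult_minus_1)
  then have "adj A (u n) \<ominus> adj A a = adj A (u n \<ominus> a)" for n
    using c by (simp add: a_minus_def adj_add)
  then have "nrm A (adj A (u n) \<ominus> adj A a) = nrm A (u n \<ominus> a)" for n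
    using c by (simp add: nrm_adj)
  then show ?thesis
    using assms c by (simp add: converges_def adj_closed)
qed

end


theorem (in bounded_presentation) universal_cstar_universal:
  assumes "cstar_algebra B"
    and \<psi>: "\<psi> \<in> star_hom (free_star_algebra X) B"
    and rel: "\<And>r. r \<in> R \<Longrightarrow> \<psi> r = \<zero>\<^bsub>B\<^esub>"
  shows "\<exists>\<phi>\<in>star_hom (universal_cstar X R) B.
    (\<forall>f\<in>free_carrier X. \<phi> (universal_map X R f) = \<psi> f) \<and>
    (\<forall>a\<in>carrier (universal_cstar X R). nrm B (\<phi> a) \<le> nrm (universal_cstar X R) a)"
proof -
  interpret B: cstar_algebra B by fact
  have closed: "\<psi> f \<in> carrier B" if "f \<in> free_carrier X" for f
    using \<psi> that by (auto simp: star_hom_def ring_hom_def free_star_algebra_def)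
  have add: "\<psi> (f + g) = \<psi> f \<oplus>\<^bsub>B\<^esub> \<psi> g" and mult: "\<psi> (f * g) = \<psi> f \<otimes>\<^bsub>B\<^esub> \<psi> g"
    if "f \<in> free_carrier X" "g \<in> free_carrier X" for f g
    using \<psi> that by (auto simp: star_hom_def ring_hom_def free_star_algebra_def)
  have smult: "\<psi> (fscale c f) = c \<odot>\<^bsub>B\<^esub> \<psi> f" and star: "\<psi> (fstar f) = adj B (\<psi> f)"
    if "f \<in> free_carrier X" for c f
    using \<psi> that by (auto simp: star_hom_def ring_hom_def free_star_algebra_def)
  have one: "\<psi> 1 = \<one>\<^bsub>B\<^esub>"
    using \<psi> by (auto simp: star_hom_def ring_hom_def free_star_algebra_def)
  have diff: "\<psi> (f - g) = \<psi> f \<ominus>\<^bsub>B\<^esub> \<psi> g" if "f \<in> free_carrier X" "g \<in> free_carrier X" for f g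
    using add [of f "fscale (-1) g"] smult [of g "-1"] that
    by (simp add: free_closed closed fscale_minus_1 B.smult_minus_1 a_minus_def)
  have "(\<lambda>f. nrm B (\<psi> f)) \<in> admissible_seminorms X R"
    unfolding admissible_seminorms_def cstar_seminorm_def
    using rel B.nrm_eq_0_iff [of "\<zero>\<^bsub>B\<^esub>"]
    by (auto simp: add mult smult star closed free_closed B.nrm_nonneg B.nrm_add B.nrm_smult
        B.nrm_mult B.nrm_adj_mult)
  then have le: "nrm B (\<psi> f) \<le> universal_seminorm X R f" if "f \<in> free_carrier X" for f
    using admissible_le_universal that by fastforce
  have ex: "\<exists>b. B.converges (\<lambda>n. \<psi> (x n)) b" if x: "x \<in> N.C" for x
  proof -
    have "\<exists>b\<in>carrier B. (\<lambda>n. nrm B (\<psi> (x n) \<ominus>\<^bsub>B\<^esub> b)) \<longlonglongrightarrow> 0"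
    proof (rule B.complete)
      show "\<psi> (x n) \<in> carrier B" for n
        using x by (simp add: closed N.C_free)
      fix e :: real assume "0 < e"
      then obtain M where M: "\<And>m n. m \<ge> M \<Longrightarrow> n \<ge> M \<Longrightarrow> universal_seminorm X R (x m - x n) < e"
        using N.C_D [OF x] by blast
      have "nrm B (\<psi> (x m) \<ominus>\<^bsub>B\<^esub> \<psi> (x n)) < e" if "m \<ge> M" "n \<ge> M" for m n
        using le [of "x m - x n"] M [OF that] x by (simp add: diff N.C_free free_diff)
      then show "\<exists>M. \<forall>m\<ge>M. \<forall>n\<ge>M. nrm B (\<psi> (x m) \<ominus>\<^bsub>B\<^esub> \<psi> (x n)) < e" by blast
    qed
    then show ?thesis
      using x by (auto simp: B.converges_def closed N.C_free)
  qed
  define \<phi> where "\<phi> a = (THE b. B.converges (\<lambda>n. \<psi> (class_rep a n)) b)" for a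
  have conv: "B.converges (\<lambda>n. \<psi> (x n)) (\<phi> (N.cls x))" if x: "x \<in> N.C" for x
  proof -
    define y where "y = class_rep (N.cls x)"
    have y: "y \<in> N.C" "N.eqv x y"
      using N.class_rep_cls [OF x] by (auto simp: y_def)
    obtain b where b: "B.converges (\<lambda>n. \<psi> (y n)) b" using ex [OF y(1)] by blast
    then have "\<phi> (N.cls x) = b"
      unfolding \<phi>_def y_def [symmetric] using B.converges_unique by blast
    moreover have "(\<lambda>n. nrm B (\<psi> (x n) \<ominus>\<^bsub>B\<^esub> \<psi> (y n))) \<longlonglongrightarrow> 0"
    proof (rule B.null_dominated [OF _ _ y(2)])
      fix n
      have F: "x n \<in> free_carrier X" "y n \<in> free_carrier X"
        using x y by (auto simp: N.C_free)
      then show "\<psi> (x n) \<ominus>\<^bsub>B\<^esub> \<psi> (y n) \<in> carrier B"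
        by (simp add: closed)
      show "nrm B (\<psi> (x n) \<ominus>\<^bsub>B\<^esub> \<psi> (y n)) \<le> universal_seminorm X R (x n - y n)"
        using le [of "x n - y n"] F by (simp add: diff free_diff)
    qed
    then have lim: "(\<lambda>n. nrm B (\<psi> (x n) \<ominus>\<^bsub>B\<^esub> \<psi> (y n)) + nrm B (\<psi> (y n) \<ominus>\<^bsub>B\<^esub> b)) \<longlonglongrightarrow> 0"
      using b by (intro tendsto_add_zero) (simp_all add: B.converges_def)
    have c: "\<psi> (x n) \<in> carrier B" "\<psi> (y n) \<in> carrier B" "b \<in> carrier B" for n
      using x y b by (auto simp: N.C_free closed B.converges_def)
    have "(\<lambda>n. nrm B (\<psi> (x n) \<ominus>\<^bsub>B\<^esub> b)) \<longlonglongrightarrow> 0"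
      by (rule B.null_dominated [OF _ B.nrm_triangle lim]) (use c in auto)
    ultimately show ?thesis
      using c by (simp add: B.converges_def)
  qed
  have eqI: "\<phi> (N.cls x) = b" if "x \<in> N.C" "B.converges (\<lambda>n. \<psi> (x n)) b" for x b
    using B.converges_unique [OF conv [OF that(1)] that(2)] .
  have const: "\<phi> (N.cls (\<lambda>n. f)) = \<psi> f" if "f \<in> free_carrier X" for f
    using that closed [OF that] B.nrm_eq_0_iff [of "\<zero>\<^bsub>B\<^esub>"]
    by (intro eqI N.C_const) (simp_all add: B.converges_def a_minus_def B.r_neg)
  have in_B: "\<phi> (N.cls x) \<in> carrier B" if "x \<in> N.C" for x
    using conv [OF that] by (simp add: B.converges_def)
  have "\<phi> \<in> star_hom N.K B"
    unfolding star_hom_def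
  proof (intro CollectI conjI ballI allI ring_hom_memI)
    fix a assume "a \<in> carrier N.K"
    then obtain x where x: "x \<in> N.C" "a = N.cls x" by (auto simp: N.carrier_K)
    then have F: "x n \<in> free_carrier X" for n by (simp add: N.C_free)
    show "\<phi> a \<in> carrier B" using x in_B by simp
    show "\<phi> (c \<odot>\<^bsub>N.K\<^esub> a) = c \<odot>\<^bsub>B\<^esub> \<phi> a" for c
      using B.converges_smult [OF conv [OF x(1)], of c] x F
      by (simp add: N.smult_K) (intro eqI N.C_fscale, simp_all add: smult)
    show "\<phi> (adj N.K a) = adj B (\<phi> a)"
      using B.converges_adj [OF conv [OF x(1)]] x F
      by (simp add: N.adj_K) (intro eqI N.C_fstar, simp_all add: star)
    fix b assume "b \<in> carrier N.K"
    then obtain y where y: "y \<in> N.C" "b = N.cls y" by (auto simp: N.carrier_K)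
    then have G: "y n \<in> free_carrier X" for n by (simp add: N.C_free)
    show "\<phi> (a \<otimes>\<^bsub>N.K\<^esub> b) = \<phi> a \<otimes>\<^bsub>B\<^esub> \<phi> b"
      using B.converges_mult [OF conv [OF x(1)] conv [OF y(1)]] x y F G
      by (simp add: N.mult_K) (intro eqI N.C_mult, simp_all add: mult)
    show "\<phi> (a \<oplus>\<^bsub>N.K\<^esub> b) = \<phi> a \<oplus>\<^bsub>B\<^esub> \<phi> b"
      using B.converges_add [OF conv [OF x(1)] conv [OF y(1)]] x y F G
      by (simp add: N.add_K) (intro eqI N.C_add, simp_all add: add)
  next
    show "\<phi> \<one>\<^bsub>N.K\<^esub> = \<one>\<^bsub>B\<^esub>"
      using const [OF free_1] by (simp add: N.one_K one)
  qed
  moreover have "nrm B (\<phi> a) \<le> nrm N.K a" if "a \<in> carrier N.K" for a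
  proof -
    obtain x where x: "x \<in> N.C" "a = N.cls x" using \<open>a \<in> carrier N.K\<close> by (auto simp: N.carrier_K)
    have "nrm B (\<phi> (N.cls x)) \<le> nrm N.K (N.cls x)"
      by (rule LIMSEQ_le [OF B.converges_nrm [OF conv [OF x(1)]] N.nrm_K [OF x(1)]])
         (use x le N.C_free in auto)
    then show ?thesis by (simp add: x(2))
  qed
  ultimately show ?thesis
    unfolding universal_cstar_def universal_map_def using const by blast
qed


section \<open>The two presentations are bounded\<close>

lemma bounded_ads: "bounded_gens (ads_gens G P) (ads_relations G P \<theta>)"
  unfolding bounded_gens_def
proof (intro ballI exI)
  fix x p
  assume x: "x \<in> ads_gens G P"
    and p: "p \<in> admissible_seminorms (ads_gens G P) (ads_relations G P \<theta>)"
  interpret cstar_seminormed "ads_gens G P" p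
    using p by (simp add: cstar_seminormed_def admissible_seminorms_def)
  have "fstar (fgen x) * fgen x - 1 \<in> ads_relations G P \<theta>"
    using x unfolding ads_gens_def ads_relations_def by blast
  then show "p (fgen x) \<le> 1"
    using p x by (intro p_isometry_le) (auto simp: admissible_seminorms_def free_fgen)
qed

lemma bounded_semigroup: "bounded_gens (semigroup_gens S) (semigroup_relations S)"
  unfolding bounded_gens_def
proof (intro ballI exI)
  fix x p
  assume x: "x \<in> semigroup_gens S"
    and p: "p \<in> admissible_seminorms (semigroup_gens S) (semigroup_relations S)"
  interpret cstar_seminormed "semigroup_gens S" p
    using p by (simp add: cstar_seminormed_def admissible_seminorms_def)
  have F: "fgen x \<in> F"
    using x by (rule free_fgen)
  have z: "p r = 0" if "r \<in> semigroup_relations S" for r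
    using p that by (simp add: admissible_seminorms_def)
  have "fstar (fgen x) * fgen x - 1 \<in> semigroup_relations S \<or>
      fstar (fgen x) - fgen x \<in> semigroup_relations S \<and>
      fgen x * fgen x - fgen x \<in> semigroup_relations S"
    using x unfolding semigroup_gens_def semigroup_relations_def by blast
  then show "p (fgen x) \<le> 1"
    using p_isometry_le [OF F] p_projection_le [OF F] z by blast
qed

theorem cstar_algebra_ads_cstar: "cstar_algebra (ads_cstar G P \<theta>)"
  unfolding ads_cstar_def
  by (intro bounded_presentation.cstar_algebra_universal_cstar bounded_presentation.intro bounded_ads)

theorem cstar_algebra_semigroup_cstar: "cstar_algebra (semigroup_cstar S)"
  unfolding semigroup_cstar_def
  by (intro bounded_presentation.cstar_algebra_universal_cstar bounded_presentation.intro bounded_semigroup)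

end

theory Submission
  imports Defs
begin

text \<open>Both algebras are universal, so the isomorphism comes from comparing what they represent. Put
  \<open>S = G \<rtimes> P\<close>. In any C*-algebra, a family \<open>u, s\<close> satisfying the relations of the dynamical system
  and a family \<open>v, e\<close> satisfying the relations of \<open>C*(S)\<close> are the same data. Given \<open>v, e\<close>, restrict
  \<open>v\<close> to \<open>G \<times> {1}\<close> and \<open>{1} \<times> P\<close>. Given \<open>u, s\<close>, put \<open>w (g, p) = u g s p\<close>, which is multiplicative by
  (A1) and consists of isometries, and let the projection of the ideal \<open>x S\<close> be \<open>w x (w x)*\<close>.

  What has to be understood is how (A2) encodes the ideals of \<open>S\<close>. The elements \<open>k, p', q', l\<close>
  in (A2) for \<open>(w (g, p))* w (h, q) = (s p)* u (g\<inverse> h) s q\<close> are exactly those with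
  \<open>(g, p) (k, p') = (h, q) (l, q')\<close> for which this common multiple generates
  \<open>(g, p) S \<inter> (h, q) S\<close>; they exist if and only if this intersection is nonempty (\<open>semidirect_lcm\<close>,
  \<open>semidirect_factorization_exists\<close>). This is where \<open>\<theta> p (G) \<inter> \<theta> q (G) = \<theta> r (G)\<close> enters. Hence \<open>S\<close> is
  right LCM, every constructible ideal of \<open>S\<close> is empty or principal
  (\<open>constructible_ideals_principal\<close>), and (A2) says precisely that
  \<open>x S \<mapsto> w x (w x)*\<close> turns intersections into products (\<open>w_proj_mult\<close> in one direction,
  \<open>adj_v_v_lcm\<close> in the other). The projection depends on \<open>x S\<close> alone because generators of the same
  ideal differ by an invertible element of \<open>S\<close>, and \<open>w\<close> is unitary there (\<open>w_proj_ideal\<close>).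

  The two constructions give homomorphisms in both directions (\<open>ads_hom\<close>, \<open>semigroup_hom\<close>). They
  are inverse to each other on the generators, hence everywhere, because contractive homomorphisms
  are determined by their values on the generators (\<open>universal_cstar_hom_unique\<close>).\<close>

section \<open>Homomorphisms out of free and universal algebras\<close>

context cstar_algebra
begin

lemma adj_one: "adj A \<one> = \<one>"
proof -
  have "adj A (adj A \<one> \<otimes> \<one>) = adj A \<one> \<otimes> adj A (adj A \<one>)"
    by (intro adj_mult adj_closed one_closed)
  then show ?thesis
    by (simp add: adj_adj adj_closed)
qed

lemma minus_eq_zero_iff:
  assumes "x \<in> carrier A" "y \<in> carrier A"
  shows "x \<ominus> y = \<zero> \<longleftrightarrow> x = y"
proof
  assume "x \<ominus> y = \<zero>"
  from minus_equality [OF this [unfolded a_minus_def]] show "x = y"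
    using assms by simp
qed (use assms in \<open>simp add: a_minus_def r_neg\<close>)

lemma adj_zero: "adj A \<zero> = \<zero>"
  using adj_smult [of \<zero> 0] by (simp add: smult_0 adj_closed)

definition word_value :: "('x \<Rightarrow> 'a) \<Rightarrow> 'x star_word \<Rightarrow> 'a" where
  "word_value h w =
     foldr (\<lambda>(x, b) a. (if b then adj A (h x) else h x) \<otimes> a) (letters w) \<one>"

text \<open>The linear extension of \<open>word_value\<close>: evaluation of a noncommutative *-polynomial at the
  family \<open>h\<close>.\<close>

definition free_value :: "('x \<Rightarrow> 'a) \<Rightarrow> 'x free_star \<Rightarrow> 'a" where
  "free_value h f =
     (\<Oplus>w\<in>Poly_Mapping.keys f. Poly_Mapping.lookup f w \<odot> word_value h w)"

context
  fixes h :: "'x \<Rightarrow> 'a"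
  assumes h: "h x \<in> carrier A"
begin

lemma word_value_closed: "word_value h w \<in> carrier A"
proof -
  have "foldr (\<lambda>(x, b) a. (if b then adj A (h x) else h x) \<otimes> a) l \<one> \<in> carrier A" for l
    by (induction l) (auto simp: h adj_closed)
  then show ?thesis by (simp add: word_value_def)
qed

lemma word_value_Cons:
  "word_value h (Word ((x, b) # l)) = (if b then adj A (h x) else h x) \<otimes> word_value h (Word l)"
  by (simp add: word_value_def)

lemma word_value_Nil: "word_value h (Word []) = \<one>"
  by (simp add: word_value_def)

lemma word_value_plus: "word_value h (v + w) = word_value h v \<otimes> word_value h w"
proof -
  have "word_value h (Word (k @ l)) = word_value h (Word k) \<otimes> word_value h (Word l)" for k l
    by (induction k)
      (auto simp: word_value_Cons word_value_Nil word_value_closed h adj_closed m_assoc)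
  then show ?thesis by (simp add: plus_star_word_def)
qed

lemma word_value_star: "word_value h (word_star w) = adj A (word_value h w)"
proof -
  have "word_value h (word_star (Word l)) = adj A (word_value h (Word l))" for l
  proof (induction l)
    case Nil
    then show ?case by (simp add: word_star_def word_value_Nil adj_one)
  next
    case (Cons a l)
    obtain x b where a: "a = (x, b)" by fastforce
    have "word_star (Word (a # l)) = word_star (Word l) + Word [(x, \<not> b)]"
      by (simp add: word_star_def plus_star_word_def a)
    then show ?case
      using Cons by (simp add: word_value_plus word_value_Cons word_value_Nil word_value_closed a
          adj_mult adj_closed adj_adj h)
  qed
  then show ?thesis by (cases w) simp
qed

text \<open>The support of a sum may be smaller than the union of the supports, so additivity needs the
  freedom to sum over any larger finite set.\<close>

lemma free_value_superset:
  assumes "finite W" "Poly_Mapping.keys f \<subseteq> W"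
  shows "free_value h f = (\<Oplus>w\<in>W. Poly_Mapping.lookup f w \<odot> word_value h w)"
  unfolding free_value_def
proof (rule add.finprod_mono_neutral_cong_left [OF assms])
  fix w assume "w \<in> W - Poly_Mapping.keys f"
  then show "Poly_Mapping.lookup f w \<odot> word_value h w = \<zero>"
    using smult_0 [OF word_value_closed] by (simp add: in_keys_iff)
qed (simp_all add: word_value_closed smult_closed)

lemma free_value_single: "free_value h (Poly_Mapping.single w c) = c \<odot> word_value h w"
  using free_value_superset [of "{w}" "Poly_Mapping.single w c"]
  by (simp add: word_value_closed smult_closed)

lemma free_value_closed: "free_value h f \<in> carrier A"
  unfolding free_value_def by (intro finsum_closed) (auto simp: word_value_closed smult_closed)

lemma free_value_add: "free_value h (f + g) = free_value h f \<oplus> free_value h g"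
proof -
  let ?W = "Poly_Mapping.keys f \<union> Poly_Mapping.keys g"
  have "free_value h (f + g)
      = (\<Oplus>w\<in>?W. Poly_Mapping.lookup f w \<odot> word_value h w \<oplus> Poly_Mapping.lookup g w \<odot> word_value h w)"
    using Poly_Mapping.keys_add [of f g]
    by (subst free_value_superset [of ?W])
       (auto simp: lookup_add smult_add_left word_value_closed smult_closed intro!: finsum_cong')
  also have "\<dots> = free_value h f \<oplus> free_value h g"
    by (subst finsum_addf)
       (auto simp: word_value_closed smult_closed free_value_superset [of ?W])
  finally show ?thesis .
qed

lemma free_value_mult: "free_value h (f * g) = free_value h f \<otimes> free_value h g"
proof (induction f rule: free_induct)
  case (single v c)
  show ?case
  proof (induction g rule: free_induct)
    case (single w d)
    show ?case
      by (simp add: mult_single free_value_single word_value_plus word_value_closed smult_closed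
          smult_mult_left smult_mult_right smult_smult mult.commute [of c d])
  next
    case (add f g)
    then show ?case by (simp add: distrib_left free_value_add free_value_closed r_distr)
  qed
next
  case (add f g)
  then show ?case by (simp add: distrib_right free_value_add free_value_closed l_distr)
qed

lemma free_value_fstar: "free_value h (fstar f) = adj A (free_value h f)"
proof (induction f rule: free_induct)
  case (single w c)
  show ?case
    by (simp add: fstar_single free_value_single word_value_star word_value_closed adj_smult)
next
  case (add f g)
  then show ?case by (simp add: fstar_add free_value_add free_value_closed adj_add)
qed

lemma free_value_one: "free_value h 1 = \<one>"
proof -
  have "free_value h (Poly_Mapping.single 0 1) = \<one>"
    by (simp only: free_value_single zero_star_word_def word_value_Nil smult_one one_closed)
  then show ?thesis by simp
qed

lemma free_value_fscale: "free_value h (fscale c f) = c \<odot> free_value h f"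
proof -
  have "free_value h (Poly_Mapping.single 0 c) = c \<odot> \<one>"
    by (simp only: free_value_single zero_star_word_def word_value_Nil)
  then show ?thesis
    by (simp add: fscale_def free_value_mult free_value_closed smult_mult_left)
qed

lemma free_value_fgen: "free_value h (fgen x) = h x"
  by (simp add: fgen_def free_value_single word_value_Cons word_value_Nil h smult_one)

end

theorem free_star_algebra_universal:
  assumes h: "\<And>x. x \<in> X \<Longrightarrow> h x \<in> carrier A"
  shows "\<exists>\<psi>\<in>star_hom (free_star_algebra X) A. \<forall>x\<in>X. \<psi> (fgen x) = h x"
proof -
  \<comment> \<open>Evaluation treats all letters alike, including those outside \<open>X\<close>, so \<open>h\<close> is made total with
    values in \<open>A\<close>.\<close>
  define k where "k x = (if x \<in> X then h x else \<zero>)" for x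
  have k: "k x \<in> carrier A" for x
    using h by (simp add: k_def)
  have "free_value k \<in> star_hom (free_star_algebra X) A"
    by (auto simp: star_hom_def ring_hom_def free_star_algebra_def k free_value_closed
        free_value_add free_value_mult free_value_fscale free_value_fstar free_value_one)
  moreover have "free_value k (fgen x) = h x" if "x \<in> X" for x
    using that by (simp add: free_value_fgen k) (simp add: k_def)
  ultimately show ?thesis by blast
qed

end

lemma star_hom_free:
  assumes "\<psi> \<in> star_hom (free_star_algebra X) B"
  shows "f \<in> free_carrier X \<Longrightarrow> \<psi> f \<in> carrier B"
    and "f \<in> free_carrier X \<Longrightarrow> g \<in> free_carrier X \<Longrightarrow> \<psi> (f + g) = \<psi> f \<oplus>\<^bsub>B\<^esub> \<psi> g"
    and "f \<in> free_carrier X \<Longrightarrow> g \<in> free_carrier X \<Longrightarrow> \<psi> (f * g) = \<psi> f \<otimes>\<^bsub>B\<^esub> \<psi> g"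
    and "f \<in> free_carrier X \<Longrightarrow> \<psi> (fscale c f) = c \<odot>\<^bsub>B\<^esub> \<psi> f"
    and "f \<in> free_carrier X \<Longrightarrow> \<psi> (fstar f) = adj B (\<psi> f)"
    and "\<psi> 1 = \<one>\<^bsub>B\<^esub>"
  using assms by (auto simp: star_hom_def ring_hom_def free_star_algebra_def)

lemma star_hom_free_diff:
  assumes "cstar_algebra B" and \<psi>: "\<psi> \<in> star_hom (free_star_algebra X) B"
    and "f \<in> free_carrier X" "g \<in> free_carrier X"
  shows "\<psi> (f - g) = \<psi> f \<ominus>\<^bsub>B\<^esub> \<psi> g"
proof -
  interpret B: cstar_algebra B by fact
  show ?thesis
    using star_hom_free(2) [OF \<psi>, of f "fscale (-1) g"] star_hom_free(4) [OF \<psi>, of g "-1"] assms(3,4)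
    by (simp add: star_hom_free(1) [OF \<psi>] free_closed fscale_minus_1 B.smult_minus_1 a_minus_def)
qed

lemma star_hom_free_zero:
  assumes "cstar_algebra B" and \<psi>: "\<psi> \<in> star_hom (free_star_algebra X) B"
  shows "\<psi> 0 = \<zero>\<^bsub>B\<^esub>"
proof -
  interpret B: cstar_algebra B by fact
  have "\<psi> (0 - 0) = \<psi> 0 \<ominus>\<^bsub>B\<^esub> \<psi> 0"
    by (rule star_hom_free_diff [OF assms free_0 free_0])
  also have "\<dots> = \<zero>\<^bsub>B\<^esub>"
    using star_hom_free(1) [OF \<psi> free_0] by (simp add: a_minus_def B.r_neg)
  finally show ?thesis by simp
qed

text \<open>Every *-homomorphism of C*-algebras is contractive, but the maps below are contractive already by
  their construction from the universal seminorm, so the property is simply carried along.\<close>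

definition contractive ::
    "('a, 'm) cstar_algebra_scheme \<Rightarrow> ('b, 'n) cstar_algebra_scheme \<Rightarrow> ('a \<Rightarrow> 'b) \<Rightarrow> bool" where
  "contractive A B \<phi> \<longleftrightarrow> (\<forall>a\<in>carrier A. nrm B (\<phi> a) \<le> nrm A a)"

lemma star_hom_closed: "\<phi> \<in> star_hom A B \<Longrightarrow> a \<in> carrier A \<Longrightarrow> \<phi> a \<in> carrier B"
  by (auto simp: star_hom_def ring_hom_def)

lemma star_hom_diff:
  assumes "cstar_algebra A" "cstar_algebra B" and \<phi>: "\<phi> \<in> star_hom A B"
    and "a \<in> carrier A" "b \<in> carrier A"
  shows "\<phi> (a \<ominus>\<^bsub>A\<^esub> b) = \<phi> a \<ominus>\<^bsub>B\<^esub> \<phi> b"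
proof -
  interpret A: cstar_algebra A by fact
  interpret B: cstar_algebra B by fact
  have "\<phi> (a \<oplus>\<^bsub>A\<^esub> (-1) \<odot>\<^bsub>A\<^esub> b) = \<phi> a \<oplus>\<^bsub>B\<^esub> (-1) \<odot>\<^bsub>B\<^esub> \<phi> b"
    using \<phi> assms(4,5) A.smult_closed [of b "-1"] by (auto simp: star_hom_def ring_hom_def)
  then show ?thesis
    using assms(4,5) star_hom_closed [OF \<phi>] by (simp add: A.smult_minus_1 B.smult_minus_1 a_minus_def)
qed

lemma star_hom_zero:
  assumes "cstar_algebra A" "cstar_algebra B" and \<phi>: "\<phi> \<in> star_hom A B"
  shows "\<phi> \<zero>\<^bsub>A\<^esub> = \<zero>\<^bsub>B\<^esub>"
proof -
  interpret A: cstar_algebra A by fact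
  interpret B: cstar_algebra B by fact
  have "\<phi> (\<zero>\<^bsub>A\<^esub> \<ominus>\<^bsub>A\<^esub> \<zero>\<^bsub>A\<^esub>) = \<phi> \<zero>\<^bsub>A\<^esub> \<ominus>\<^bsub>B\<^esub> \<phi> \<zero>\<^bsub>A\<^esub>"
    by (rule star_hom_diff [OF assms A.zero_closed A.zero_closed])
  then show ?thesis
    using star_hom_closed [OF \<phi> A.zero_closed]
    by (simp add: A.minus_eq_zero_iff B.r_neg a_minus_def)
qed

lemma star_hom_compose:
  assumes "\<phi> \<in> star_hom A B" "\<psi> \<in> star_hom B C"
  shows "(\<lambda>a. \<psi> (\<phi> a)) \<in> star_hom A C"
  using assms by (simp add: star_hom_def ring_hom_def Pi_iff)

lemma star_hom_id: "(\<lambda>a. a) \<in> star_hom A A"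
  by (simp add: star_hom_def ring_hom_def)

context bounded_presentation
begin

text \<open>The universal property in terms of generators: a family in \<open>B\<close> extends as soon as evaluation at
  it kills the relations. That evaluation is characterised by being a *-homomorphism with the
  given values, so the assumption \<open>rel\<close> can be checked without knowing how it is constructed.\<close>

theorem universal_cstar_hom_exists:
  assumes B: "cstar_algebra B"
    and h: "\<And>x. x \<in> X \<Longrightarrow> h x \<in> carrier B"
    and rel: "\<And>\<psi> r. \<psi> \<in> star_hom (free_star_algebra X) B \<Longrightarrow> (\<And>x. x \<in> X \<Longrightarrow> \<psi> (fgen x) = h x) \<Longrightarrow>
      r \<in> R \<Longrightarrow> \<psi> r = \<zero>\<^bsub>B\<^esub>"
  shows "\<exists>\<phi>\<in>star_hom (universal_cstar X R) B. contractive (universal_cstar X R) B \<phi> \<and>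
    (\<forall>x\<in>X. \<phi> (universal_map X R (fgen x)) = h x)"
proof -
  obtain \<psi> where \<psi>: "\<psi> \<in> star_hom (free_star_algebra X) B" "\<And>x. x \<in> X \<Longrightarrow> \<psi> (fgen x) = h x"
    using cstar_algebra.free_star_algebra_universal [OF B, of X h] h by auto
  have "\<exists>\<phi>\<in>star_hom (universal_cstar X R) B.
      (\<forall>f\<in>free_carrier X. \<phi> (universal_map X R f) = \<psi> f) \<and>
      (\<forall>a\<in>carrier (universal_cstar X R). nrm B (\<phi> a) \<le> nrm (universal_cstar X R) a)"
    by (rule universal_cstar_universal [OF B \<psi>(1)]) (rule rel [OF \<psi>])
  then obtain \<phi> where \<phi>: "\<phi> \<in> star_hom (universal_cstar X R) B"
      "\<forall>f\<in>free_carrier X. \<phi> (universal_map X R f) = \<psi> f"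
      "contractive (universal_cstar X R) B \<phi>"
    unfolding contractive_def by (elim bexE conjE)
  show ?thesis
    by (rule bexI [OF _ \<phi>(1)]) (simp add: \<phi>(2,3) \<psi>(2) free_fgen)
qed

text \<open>Both homomorphisms agree on the image of the free algebra, which is dense, and contractions are
  continuous.\<close>

theorem universal_cstar_hom_unique:
  assumes B: "cstar_algebra B"
    and \<phi>: "\<phi> \<in> star_hom (universal_cstar X R) B" "contractive (universal_cstar X R) B \<phi>"
    and \<psi>: "\<psi> \<in> star_hom (universal_cstar X R) B" "contractive (universal_cstar X R) B \<psi>"
    and gens: "\<And>x. x \<in> X \<Longrightarrow> \<phi> (universal_map X R (fgen x)) = \<psi> (universal_map X R (fgen x))"
    and a: "a \<in> carrier (universal_cstar X R)"
  shows "\<phi> a = \<psi> a"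
proof -
  interpret B: cstar_algebra B by fact
  interpret U: cstar_algebra "universal_cstar X R" by (rule cstar_algebra_universal_cstar)
  note hom = star_hom_free [OF universal_map_star_hom]
  have hom_\<phi>: "(\<lambda>f. \<phi> (universal_map X R f)) \<in> star_hom (free_star_algebra X) B"
    by (rule star_hom_compose [OF universal_map_star_hom \<phi>(1)])
  have hom_\<psi>: "(\<lambda>f. \<psi> (universal_map X R f)) \<in> star_hom (free_star_algebra X) B"
    by (rule star_hom_compose [OF universal_map_star_hom \<psi>(1)])
  have free: "\<phi> (universal_map X R f) = \<psi> (universal_map X R f)" if "f \<in> free_carrier X" for f
    using that
  proof (induction rule: free_carrier_induct)
    case zero
    show ?case
      using star_hom_free_zero [OF B hom_\<phi>] star_hom_free_zero [OF B hom_\<psi>] by simp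
  next
    case (gen x)
    then show ?case by (rule gens)
  next
    case one
    show ?case using star_hom_free(6) [OF hom_\<phi>] star_hom_free(6) [OF hom_\<psi>] by simp
  next
    case (add f g)
    then show ?case
      using star_hom_free(2) [OF hom_\<phi> add.hyps] star_hom_free(2) [OF hom_\<psi> add.hyps] by simp
  next
    case (mult f g)
    then show ?case
      using star_hom_free(3) [OF hom_\<phi> mult.hyps] star_hom_free(3) [OF hom_\<psi> mult.hyps] by simp
  next
    case (fscale c f)
    then show ?case
      using star_hom_free(4) [OF hom_\<phi> fscale.hyps] star_hom_free(4) [OF hom_\<psi> fscale.hyps] by simp
  next
    case (fstar f)
    then show ?case
      using star_hom_free(5) [OF hom_\<phi> fstar.hyps] star_hom_free(5) [OF hom_\<psi> fstar.hyps] by simp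
  qed
  have c: "\<phi> a \<in> carrier B" "\<psi> a \<in> carrier B"
    by (rule star_hom_closed [OF \<phi>(1) a], rule star_hom_closed [OF \<psi>(1) a])
  have "nrm B (\<phi> a \<ominus>\<^bsub>B\<^esub> \<psi> a) \<le> 0"
  proof (rule field_le_epsilon)
    fix e :: real
    assume "0 < e"
    then obtain f where f: "f \<in> free_carrier X"
      and near: "nrm (universal_cstar X R) (a \<ominus>\<^bsub>universal_cstar X R\<^esub> universal_map X R f) < e / 2"
      using universal_map_dense [OF a, of "e / 2"] by auto
    let ?b = "universal_map X R f"
    have b: "?b \<in> carrier (universal_cstar X R)"
      using f by (rule hom(1))
    have near': "nrm B (\<chi> a \<ominus>\<^bsub>B\<^esub> \<chi> ?b) < e / 2"
      if "\<chi> \<in> star_hom (universal_cstar X R) B" "contractive (universal_cstar X R) B \<chi>" for \<chi>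
    proof -
      have "nrm B (\<chi> (a \<ominus>\<^bsub>universal_cstar X R\<^esub> ?b)) < e / 2"
        using that(2) near U.minus_closed [OF a b] unfolding contractive_def by fastforce
      then show ?thesis
        by (simp add: star_hom_diff [OF U.cstar_algebra_axioms B that(1) a b])
    qed
    have "nrm B (\<phi> a \<ominus>\<^bsub>B\<^esub> \<psi> a) \<le> nrm B (\<phi> a \<ominus>\<^bsub>B\<^esub> \<phi> ?b) + nrm B (\<phi> ?b \<ominus>\<^bsub>B\<^esub> \<psi> a)"
      using c star_hom_closed [OF \<phi>(1) b] by (intro B.nrm_triangle)
    also have "nrm B (\<phi> ?b \<ominus>\<^bsub>B\<^esub> \<psi> a) = nrm B (\<psi> a \<ominus>\<^bsub>B\<^esub> \<psi> ?b)"
      using c star_hom_closed [OF \<psi>(1) b] by (simp add: free [OF f] B.nrm_minus_commute)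
    finally show "nrm B (\<phi> a \<ominus>\<^bsub>B\<^esub> \<psi> a) \<le> 0 + e"
      using near' [OF \<phi>] near' [OF \<psi>] by linarith
  qed
  then have "\<phi> a \<ominus>\<^bsub>B\<^esub> \<psi> a = \<zero>\<^bsub>B\<^esub>"
    using c B.nrm_nonneg [of "\<phi> a \<ominus>\<^bsub>B\<^esub> \<psi> a"] B.nrm_eq_0_iff [of "\<phi> a \<ominus>\<^bsub>B\<^esub> \<psi> a"] by simp
  then show ?thesis using c by (simp add: B.minus_eq_zero_iff)
qed

end

theorem universal_cstar_isoI:
  assumes bounded: "bounded_presentation X R" "bounded_presentation Y T"
    and \<phi>: "\<phi> \<in> star_hom (universal_cstar X R) (universal_cstar Y T)"
      "contractive (universal_cstar X R) (universal_cstar Y T) \<phi>"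
    and \<psi>: "\<psi> \<in> star_hom (universal_cstar Y T) (universal_cstar X R)"
      "contractive (universal_cstar Y T) (universal_cstar X R) \<psi>"
    and \<psi>\<phi>: "\<And>x. x \<in> X \<Longrightarrow> \<psi> (\<phi> (universal_map X R (fgen x))) = universal_map X R (fgen x)"
    and \<phi>\<psi>: "\<And>y. y \<in> Y \<Longrightarrow> \<phi> (\<psi> (universal_map Y T (fgen y))) = universal_map Y T (fgen y)"
  shows "\<phi> \<in> star_iso (universal_cstar X R) (universal_cstar Y T)"
proof -
  have id: "contractive A A (\<lambda>a. a)" for A :: "('c, 'n) cstar_algebra_scheme"
    by (simp add: contractive_def)
  have contr: "contractive (universal_cstar X R) (universal_cstar X R) (\<lambda>a. \<psi> (\<phi> a))"
    "contractive (universal_cstar Y T) (universal_cstar Y T) (\<lambda>b. \<phi> (\<psi> b))"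
    using \<phi> \<psi> star_hom_closed unfolding contractive_def by (meson order_trans)+
  have 1: "\<psi> (\<phi> a) = a" if "a \<in> carrier (universal_cstar X R)" for a
    using bounded_presentation.universal_cstar_hom_unique [OF bounded(1)
        bounded_presentation.cstar_algebra_universal_cstar [OF bounded(1)]
        star_hom_compose [OF \<phi>(1) \<psi>(1)] contr(1) star_hom_id id \<psi>\<phi> that] .
  have 2: "\<phi> (\<psi> b) = b" if "b \<in> carrier (universal_cstar Y T)" for b
    using bounded_presentation.universal_cstar_hom_unique [OF bounded(2)
        bounded_presentation.cstar_algebra_universal_cstar [OF bounded(2)]
        star_hom_compose [OF \<psi>(1) \<phi>(1)] contr(2) star_hom_id id \<phi>\<psi> that] .
  have "bij_betw \<phi> (carrier (universal_cstar X R)) (carrier (universal_cstar Y T))"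
    by (rule bij_betw_byWitness [where f' = \<psi>]) (use 1 2 star_hom_closed \<phi>(1) \<psi>(1) in auto)
  then show ?thesis using \<phi>(1) by (simp add: star_iso_def)
qed

section \<open>Principal right ideals\<close>

lemma mem_l_coset_iff: "x \<in> a <#\<^bsub>S\<^esub> H \<longleftrightarrow> (\<exists>h\<in>H. x = a \<otimes>\<^bsub>S\<^esub> h)"
  by (auto simp: l_coset_def)

context monoid
begin

lemma l_coset_l_coset:
  assumes "a \<in> carrier G" "b \<in> carrier G"
  shows "a <# (b <# carrier G) = (a \<otimes> b) <# carrier G"
  using assms by (auto simp: l_coset_def m_assoc)

lemma principal_mult_subset:
  assumes "a \<in> carrier G" "b \<in> carrier G"
  shows "(a \<otimes> b) <# carrier G \<subseteq> a <# carrier G"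
proof
  fix x assume "x \<in> (a \<otimes> b) <# carrier G"
  then obtain c where "c \<in> carrier G" "x = a \<otimes> (b \<otimes> c)"
    using assms by (auto simp: mem_l_coset_iff m_assoc)
  then show "x \<in> a <# carrier G"
    using assms by (auto simp: mem_l_coset_iff)
qed

lemma self_mem_principal: "a \<in> carrier G \<Longrightarrow> a \<in> a <# carrier G"
  unfolding mem_l_coset_iff by (intro bexI [of _ \<one>]) auto

lemma one_principal: "\<one> <# carrier G = carrier G"
  by (auto simp: l_coset_def)

lemma principal_constructible: "a \<in> carrier G \<Longrightarrow> a <# carrier G \<in> constructible_ideals G"
  by (intro constructible_ideals.image constructible_ideals.carrier)

end

context left_cancellative_monoid
begin

text \<open>Generators of the same principal ideal differ by a unit. Cancellation gives \<open>x \<otimes> y = \<one>\<close>;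
  one-sided invertibility is all that an isometric representation needs in order to be unitary at
  \<open>x\<close>.\<close>

lemma principal_eqE:
  assumes "a \<in> carrier S" "b \<in> carrier S" "a <# carrier S = b <# carrier S"
  obtains x y where "x \<in> carrier S" "y \<in> carrier S" "b = a \<otimes> x" "a = b \<otimes> y" "x \<otimes> y = \<one>"
proof -
  obtain x y where xy: "x \<in> carrier S" "y \<in> carrier S" "b = a \<otimes> x" "a = b \<otimes> y"
    using self_mem_principal [OF assms(1)] self_mem_principal [OF assms(2)] assms(3)
    by (metis mem_l_coset_iff)
  have "a \<otimes> (x \<otimes> y) = (a \<otimes> x) \<otimes> y"
    using assms(1) xy(1,2) by (simp add: m_assoc)
  also have "\<dots> = a \<otimes> \<one>"
    unfolding xy(3) [symmetric] xy(4) [symmetric] using assms(1) by simp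
  finally have "x \<otimes> y = \<one>"
    by (rule left_cancel [OF assms(1) m_closed [OF xy(1,2)] one_closed])
  then show thesis using that xy by blast
qed

end

context right_lcm_monoid
begin

text \<open>Only preimages need an argument: if \<open>p S \<inter> a S = r S\<close> and \<open>r = p b\<close>, then \<open>p y \<in> a S\<close> means
  \<open>p y \<in> p b S\<close>, so the preimage of \<open>a S\<close> under \<open>p\<close> is \<open>b S\<close> by cancellation.\<close>

lemma constructible_ideals_principal:
  assumes "X \<in> constructible_ideals S"
  shows "X = {} \<or> (\<exists>a\<in>carrier S. X = a <# carrier S)"
  using assms
proof induction
  case carrier
  then show ?case using one_principal by blast
next
  case empty
  then show ?case by simp
next
  case (image p X)
  have "p <# {} = {}" by (simp add: l_coset_def)
  with image show ?case
    by (metis l_coset_l_coset m_closed)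
next
  case (preimage p X)
  let ?Y = "{y \<in> carrier S. p \<otimes> y \<in> X}"
  have "?Y = {}" if "X = {}"
    using that by simp
  moreover have "?Y = {} \<or> (\<exists>b\<in>carrier S. ?Y = b <# carrier S)"
    if a: "a \<in> carrier S" "X = a <# carrier S" for a
    using right_lcm [OF \<open>p \<in> carrier S\<close> a(1)]
  proof
    assume disj: "(p <# carrier S) \<inter> (a <# carrier S) = {}"
    have "p \<otimes> y \<in> (p <# carrier S) \<inter> (a <# carrier S)" if "y \<in> ?Y" for y
      using that a by (auto simp: mem_l_coset_iff)
    then show ?thesis
      unfolding disj by blast
  next
    assume "\<exists>r\<in>carrier S. (p <# carrier S) \<inter> (a <# carrier S) = r <# carrier S"
    then obtain r where r: "r \<in> carrier S" "(p <# carrier S) \<inter> (a <# carrier S) = r <# carrier S"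
      by blast
    then obtain b where b: "b \<in> carrier S" "r = p \<otimes> b"
      using self_mem_principal [OF r(1)] unfolding r(2) [symmetric] by (auto simp: mem_l_coset_iff)
    have "y \<in> ?Y \<longleftrightarrow> y \<in> b <# carrier S" if y: "y \<in> carrier S" for y
    proof -
      have "y \<in> ?Y \<longleftrightarrow> p \<otimes> y \<in> (p <# carrier S) \<inter> (a <# carrier S)"
        using y a by (auto simp: mem_l_coset_iff)
      also have "\<dots> \<longleftrightarrow> (\<exists>z\<in>carrier S. p \<otimes> y = p \<otimes> (b \<otimes> z))"
        using r b \<open>p \<in> carrier S\<close> by (simp add: mem_l_coset_iff m_assoc)
      also have "\<dots> \<longleftrightarrow> y \<in> b <# carrier S"
        using left_cancel [OF \<open>p \<in> carrier S\<close> y] b by (auto simp: mem_l_coset_iff)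
      finally show ?thesis .
    qed
    moreover have "b <# carrier S \<subseteq> carrier S"
      using b by (auto simp: mem_l_coset_iff)
    ultimately have "?Y = b <# carrier S" by blast
    then show ?thesis using b by blast
  qed
  ultimately show ?case using preimage.IH by blast
qed

lemma constructible_ideals_Int:
  assumes "X \<in> constructible_ideals S" "Y \<in> constructible_ideals S"
  shows "X \<inter> Y \<in> constructible_ideals S"
proof (cases "X = {} \<or> Y = {}")
  case True
  then show ?thesis using constructible_ideals.empty by auto
next
  case False
  then obtain a b where ab: "a \<in> carrier S" "X = a <# carrier S" "b \<in> carrier S" "Y = b <# carrier S"
    using constructible_ideals_principal assms by blast
  show ?thesis
    using right_lcm [OF ab(1,3)] principal_constructible constructible_ideals.empty
    unfolding ab(2,4) by auto
qed

end

section \<open>The semidirect product\<close>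

context algebraic_dynamical_system
begin

abbreviation "S \<equiv> semidirect G P \<theta>"

lemma semidirect_simps:
  "carrier S = carrier G \<times> carrier P"
  "(g, p) \<otimes>\<^bsub>S\<^esub> (h, q) = (g \<otimes>\<^bsub>G\<^esub> \<theta> p h, p \<otimes>\<^bsub>P\<^esub> q)"
  "\<one>\<^bsub>S\<^esub> = (\<one>\<^bsub>G\<^esub>, \<one>\<^bsub>P\<^esub>)"
  by (simp_all add: semidirect_def)

lemma action_closed: "p \<in> carrier P \<Longrightarrow> g \<in> carrier G \<Longrightarrow> \<theta> p g \<in> carrier G"
  using action_hom by (auto simp: hom_def)

lemma action_distrib:
  "p \<in> carrier P \<Longrightarrow> g \<in> carrier G \<Longrightarrow> h \<in> carrier G \<Longrightarrow> \<theta> p (g \<otimes>\<^bsub>G\<^esub> h) = \<theta> p g \<otimes>\<^bsub>G\<^esub> \<theta> p h"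
  using action_hom by (auto simp: hom_def)

lemma action_group_hom: "p \<in> carrier P \<Longrightarrow> group_hom G G (\<theta> p)"
  by (simp add: group_hom_def group_hom_axioms_def action_hom)

lemma action_inv: "p \<in> carrier P \<Longrightarrow> g \<in> carrier G \<Longrightarrow> \<theta> p (inv\<^bsub>G\<^esub> g) = inv\<^bsub>G\<^esub> \<theta> p g"
  by (rule group_hom.hom_inv [OF action_group_hom])

lemma action_group_one: "p \<in> carrier P \<Longrightarrow> \<theta> p \<one>\<^bsub>G\<^esub> = \<one>\<^bsub>G\<^esub>"
  by (rule group_hom.hom_one [OF action_group_hom])

lemma left_cancellative_semidirect: "left_cancellative_monoid S"
proof
  fix x y z assume "x \<in> carrier S" "y \<in> carrier S"
  then show "x \<otimes>\<^bsub>S\<^esub> y \<in> carrier S"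
    by (auto simp: semidirect_simps action_closed)
  assume "z \<in> carrier S"
  then show "x \<otimes>\<^bsub>S\<^esub> y \<otimes>\<^bsub>S\<^esub> z = x \<otimes>\<^bsub>S\<^esub> (y \<otimes>\<^bsub>S\<^esub> z)"
    using \<open>x \<in> carrier S\<close> \<open>y \<in> carrier S\<close>
    by (auto simp: semidirect_simps action_closed action_distrib action_mult G.m_assoc P.m_assoc)
next
  show "\<one>\<^bsub>S\<^esub> \<in> carrier S" by (simp add: semidirect_simps)
next
  fix x assume "x \<in> carrier S"
  then show "\<one>\<^bsub>S\<^esub> \<otimes>\<^bsub>S\<^esub> x = x" "x \<otimes>\<^bsub>S\<^esub> \<one>\<^bsub>S\<^esub> = x"
    by (auto simp: semidirect_simps action_one action_group_one)
next
  fix x y z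
  assume "x \<in> carrier S" "y \<in> carrier S" "z \<in> carrier S" and eq: "x \<otimes>\<^bsub>S\<^esub> y = x \<otimes>\<^bsub>S\<^esub> z"
  then obtain g p h q k r where [simp]: "x = (g, p)" "y = (h, q)" "z = (k, r)"
    and c: "g \<in> carrier G" "p \<in> carrier P" "h \<in> carrier G" "q \<in> carrier P"
      "k \<in> carrier G" "r \<in> carrier P"
    by (auto simp: semidirect_simps)
  have "\<theta> p h = \<theta> p k" "p \<otimes>\<^bsub>P\<^esub> q = p \<otimes>\<^bsub>P\<^esub> r"
    using eq c by (simp_all add: semidirect_simps action_closed)
  then show "y = z"
    using inj_onD [OF action_inj [OF c(2)] _ c(3,5)] P.left_cancel [OF c(2,4,6)] by simp
qed

sublocale S: left_cancellative_monoid S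
  by (rule left_cancellative_semidirect)

text \<open>The factorization \<open>g\<inverse> h = \<theta> p k (\<theta> q l)\<inverse>\<close> is the equation \<open>g \<theta> p k = h \<theta> q l\<close>, which is the first
  coordinate of \<open>(g, p) (k, p') = (h, q) (l, q')\<close>. Any other common multiple has a second coordinate
  in \<open>r P\<close>, and its first coordinate differs from that one by an element of
  \<open>\<theta> p (G) \<inter> \<theta> q (G) = \<theta> r (G)\<close>, so it is a multiple of this one.\<close>

lemma semidirect_lcm:
  assumes g: "g \<in> carrier G" and h: "h \<in> carrier G"
    and p: "p \<in> carrier P" and q: "q \<in> carrier P"
    and fact: "lcm_factorization G P \<theta> p q (inv\<^bsub>G\<^esub> g \<otimes>\<^bsub>G\<^esub> h) k p' q' l"
  shows "(g, p) \<otimes>\<^bsub>S\<^esub> (k, p') = (h, q) \<otimes>\<^bsub>S\<^esub> (l, q')"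
    and "((g, p) <#\<^bsub>S\<^esub> carrier S) \<inter> ((h, q) <#\<^bsub>S\<^esub> carrier S) = ((g, p) \<otimes>\<^bsub>S\<^esub> (k, p')) <#\<^bsub>S\<^esub> carrier S"
proof -
  from fact obtain r where c: "p' \<in> carrier P" "q' \<in> carrier P" "k \<in> carrier G" "l \<in> carrier G"
    and r: "r \<in> carrier P" "(p <#\<^bsub>P\<^esub> carrier P) \<inter> (q <#\<^bsub>P\<^esub> carrier P) = r <#\<^bsub>P\<^esub> carrier P"
      "p \<otimes>\<^bsub>P\<^esub> p' = r" "q \<otimes>\<^bsub>P\<^esub> q' = r"
    and eq: "inv\<^bsub>G\<^esub> g \<otimes>\<^bsub>G\<^esub> h = \<theta> p k \<otimes>\<^bsub>G\<^esub> \<theta> q (inv\<^bsub>G\<^esub> l)"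
    unfolding lcm_factorization_def by blast
  note [simp] = g h p q c r(1) action_closed
  have "h \<otimes>\<^bsub>G\<^esub> \<theta> q l = g \<otimes>\<^bsub>G\<^esub> (inv\<^bsub>G\<^esub> g \<otimes>\<^bsub>G\<^esub> h) \<otimes>\<^bsub>G\<^esub> \<theta> q l"
    by (simp flip: G.m_assoc)
  also have "\<dots> = g \<otimes>\<^bsub>G\<^esub> (\<theta> p k \<otimes>\<^bsub>G\<^esub> inv\<^bsub>G\<^esub> \<theta> q l) \<otimes>\<^bsub>G\<^esub> \<theta> q l"
    by (simp only: eq action_inv q c)
  also have "\<dots> = g \<otimes>\<^bsub>G\<^esub> \<theta> p k"
    by (simp add: G.m_assoc)
  finally have gh: "g \<otimes>\<^bsub>G\<^esub> \<theta> p k = h \<otimes>\<^bsub>G\<^esub> \<theta> q l" ..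
  then show prod: "(g, p) \<otimes>\<^bsub>S\<^esub> (k, p') = (h, q) \<otimes>\<^bsub>S\<^esub> (l, q')"
    by (simp add: semidirect_simps r)
  show "((g, p) <#\<^bsub>S\<^esub> carrier S) \<inter> ((h, q) <#\<^bsub>S\<^esub> carrier S) = ((g, p) \<otimes>\<^bsub>S\<^esub> (k, p')) <#\<^bsub>S\<^esub> carrier S"
    (is "?L = ?R")
  proof
    have "?R \<subseteq> (g, p) <#\<^bsub>S\<^esub> carrier S"
      by (rule S.principal_mult_subset) (simp_all add: semidirect_simps)
    moreover have "?R \<subseteq> (h, q) <#\<^bsub>S\<^esub> carrier S"
      unfolding prod by (rule S.principal_mult_subset) (simp_all add: semidirect_simps)
    ultimately show "?R \<subseteq> ?L" by blast
  next
    show "?L \<subseteq> ?R"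
    proof
      fix z assume "z \<in> ?L"
      then obtain a x b y where ab: "a \<in> carrier G" "x \<in> carrier P" "b \<in> carrier G" "y \<in> carrier P"
        and z: "z = (g \<otimes>\<^bsub>G\<^esub> \<theta> p a, p \<otimes>\<^bsub>P\<^esub> x)"
        and z1: "g \<otimes>\<^bsub>G\<^esub> \<theta> p a = h \<otimes>\<^bsub>G\<^esub> \<theta> q b" and z2: "p \<otimes>\<^bsub>P\<^esub> x = q \<otimes>\<^bsub>P\<^esub> y"
        by (auto simp: mem_l_coset_iff semidirect_simps)
      note [simp] = ab
      have "p \<otimes>\<^bsub>P\<^esub> x \<in> r <#\<^bsub>P\<^esub> carrier P"
        unfolding r(2) [symmetric] using z2 ab by (metis IntI mem_l_coset_iff)
      then obtain c where c: "c \<in> carrier P" "p \<otimes>\<^bsub>P\<^esub> x = r \<otimes>\<^bsub>P\<^esub> c"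
        by (auto simp: mem_l_coset_iff)
      \<comment> \<open>The quotient of the two first coordinates lies in \<open>\<theta> p (G)\<close> and, by \<open>gh\<close> and \<open>z1\<close>, in
        \<open>\<theta> q (G)\<close>.\<close>
      let ?d = "inv\<^bsub>G\<^esub> (g \<otimes>\<^bsub>G\<^esub> \<theta> p k) \<otimes>\<^bsub>G\<^esub> (g \<otimes>\<^bsub>G\<^esub> \<theta> p a)"
      have "?d = \<theta> p (inv\<^bsub>G\<^esub> k \<otimes>\<^bsub>G\<^esub> a)"
        by (simp add: action_distrib action_inv G.inv_mult_group G.m_assoc)
           (simp flip: G.m_assoc)
      moreover have "?d = \<theta> q (inv\<^bsub>G\<^esub> l \<otimes>\<^bsub>G\<^esub> b)"
        unfolding gh z1 by (simp add: action_distrib action_inv G.inv_mult_group G.m_assoc)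
           (simp flip: G.m_assoc)
      ultimately have "?d \<in> \<theta> p ` carrier G \<inter> \<theta> q ` carrier G"
        by (metis IntI G.inv_closed G.m_closed \<open>k \<in> carrier G\<close> \<open>l \<in> carrier G\<close> ab(1,3) imageI)
      then have "?d \<in> \<theta> r ` carrier G"
        using action_lcm [OF p q r(1,2)] by simp
      then obtain m where m: "m \<in> carrier G" "?d = \<theta> r m" by blast
      then have "g \<otimes>\<^bsub>G\<^esub> \<theta> p a = g \<otimes>\<^bsub>G\<^esub> \<theta> p k \<otimes>\<^bsub>G\<^esub> \<theta> r m"
        by (metis G.inv_solve_left G.m_closed G.inv_closed g p action_closed ab(1) \<open>k \<in> carrier G\<close> r(1))
      then have "z = (g, p) \<otimes>\<^bsub>S\<^esub> (k, p') \<otimes>\<^bsub>S\<^esub> (m, c)"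
        by (simp add: z semidirect_simps r(3) c(2))
      then show "z \<in> ?R"
        using m c by (auto simp: mem_l_coset_iff semidirect_simps)
    qed
  qed
qed

text \<open>A common multiple of \<open>(g, p)\<close> and \<open>(h, q)\<close> supplies \<open>k\<close> and \<open>l\<close> through its first coordinate and
  shows through its second one that \<open>p\<close> and \<open>q\<close> have a least common multiple, which supplies \<open>p'\<close>
  and \<open>q'\<close>.\<close>

lemma semidirect_factorization_exists:
  assumes g: "g \<in> carrier G" and h: "h \<in> carrier G"
    and p: "p \<in> carrier P" and q: "q \<in> carrier P"
    and meet: "((g, p) <#\<^bsub>S\<^esub> carrier S) \<inter> ((h, q) <#\<^bsub>S\<^esub> carrier S) \<noteq> {}"
  shows "\<exists>k p' q' l. lcm_factorization G P \<theta> p q (inv\<^bsub>G\<^esub> g \<otimes>\<^bsub>G\<^esub> h) k p' q' l"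
proof -
  from meet obtain a x b y
    where ab: "a \<in> carrier G" "x \<in> carrier P" "b \<in> carrier G" "y \<in> carrier P"
    and eq: "g \<otimes>\<^bsub>G\<^esub> \<theta> p a = h \<otimes>\<^bsub>G\<^esub> \<theta> q b" "p \<otimes>\<^bsub>P\<^esub> x = q \<otimes>\<^bsub>P\<^esub> y"
    by (auto simp: mem_l_coset_iff semidirect_simps)
  have "p \<otimes>\<^bsub>P\<^esub> x \<in> (p <#\<^bsub>P\<^esub> carrier P) \<inter> (q <#\<^bsub>P\<^esub> carrier P)"
    using ab eq(2) by (metis IntI mem_l_coset_iff)
  then obtain r where r: "r \<in> carrier P"
      "(p <#\<^bsub>P\<^esub> carrier P) \<inter> (q <#\<^bsub>P\<^esub> carrier P) = r <#\<^bsub>P\<^esub> carrier P"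
    using P.right_lcm [OF p q] by auto
  then have "r \<in> (p <#\<^bsub>P\<^esub> carrier P) \<inter> (q <#\<^bsub>P\<^esub> carrier P)"
    using P.self_mem_principal by simp
  then obtain p' q' where pq: "p' \<in> carrier P" "q' \<in> carrier P" "p \<otimes>\<^bsub>P\<^esub> p' = r" "q \<otimes>\<^bsub>P\<^esub> q' = r"
    by (auto simp: mem_l_coset_iff)
  have "inv\<^bsub>G\<^esub> g \<otimes>\<^bsub>G\<^esub> h = \<theta> p a \<otimes>\<^bsub>G\<^esub> \<theta> q (inv\<^bsub>G\<^esub> b)"
  proof -
    have "\<theta> p a = inv\<^bsub>G\<^esub> g \<otimes>\<^bsub>G\<^esub> (h \<otimes>\<^bsub>G\<^esub> \<theta> q b)"
      using G.inv_solve_left [of "\<theta> p a" g "h \<otimes>\<^bsub>G\<^esub> \<theta> q b"] eq(1) g h p q ab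
      by (simp add: action_closed)
    then show ?thesis
      using g h p q ab by (simp add: action_closed action_inv G.m_assoc)
  qed
  then have "lcm_factorization G P \<theta> p q (inv\<^bsub>G\<^esub> g \<otimes>\<^bsub>G\<^esub> h) a p' q' b"
    using ab r pq unfolding lcm_factorization_def by blast
  then show ?thesis by blast
qed

lemma right_lcm_semidirect: "right_lcm_monoid S"
proof
  fix s t assume st: "s \<in> carrier S" "t \<in> carrier S"
  obtain g p h q where gp: "s = (g, p)" "t = (h, q)" by (cases s, cases t)
  with st have c: "g \<in> carrier G" "h \<in> carrier G" "p \<in> carrier P" "q \<in> carrier P"
    by (auto simp: semidirect_simps)
  show "(s <#\<^bsub>S\<^esub> carrier S) \<inter> (t <#\<^bsub>S\<^esub> carrier S) = {} \<or>
      (\<exists>r\<in>carrier S. (s <#\<^bsub>S\<^esub> carrier S) \<inter> (t <#\<^bsub>S\<^esub> carrier S) = r <#\<^bsub>S\<^esub> carrier S)"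
  proof (cases "(s <#\<^bsub>S\<^esub> carrier S) \<inter> (t <#\<^bsub>S\<^esub> carrier S) = {}")
    case False
    then obtain k p' q' l where f: "lcm_factorization G P \<theta> p q (inv\<^bsub>G\<^esub> g \<otimes>\<^bsub>G\<^esub> h) k p' q' l"
      using semidirect_factorization_exists [OF c] gp by blast
    then have "(k, p') \<in> carrier S"
      by (simp add: lcm_factorization_def semidirect_simps)
    then have m: "(g, p) \<otimes>\<^bsub>S\<^esub> (k, p') \<in> carrier S"
      using st gp S.m_closed by simp
    show ?thesis
      unfolding gp semidirect_lcm(2) [OF c f] by (rule disjI2, rule bexI [OF refl m])
  qed (rule disjI1)
qed

sublocale S: right_lcm_monoid S
  by (rule right_lcm_semidirect)

end

section \<open>Isometries in a C*-algebra\<close>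

context cstar_algebra
begin

lemma isometry_cancel:
  assumes "adj A x \<otimes> x = \<one>" "x \<in> carrier A" "y \<in> carrier A"
  shows "adj A x \<otimes> (x \<otimes> y) = y"
  using assms by (simp add: adj_closed flip: m_assoc)

lemma isometry_right_inverse:
  assumes "adj A x \<otimes> x = \<one>" "x \<otimes> y = \<one>" "x \<in> carrier A" "y \<in> carrier A"
  shows "y = adj A x"
  using isometry_cancel [OF assms(1,3,4)] assms(2,3) by (simp add: adj_closed)

end

section \<open>Representations\<close>

text \<open>The defining relations of the two universal algebras, read in an arbitrary C*-algebra.\<close>

locale ads_representation =
  algebraic_dynamical_system G P \<theta> + B: cstar_algebra B
  for G :: "('g, 'm) monoid_scheme" and P :: "('p, 'n) monoid_scheme"
    and \<theta> :: "'p \<Rightarrow> 'g \<Rightarrow> 'g" and B :: "('b, 'k) cstar_algebra_scheme" (structure) +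
  fixes u :: "'g \<Rightarrow> 'b" and s :: "'p \<Rightarrow> 'b"
  assumes u_closed [simp]: "g \<in> carrier G \<Longrightarrow> u g \<in> carrier B"
    and s_closed [simp]: "p \<in> carrier P \<Longrightarrow> s p \<in> carrier B"
    and u_mult: "g \<in> carrier G \<Longrightarrow> h \<in> carrier G \<Longrightarrow> u g \<otimes> u h = u (g \<otimes>\<^bsub>G\<^esub> h)"
    and u_isometry: "g \<in> carrier G \<Longrightarrow> adj B (u g) \<otimes> u g = \<one>"
    and u_coisometry: "g \<in> carrier G \<Longrightarrow> u g \<otimes> adj B (u g) = \<one>"
    and s_mult: "p \<in> carrier P \<Longrightarrow> q \<in> carrier P \<Longrightarrow> s p \<otimes> s q = s (p \<otimes>\<^bsub>P\<^esub> q)"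
    and s_isometry: "p \<in> carrier P \<Longrightarrow> adj B (s p) \<otimes> s p = \<one>"
    and s_u: "p \<in> carrier P \<Longrightarrow> g \<in> carrier G \<Longrightarrow> s p \<otimes> u g = u (\<theta> p g) \<otimes> s p"
    and adj_s_u_s: "p \<in> carrier P \<Longrightarrow> q \<in> carrier P \<Longrightarrow> g \<in> carrier G \<Longrightarrow>
      lcm_factorization G P \<theta> p q g k p' q' l \<Longrightarrow>
      adj B (s p) \<otimes> u g \<otimes> s q = u k \<otimes> s p' \<otimes> adj B (s q') \<otimes> adj B (u l)"
    and adj_s_u_s_zero: "p \<in> carrier P \<Longrightarrow> q \<in> carrier P \<Longrightarrow> g \<in> carrier G \<Longrightarrow>
      \<nexists>k p' q' l. lcm_factorization G P \<theta> p q g k p' q' l \<Longrightarrow>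
      adj B (s p) \<otimes> u g \<otimes> s q = \<zero>"

text \<open>Idempotence of \<open>e X\<close> is the case \<open>X = Y\<close> of \<open>e_Int\<close>.\<close>

locale semigroup_representation =
  S: left_cancellative_monoid S + B: cstar_algebra B
  for S :: "('a, 'm) monoid_scheme"
    and B :: "('b, 'k) cstar_algebra_scheme" (structure) +
  fixes v :: "'a \<Rightarrow> 'b" and e :: "'a set \<Rightarrow> 'b"
  assumes v_closed [simp]: "p \<in> carrier S \<Longrightarrow> v p \<in> carrier B"
    and e_closed [simp]: "X \<in> constructible_ideals S \<Longrightarrow> e X \<in> carrier B"
    and v_isometry: "p \<in> carrier S \<Longrightarrow> adj B (v p) \<otimes> v p = \<one>"
    and e_adj: "X \<in> constructible_ideals S \<Longrightarrow> adj B (e X) = e X"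
    and v_mult: "p \<in> carrier S \<Longrightarrow> q \<in> carrier S \<Longrightarrow> v p \<otimes> v q = v (p \<otimes>\<^bsub>S\<^esub> q)"
    and v_e: "p \<in> carrier S \<Longrightarrow> X \<in> constructible_ideals S \<Longrightarrow>
      v p \<otimes> e X \<otimes> adj B (v p) = e (p <#\<^bsub>S\<^esub> X)"
    and e_empty: "e {} = \<zero>"
    and e_carrier: "e (carrier S) = \<one>"
    and e_Int: "X \<in> constructible_ideals S \<Longrightarrow> Y \<in> constructible_ideals S \<Longrightarrow>
      e X \<otimes> e Y = e (X \<inter> Y)"

context ads_representation
begin

lemma ads_hom:
  "\<exists>\<phi>\<in>star_hom (ads_cstar G P \<theta>) B. contractive (ads_cstar G P \<theta>) B \<phi> \<and>
    (\<forall>g\<in>carrier G. \<phi> (ads_u G P \<theta> g) = u g) \<and> (\<forall>p\<in>carrier P. \<phi> (ads_s G P \<theta> p) = s p)"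
proof -
  let ?X = "ads_gens G P" and ?R = "ads_relations G P \<theta>"
  define h where "h = case_ads_gen u s"
  have h_simps [simp]: "h (UGen g) = u g" "h (SGen p) = s p" for g p
    by (simp_all add: h_def)
  have gens: "UGen g \<in> ?X" if "g \<in> carrier G" for g
    using that by (simp add: ads_gens_def)
  have gens': "SGen p \<in> ?X" if "p \<in> carrier P" for p
    using that by (simp add: ads_gens_def)
  have "\<exists>\<phi>\<in>star_hom (universal_cstar ?X ?R) B. contractive (universal_cstar ?X ?R) B \<phi> \<and>
    (\<forall>x\<in>?X. \<phi> (universal_map ?X ?R (fgen x)) = h x)"
  proof (rule bounded_presentation.universal_cstar_hom_exists)
    show "bounded_presentation ?X ?R"
      by (intro bounded_presentation.intro bounded_ads)
    show "cstar_algebra B" by (rule B.cstar_algebra_axioms)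
    show "h x \<in> carrier B" if "x \<in> ?X" for x
      using that by (auto simp: ads_gens_def)
    fix \<psi> r
    assume \<psi>: "\<psi> \<in> star_hom (free_star_algebra ?X) B" and val: "\<And>x. x \<in> ?X \<Longrightarrow> \<psi> (fgen x) = h x"
      and r: "r \<in> ?R"
    note hom = star_hom_free [OF \<psi>] star_hom_free_diff [OF B.cstar_algebra_axioms \<psi>]
    from r show "\<psi> r = \<zero>"
      unfolding ads_relations_def
      by (elim UnE; clarsimp simp: hom val gens gens' free_closed B.minus_eq_zero_iff B.adj_closed
          action_closed u_mult u_isometry u_coisometry s_mult s_isometry s_u adj_s_u_s adj_s_u_s_zero
          lcm_factorization_def)
  qed
  then show ?thesis
    using gens gens' unfolding ads_cstar_def ads_u_def ads_s_def by (elim bexE, intro bexI) auto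
qed

lemma u_one: "u \<one>\<^bsub>G\<^esub> = \<one>"
proof -
  have "adj B (u \<one>\<^bsub>G\<^esub>) \<otimes> (u \<one>\<^bsub>G\<^esub> \<otimes> u \<one>\<^bsub>G\<^esub>) = \<one>"
    by (simp add: u_mult u_isometry)
  then show ?thesis by (simp add: B.isometry_cancel u_isometry)
qed

lemma s_one: "s \<one>\<^bsub>P\<^esub> = \<one>"
proof -
  have "adj B (s \<one>\<^bsub>P\<^esub>) \<otimes> (s \<one>\<^bsub>P\<^esub> \<otimes> s \<one>\<^bsub>P\<^esub>) = \<one>"
    by (simp add: s_mult s_isometry)
  then show ?thesis by (simp add: B.isometry_cancel s_isometry)
qed

lemma adj_u: "g \<in> carrier G \<Longrightarrow> adj B (u g) = u (inv\<^bsub>G\<^esub> g)"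
  by (rule B.isometry_right_inverse [symmetric]) (simp_all add: u_isometry u_mult u_one)

text \<open>The isometric representation of \<open>S\<close>, based on \<open>(g, p) = (g, 1) (1, p)\<close>.\<close>

definition w :: "'g \<times> 'p \<Rightarrow> 'b" where
  "w x = u (fst x) \<otimes> s (snd x)"

lemma w_closed [simp]: "x \<in> carrier S \<Longrightarrow> w x \<in> carrier B"
  by (auto simp: w_def semidirect_simps)

lemma w_one: "w \<one>\<^bsub>S\<^esub> = \<one>"
  by (simp add: w_def semidirect_simps u_one s_one)

lemma w_mult:
  assumes "x \<in> carrier S" "y \<in> carrier S"
  shows "w x \<otimes> w y = w (x \<otimes>\<^bsub>S\<^esub> y)"
proof -
  obtain g p h q where [simp]: "x = (g, p)" "y = (h, q)" by (cases x, cases y)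
  have [simp]: "g \<in> carrier G" "p \<in> carrier P" "h \<in> carrier G" "q \<in> carrier P"
    using assms by (simp_all add: semidirect_simps)
  have su: "s p \<otimes> u h = u (\<theta> p h) \<otimes> s p"
    by (intro s_u) simp_all
  have "w x \<otimes> w y = u g \<otimes> (s p \<otimes> u h) \<otimes> s q"
    by (simp add: w_def B.m_assoc)
  also have "\<dots> = (u g \<otimes> u (\<theta> p h)) \<otimes> (s p \<otimes> s q)"
    by (simp only: su) (simp add: action_closed B.m_assoc)
  also have "\<dots> = w (x \<otimes>\<^bsub>S\<^esub> y)"
    by (simp add: w_def semidirect_simps u_mult s_mult action_closed)
  finally show ?thesis .
qed

lemma w_isometry:
  assumes "x \<in> carrier S" shows "adj B (w x) \<otimes> w x = \<one>"
  using assms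
  by (auto simp: w_def semidirect_simps B.adj_mult B.m_assoc B.adj_closed B.isometry_cancel
      u_isometry s_isometry)

text \<open>This brings \<open>(w x)* w y\<close> into the form to which (A2) applies.\<close>

lemma adj_w_w:
  assumes "g \<in> carrier G" "p \<in> carrier P" "h \<in> carrier G" "q \<in> carrier P"
  shows "adj B (w (g, p)) \<otimes> w (h, q) = adj B (s p) \<otimes> u (inv\<^bsub>G\<^esub> g \<otimes>\<^bsub>G\<^esub> h) \<otimes> s q"
  using assms
  by (simp add: w_def B.adj_mult B.m_assoc B.adj_closed adj_u flip: u_mult)

definition w_proj :: "'g \<times> 'p \<Rightarrow> 'b" where
  "w_proj x = w x \<otimes> adj B (w x)"

lemma w_proj_closed [simp]: "x \<in> carrier S \<Longrightarrow> w_proj x \<in> carrier B"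
  by (simp add: w_proj_def B.adj_closed)

text \<open>If \<open>y = x a\<close> and \<open>a b = \<one>\<close>, then \<open>w b\<close> is a right inverse of the isometry \<open>w a\<close>. So \<open>w a\<close> is unitary
  and cancels from \<open>w y (w y)* = w x (w a (w a)*) (w x)*\<close>.\<close>

lemma w_proj_ideal:
  assumes x: "x \<in> carrier S" and y: "y \<in> carrier S"
    and eq: "x <#\<^bsub>S\<^esub> carrier S = y <#\<^bsub>S\<^esub> carrier S"
  shows "w_proj x = w_proj y"
proof -
  obtain a b where ab: "a \<in> carrier S" "b \<in> carrier S" "y = x \<otimes>\<^bsub>S\<^esub> a" "a \<otimes>\<^bsub>S\<^esub> b = \<one>\<^bsub>S\<^esub>"
    by (rule S.principal_eqE [OF x y eq])
  have "w a \<otimes> w b = \<one>"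
    using ab by (simp add: w_mult w_one)
  moreover from this have "w b = adj B (w a)"
    by (intro B.isometry_right_inverse w_isometry w_closed ab)
  ultimately have unitary: "w a \<otimes> adj B (w a) = \<one>" by simp
  have "w_proj y = w x \<otimes> (w a \<otimes> adj B (w a)) \<otimes> adj B (w x)"
    using x ab(1) by (simp add: w_proj_def ab(3) B.adj_mult B.adj_closed B.m_assoc flip: w_mult)
  then show ?thesis
    using x by (simp add: unitary w_proj_def)
qed

text \<open>By \<open>w_proj_ideal\<close> the value does not depend on the generator that is picked.\<close>

definition ideal_proj :: "('g \<times> 'p) set \<Rightarrow> 'b" where
  "ideal_proj X = (if X = {} then \<zero>
     else w_proj (SOME x. x \<in> carrier S \<and> X = x <#\<^bsub>S\<^esub> carrier S))"

lemma ideal_proj_principal: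
  assumes x: "x \<in> carrier S"
  shows "ideal_proj (x <#\<^bsub>S\<^esub> carrier S) = w_proj x"
proof -
  let ?y = "SOME y. y \<in> carrier S \<and> x <#\<^bsub>S\<^esub> carrier S = y <#\<^bsub>S\<^esub> carrier S"
  have y: "?y \<in> carrier S \<and> x <#\<^bsub>S\<^esub> carrier S = ?y <#\<^bsub>S\<^esub> carrier S"
    by (rule someI [of _ x]) (simp add: x)
  have "x <#\<^bsub>S\<^esub> carrier S \<noteq> {}"
    using S.self_mem_principal [OF x] by blast
  then have "ideal_proj (x <#\<^bsub>S\<^esub> carrier S) = w_proj ?y"
    by (simp add: ideal_proj_def)
  also have "\<dots> = w_proj x"
    using y by (intro w_proj_ideal [symmetric] x) auto
  finally show ?thesis .
qed

text \<open>Here (A2) does its work. In \<open>w x (w x)* w y (w y)*\<close> the middle factor \<open>(w x)* w y\<close> becomes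
  \<open>w x' (w y')*\<close> with \<open>x x' = y y'\<close> the least common multiple of \<open>x\<close> and \<open>y\<close>, or \<open>\<zero>\<close> if there is
  none.\<close>

lemma w_proj_mult:
  assumes x: "x \<in> carrier S" and y: "y \<in> carrier S"
  shows "w_proj x \<otimes> w_proj y = ideal_proj ((x <#\<^bsub>S\<^esub> carrier S) \<inter> (y <#\<^bsub>S\<^esub> carrier S))"
proof -
  obtain g p h q where xy: "x = (g, p)" "y = (h, q)" by (cases x, cases y)
  have c: "g \<in> carrier G" "p \<in> carrier P" "h \<in> carrier G" "q \<in> carrier P"
    using x y by (simp_all add: xy semidirect_simps)
  let ?d = "inv\<^bsub>G\<^esub> g \<otimes>\<^bsub>G\<^esub> h"
  have d: "?d \<in> carrier G" using c by simp
  have mid: "w_proj x \<otimes> w_proj y = w x \<otimes> (adj B (w x) \<otimes> w y) \<otimes> adj B (w y)"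
    using x y by (simp add: w_proj_def B.m_assoc B.adj_closed)
  show ?thesis
  proof (cases "\<exists>k p' q' l. lcm_factorization G P \<theta> p q ?d k p' q' l")
    case True
    then obtain k p' q' l where f: "lcm_factorization G P \<theta> p q ?d k p' q' l" by blast
    then have c': "k \<in> carrier G" "p' \<in> carrier P" "q' \<in> carrier P" "l \<in> carrier G"
      by (simp_all add: lcm_factorization_def)
    have x': "(k, p') \<in> carrier S" and y': "(l, q') \<in> carrier S"
      using c' by (simp_all add: semidirect_simps)
    note lcm = semidirect_lcm [OF c(1,3,2,4) f, folded xy]
    have "adj B (w x) \<otimes> w y = w (k, p') \<otimes> adj B (w (l, q'))"
      using adj_s_u_s [OF c(2,4) d f] c c'
      by (simp add: xy adj_w_w) (simp add: w_def B.adj_mult B.m_assoc B.adj_closed)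
    then have "w_proj x \<otimes> w_proj y = (w x \<otimes> w (k, p')) \<otimes> adj B (w y \<otimes> w (l, q'))"
      using x y x' y' by (simp add: mid B.adj_mult B.m_assoc B.adj_closed)
    also have "\<dots> = w_proj (x \<otimes>\<^bsub>S\<^esub> (k, p'))"
      using x y x' y' by (simp add: w_mult w_proj_def lcm(1))
    also have "\<dots> = ideal_proj ((x \<otimes>\<^bsub>S\<^esub> (k, p')) <#\<^bsub>S\<^esub> carrier S)"
      using x x' by (intro ideal_proj_principal [symmetric] S.m_closed)
    finally show ?thesis by (simp only: lcm(2))
  next
    case False
    then have "adj B (w x) \<otimes> w y = \<zero>"
      using adj_s_u_s_zero [OF c(2,4) d] c by (simp add: xy adj_w_w)
    then have "w_proj x \<otimes> w_proj y = \<zero>"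
      using x y by (simp add: mid B.adj_closed)
    moreover have "(x <#\<^bsub>S\<^esub> carrier S) \<inter> (y <#\<^bsub>S\<^esub> carrier S) = {}"
      using semidirect_factorization_exists [OF c(1,3,2,4)] False xy by blast
    ultimately show ?thesis by (simp add: ideal_proj_def)
  qed
qed

theorem semigroup_representation_w: "semigroup_representation S B w ideal_proj"
proof
  have cases: thesis if "X \<in> constructible_ideals S" "X = {} \<Longrightarrow> thesis"
    "\<And>x. x \<in> carrier S \<Longrightarrow> X = x <#\<^bsub>S\<^esub> carrier S \<Longrightarrow> thesis" for X thesis
    using S.constructible_ideals_principal [OF that(1)] that(2,3) by blast
  have empty: "ideal_proj {} = \<zero>" by (simp add: ideal_proj_def)
  show "w p \<in> carrier B" "adj B (w p) \<otimes> w p = \<one>" if "p \<in> carrier S" for p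
    using that by (simp_all add: w_isometry)
  show "w p \<otimes> w q = w (p \<otimes>\<^bsub>S\<^esub> q)" if "p \<in> carrier S" "q \<in> carrier S" for p q
    using that by (rule w_mult)
  show "ideal_proj {} = \<zero>" by (rule empty)
  show "ideal_proj (carrier S) = \<one>"
    using ideal_proj_principal [OF S.one_closed]
    by (simp add: S.one_principal w_proj_def w_one B.adj_one)
  fix X assume X: "X \<in> constructible_ideals S"
  show "ideal_proj X \<in> carrier B"
    using X by (rule cases) (simp_all add: empty ideal_proj_principal)
  show "adj B (ideal_proj X) = ideal_proj X"
    using X by (rule cases)
      (simp_all add: empty B.adj_zero ideal_proj_principal w_proj_def B.adj_mult B.adj_closed B.adj_adj)
  show "w p \<otimes> ideal_proj X \<otimes> adj B (w p) = ideal_proj (p <#\<^bsub>S\<^esub> X)" if p: "p \<in> carrier S" for p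
    using X
  proof (rule cases)
    assume "X = {}"
    then show ?thesis using p by (simp add: empty l_coset_def B.adj_closed)
  next
    fix x assume x: "x \<in> carrier S" "X = x <#\<^bsub>S\<^esub> carrier S"
    then show ?thesis
      using p by (simp add: S.l_coset_l_coset ideal_proj_principal w_proj_def B.m_assoc B.adj_mult
          B.adj_closed flip: w_mult)
  qed
  show "ideal_proj X \<otimes> ideal_proj Y = ideal_proj (X \<inter> Y)" if Y: "Y \<in> constructible_ideals S" for Y
    using X
  proof (rule cases)
    have "ideal_proj Y \<in> carrier B"
      using Y by (rule cases) (simp_all add: empty ideal_proj_principal)
    then show ?thesis if "X = {}" using that by (simp add: empty)
  next
    fix x assume x: "x \<in> carrier S" "X = x <#\<^bsub>S\<^esub> carrier S"
    show ?thesis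
      using Y by (rule cases) (use x in \<open>simp_all add: empty ideal_proj_principal w_proj_mult\<close>)
  qed
qed

end

context semigroup_representation
begin

lemma semigroup_hom:
  assumes "right_lcm_monoid S"
  shows "\<exists>\<phi>\<in>star_hom (semigroup_cstar S) B. contractive (semigroup_cstar S) B \<phi> \<and>
    (\<forall>p\<in>carrier S. \<phi> (semigroup_v S p) = v p) \<and>
    (\<forall>X\<in>constructible_ideals S. \<phi> (universal_map (semigroup_gens S) (semigroup_relations S) (fe X)) = e X)"
proof -
  interpret S: right_lcm_monoid S by fact
  let ?X = "semigroup_gens S" and ?R = "semigroup_relations S"
  define h where "h = case_semigroup_gen v e"
  have h_simps [simp]: "h (VGen p) = v p" "h (EGen X) = e X" for p X
    by (simp_all add: h_def)
  have gens: "VGen p \<in> ?X" if "p \<in> carrier S" for p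
    using that by (simp add: semigroup_gens_def)
  have gens': "EGen X \<in> ?X" if "X \<in> constructible_ideals S" for X
    using that by (simp add: semigroup_gens_def)
  have "\<exists>\<phi>\<in>star_hom (universal_cstar ?X ?R) B. contractive (universal_cstar ?X ?R) B \<phi> \<and>
    (\<forall>x\<in>?X. \<phi> (universal_map ?X ?R (fgen x)) = h x)"
  proof (rule bounded_presentation.universal_cstar_hom_exists)
    show "bounded_presentation ?X ?R"
      by (intro bounded_presentation.intro bounded_semigroup)
    show "cstar_algebra B" by (rule B.cstar_algebra_axioms)
    show "h x \<in> carrier B" if "x \<in> ?X" for x
      using that by (auto simp: semigroup_gens_def)
    fix \<psi> r
    assume \<psi>: "\<psi> \<in> star_hom (free_star_algebra ?X) B" and val: "\<And>x. x \<in> ?X \<Longrightarrow> \<psi> (fgen x) = h x"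
      and r: "r \<in> ?R"
    note hom = star_hom_free [OF \<psi>] star_hom_free_diff [OF B.cstar_algebra_axioms \<psi>]
    from r show "\<psi> r = \<zero>"
      unfolding semigroup_relations_def
      by (elim UnE insertE emptyE; clarsimp simp: hom val gens gens' free_closed B.minus_eq_zero_iff B.adj_closed
          v_isometry e_adj v_mult v_e e_empty e_carrier e_Int S.constructible_ideals_Int constructible_ideals.intros)
  qed
  then show ?thesis
    using gens gens' unfolding semigroup_cstar_def semigroup_v_def by (elim bexE, intro bexI) auto
qed

lemma v_one: "v \<one>\<^bsub>S\<^esub> = \<one>"
proof -
  have "adj B (v \<one>\<^bsub>S\<^esub>) \<otimes> (v \<one>\<^bsub>S\<^esub> \<otimes> v \<one>\<^bsub>S\<^esub>) = \<one>"
    by (simp add: v_mult v_isometry)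
  then show ?thesis by (simp add: B.isometry_cancel v_isometry)
qed

lemma e_principal:
  assumes "p \<in> carrier S"
  shows "e (p <#\<^bsub>S\<^esub> carrier S) = v p \<otimes> adj B (v p)"
  using v_e [OF assms constructible_ideals.carrier] assms by (simp add: e_carrier)

text \<open>The relation \<open>e X e Y = e (X \<inter> Y)\<close> enters through the expansion
  \<open>v\<^sub>p* v\<^sub>q = v\<^sub>p* (v\<^sub>p v\<^sub>p*) (v\<^sub>q v\<^sub>q*) v\<^sub>q\<close>, whose two bracketed factors are the projections of \<open>p S\<close> and \<open>q S\<close>.\<close>

lemma adj_v_v:
  assumes "p \<in> carrier S" "q \<in> carrier S"
  shows "adj B (v p) \<otimes> v q =
    adj B (v p) \<otimes> e ((p <#\<^bsub>S\<^esub> carrier S) \<inter> (q <#\<^bsub>S\<^esub> carrier S)) \<otimes> v q"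
proof -
  have "e ((p <#\<^bsub>S\<^esub> carrier S) \<inter> (q <#\<^bsub>S\<^esub> carrier S))
      = (v p \<otimes> adj B (v p)) \<otimes> (v q \<otimes> adj B (v q))"
    using assms by (simp add: S.principal_constructible flip: e_principal e_Int)
  then show ?thesis
    using assms
    by (simp add: B.m_assoc B.adj_closed B.isometry_cancel v_isometry)
qed

text \<open>The abstract form of (A2), valid for every isometric representation with ideal projections: the
  projection of the intersection is \<open>v\<^sub>p v\<^sub>a (v\<^sub>q v\<^sub>b)*\<close>, and \<open>v\<^sub>p\<close>, \<open>v\<^sub>q\<close> cancel against the outer factors.\<close>

lemma adj_v_v_lcm:
  assumes c: "p \<in> carrier S" "q \<in> carrier S" "a \<in> carrier S" "b \<in> carrier S"
    and eq: "p \<otimes>\<^bsub>S\<^esub> a = q \<otimes>\<^bsub>S\<^esub> b"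
    and Int: "(p <#\<^bsub>S\<^esub> carrier S) \<inter> (q <#\<^bsub>S\<^esub> carrier S) = (p \<otimes>\<^bsub>S\<^esub> a) <#\<^bsub>S\<^esub> carrier S"
  shows "adj B (v p) \<otimes> v q = v a \<otimes> adj B (v b)"
proof -
  have "e ((p <#\<^bsub>S\<^esub> carrier S) \<inter> (q <#\<^bsub>S\<^esub> carrier S)) = v (p \<otimes>\<^bsub>S\<^esub> a) \<otimes> adj B (v (q \<otimes>\<^bsub>S\<^esub> b))"
    using c eq by (simp add: Int e_principal)
  also have "\<dots> = v p \<otimes> v a \<otimes> adj B (v q \<otimes> v b)"
    using c by (simp add: v_mult)
  finally show ?thesis
    using c adj_v_v [OF c(1,2)]
    by (simp add: B.adj_mult B.m_assoc B.adj_closed B.isometry_cancel v_isometry)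
qed

lemma adj_v_v_disjoint:
  assumes "p \<in> carrier S" "q \<in> carrier S"
    and "(p <#\<^bsub>S\<^esub> carrier S) \<inter> (q <#\<^bsub>S\<^esub> carrier S) = {}"
  shows "adj B (v p) \<otimes> v q = \<zero>"
  using adj_v_v [OF assms(1,2)] assms by (simp add: e_empty B.adj_closed)

end

lemma semigroup_cstar_representation:
  assumes "right_lcm_monoid S"
  shows "semigroup_representation S (semigroup_cstar S) (semigroup_v S)
    (\<lambda>X. universal_map (semigroup_gens S) (semigroup_relations S) (fe X))"
proof -
  interpret S: right_lcm_monoid S by fact
  let ?X = "semigroup_gens S" and ?R = "semigroup_relations S"
  interpret P: bounded_presentation ?X ?R
    by (intro bounded_presentation.intro bounded_semigroup)
  interpret B: cstar_algebra "semigroup_cstar S" by (rule cstar_algebra_semigroup_cstar)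
  let ?\<pi> = "universal_map ?X ?R"
  have \<pi>: "?\<pi> \<in> star_hom (free_star_algebra ?X) (semigroup_cstar S)"
    unfolding semigroup_cstar_def by (rule P.universal_map_star_hom)
  note hom = star_hom_free [OF \<pi>] star_hom_free_diff [OF B.cstar_algebra_axioms \<pi>]
  have gens: "fv p \<in> free_carrier ?X" if "p \<in> carrier S" for p
    using that by (intro free_fgen) (simp add: semigroup_gens_def)
  have gens': "fe X \<in> free_carrier ?X" if "X \<in> constructible_ideals S" for X
    using that by (intro free_fgen) (simp add: semigroup_gens_def)
  have rel: "?\<pi> r = \<zero>\<^bsub>semigroup_cstar S\<^esub>" if "r \<in> ?R" "r \<in> free_carrier ?X" for r
    using P.universal_map_relation [OF that] by (simp add: semigroup_cstar_def)
  have eq: "?\<pi> f = ?\<pi> g" if "f - g \<in> ?R" "f \<in> free_carrier ?X" "g \<in> free_carrier ?X" for f g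
    using rel [OF that(1)] that by (simp add: hom free_diff B.minus_eq_zero_iff)
  note [simp] = gens gens' constructible_ideals.intros semigroup_v_def hom free_closed
    S.constructible_ideals_Int
  show ?thesis
  proof
    show "?\<pi> (fe {}) = \<zero>\<^bsub>semigroup_cstar S\<^esub>"
      by (rule rel) (simp_all add: semigroup_relations_def)
    have "fe (carrier S) - 1 \<in> ?R"
      by (simp add: semigroup_relations_def)
    from eq [OF this] show "?\<pi> (fe (carrier S)) = \<one>\<^bsub>semigroup_cstar S\<^esub>" by simp
    fix p assume p [simp]: "p \<in> carrier S"
    show "semigroup_v S p \<in> carrier (semigroup_cstar S)" by simp
    have "fstar (fv p) * fv p - 1 \<in> ?R"
      unfolding semigroup_relations_def using p by blast
    from eq [OF this] show "adj (semigroup_cstar S) (semigroup_v S p) \<otimes>\<^bsub>semigroup_cstar S\<^esub> semigroup_v S p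
        = \<one>\<^bsub>semigroup_cstar S\<^esub>" by simp
    show "semigroup_v S p \<otimes>\<^bsub>semigroup_cstar S\<^esub> semigroup_v S q = semigroup_v S (p \<otimes>\<^bsub>S\<^esub> q)"
      if q [simp]: "q \<in> carrier S" for q
    proof -
      have "fv p * fv q - fv (p \<otimes>\<^bsub>S\<^esub> q) \<in> ?R"
        unfolding semigroup_relations_def using p q by blast
      from eq [OF this] show ?thesis by simp
    qed
    fix X assume X [simp]: "X \<in> constructible_ideals S"
    have "fv p * fe X * fstar (fv p) - fe (p <#\<^bsub>S\<^esub> X) \<in> ?R"
      unfolding semigroup_relations_def using p X by blast
    from eq [OF this]
    show "semigroup_v S p \<otimes>\<^bsub>semigroup_cstar S\<^esub> ?\<pi> (fe X) \<otimes>\<^bsub>semigroup_cstar S\<^esub>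
        adj (semigroup_cstar S) (semigroup_v S p) = ?\<pi> (fe (p <#\<^bsub>S\<^esub> X))" by simp
  next
    fix X assume X [simp]: "X \<in> constructible_ideals S"
    show "?\<pi> (fe X) \<in> carrier (semigroup_cstar S)" by simp
    have "fstar (fe X) - fe X \<in> ?R"
      unfolding semigroup_relations_def using X by blast
    from eq [OF this] show "adj (semigroup_cstar S) (?\<pi> (fe X)) = ?\<pi> (fe X)" by simp
    show "?\<pi> (fe X) \<otimes>\<^bsub>semigroup_cstar S\<^esub> ?\<pi> (fe Y) = ?\<pi> (fe (X \<inter> Y))"
      if Y [simp]: "Y \<in> constructible_ideals S" for Y
    proof -
      have "fe X * fe Y - fe (X \<inter> Y) \<in> ?R"
        unfolding semigroup_relations_def using X Y by blast
      from eq [OF this] show ?thesis by simp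
    qed
  qed
qed

context algebraic_dynamical_system
begin

lemma ads_cstar_representation:
  "ads_representation G P \<theta> (ads_cstar G P \<theta>) (ads_u G P \<theta>) (ads_s G P \<theta>)"
proof -
  let ?X = "ads_gens G P" and ?R = "ads_relations G P \<theta>" and ?A = "ads_cstar G P \<theta>"
  interpret U: bounded_presentation ?X ?R
    by (intro bounded_presentation.intro bounded_ads)
  interpret B: cstar_algebra ?A by (rule cstar_algebra_ads_cstar)
  let ?\<pi> = "universal_map ?X ?R"
  have \<pi>: "?\<pi> \<in> star_hom (free_star_algebra ?X) ?A"
    unfolding ads_cstar_def by (rule U.universal_map_star_hom)
  have gens: "fu g \<in> free_carrier ?X" if "g \<in> carrier G" for g
    using that by (intro free_fgen) (simp add: ads_gens_def)
  have gens': "fs p \<in> free_carrier ?X" if "p \<in> carrier P" for p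
    using that by (intro free_fgen) (simp add: ads_gens_def)
  have rel: "?\<pi> r = \<zero>\<^bsub>?A\<^esub>" if "r \<in> ?R" "r \<in> free_carrier ?X" for r
    using U.universal_map_relation [OF that] by (simp add: ads_cstar_def)
  note [simp] = gens gens' ads_u_def ads_s_def star_hom_free [OF \<pi>]
    star_hom_free_diff [OF B.cstar_algebra_axioms \<pi>] free_closed action_closed
  have eq: "?\<pi> f = ?\<pi> g" if "f - g \<in> ?R" "f \<in> free_carrier ?X" "g \<in> free_carrier ?X" for f g
    using rel [OF that(1)] that by (simp add: B.minus_eq_zero_iff)
  show ?thesis
  proof
    fix g assume g [simp]: "g \<in> carrier G"
    show "ads_u G P \<theta> g \<in> carrier ?A" by simp
    have "fstar (fu g) * fu g - 1 \<in> ?R" "fu g * fstar (fu g) - 1 \<in> ?R"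
      unfolding ads_relations_def using g by blast+
    from eq [OF this(1)] eq [OF this(2)]
    show "adj ?A (ads_u G P \<theta> g) \<otimes>\<^bsub>?A\<^esub> ads_u G P \<theta> g = \<one>\<^bsub>?A\<^esub>"
      "ads_u G P \<theta> g \<otimes>\<^bsub>?A\<^esub> adj ?A (ads_u G P \<theta> g) = \<one>\<^bsub>?A\<^esub>" by simp_all
    show "ads_u G P \<theta> g \<otimes>\<^bsub>?A\<^esub> ads_u G P \<theta> h = ads_u G P \<theta> (g \<otimes>\<^bsub>G\<^esub> h)"
      if h [simp]: "h \<in> carrier G" for h
    proof -
      have "fu g * fu h - fu (g \<otimes>\<^bsub>G\<^esub> h) \<in> ?R"
        unfolding ads_relations_def using g h by blast
      from eq [OF this] show ?thesis by simp
    qed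
  next
    fix p assume p [simp]: "p \<in> carrier P"
    show "ads_s G P \<theta> p \<in> carrier ?A" by simp
    have "fstar (fs p) * fs p - 1 \<in> ?R"
      unfolding ads_relations_def using p by blast
    from eq [OF this] show "adj ?A (ads_s G P \<theta> p) \<otimes>\<^bsub>?A\<^esub> ads_s G P \<theta> p = \<one>\<^bsub>?A\<^esub>" by simp
    show "ads_s G P \<theta> p \<otimes>\<^bsub>?A\<^esub> ads_s G P \<theta> q = ads_s G P \<theta> (p \<otimes>\<^bsub>P\<^esub> q)"
      if q [simp]: "q \<in> carrier P" for q
    proof -
      have "fs p * fs q - fs (p \<otimes>\<^bsub>P\<^esub> q) \<in> ?R"
        unfolding ads_relations_def using p q by blast
      from eq [OF this] show ?thesis by simp
    qed
    fix g assume g [simp]: "g \<in> carrier G"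
    have "fs p * fu g - fu (\<theta> p g) * fs p \<in> ?R"
      unfolding ads_relations_def using p g by blast
    from eq [OF this]
    show "ads_s G P \<theta> p \<otimes>\<^bsub>?A\<^esub> ads_u G P \<theta> g = ads_u G P \<theta> (\<theta> p g) \<otimes>\<^bsub>?A\<^esub> ads_s G P \<theta> p" by simp
  next
    fix p q g
    assume c [simp]: "p \<in> carrier P" "q \<in> carrier P" "g \<in> carrier G"
    {
      fix k p' q' l assume f: "lcm_factorization G P \<theta> p q g k p' q' l"
      then have [simp]: "k \<in> carrier G" "p' \<in> carrier P" "q' \<in> carrier P" "l \<in> carrier G"
        by (simp_all add: lcm_factorization_def)
      have "fstar (fs p) * fu g * fs q - fu k * fs p' * fstar (fs q') * fstar (fu l) \<in> ?R"
        unfolding ads_relations_def using c f by blast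
      from eq [OF this]
      show "adj ?A (ads_s G P \<theta> p) \<otimes>\<^bsub>?A\<^esub> ads_u G P \<theta> g \<otimes>\<^bsub>?A\<^esub> ads_s G P \<theta> q
          = ads_u G P \<theta> k \<otimes>\<^bsub>?A\<^esub> ads_s G P \<theta> p' \<otimes>\<^bsub>?A\<^esub> adj ?A (ads_s G P \<theta> q') \<otimes>\<^bsub>?A\<^esub>
            adj ?A (ads_u G P \<theta> l)" by simp
    }
    assume "\<nexists>k p' q' l. lcm_factorization G P \<theta> p q g k p' q' l"
    then have "fstar (fs p) * fu g * fs q \<in> ?R"
      unfolding ads_relations_def using c by blast
    from rel [OF this]
    show "adj ?A (ads_s G P \<theta> p) \<otimes>\<^bsub>?A\<^esub> ads_u G P \<theta> g \<otimes>\<^bsub>?A\<^esub> ads_s G P \<theta> q = \<zero>\<^bsub>?A\<^esub>" by simp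
  qed
qed

text \<open>Since \<open>(s p)* u g s q = v (1, p)* v (g, q)\<close>, (A2) is the case of the elements \<open>(1, p)\<close> and \<open>(g, q)\<close> in
  \<open>adj_v_v_lcm\<close> and \<open>adj_v_v_disjoint\<close>. The unitarity of \<open>u\<close> holds because \<open>(g, 1)\<close> is invertible
  in \<open>S\<close>.\<close>

theorem ads_representation_v:
  assumes "semigroup_representation S B v e"
  shows "ads_representation G P \<theta> B (\<lambda>g. v (g, \<one>\<^bsub>P\<^esub>)) (\<lambda>p. v (\<one>\<^bsub>G\<^esub>, p))"
proof -
  interpret R: semigroup_representation S B v e by fact
  have G_mem: "(g, \<one>\<^bsub>P\<^esub>) \<in> carrier S" if "g \<in> carrier G" for g
    using that by (simp add: semidirect_simps)
  have P_mem: "(\<one>\<^bsub>G\<^esub>, p) \<in> carrier S" if "p \<in> carrier P" for p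
    using that by (simp add: semidirect_simps)
  have v_pair: "v (g, \<one>\<^bsub>P\<^esub>) \<otimes>\<^bsub>B\<^esub> v (\<one>\<^bsub>G\<^esub>, p) = v (g, p)" if "g \<in> carrier G" "p \<in> carrier P" for g p
    using that by (simp add: R.v_mult G_mem P_mem) (simp add: semidirect_simps action_one)
  have v_G_one: "v (\<one>\<^bsub>G\<^esub>, \<one>\<^bsub>P\<^esub>) = \<one>\<^bsub>B\<^esub>"
    using R.v_one by (simp add: semidirect_simps)
  show ?thesis
  proof
    fix g assume g: "g \<in> carrier G"
    show "v (g, \<one>\<^bsub>P\<^esub>) \<in> carrier B" using g by (simp add: G_mem)
    show "adj B (v (g, \<one>\<^bsub>P\<^esub>)) \<otimes>\<^bsub>B\<^esub> v (g, \<one>\<^bsub>P\<^esub>) = \<one>\<^bsub>B\<^esub>"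
      using g by (simp add: R.v_isometry G_mem)
    show mult: "v (g, \<one>\<^bsub>P\<^esub>) \<otimes>\<^bsub>B\<^esub> v (h, \<one>\<^bsub>P\<^esub>) = v (g \<otimes>\<^bsub>G\<^esub> h, \<one>\<^bsub>P\<^esub>)"
      if "h \<in> carrier G" for h
      using g that by (simp add: R.v_mult G_mem) (simp add: semidirect_simps action_one)
    have "v (inv\<^bsub>G\<^esub> g, \<one>\<^bsub>P\<^esub>) = adj B (v (g, \<one>\<^bsub>P\<^esub>))"
      using g by (intro R.B.isometry_right_inverse) (simp_all add: R.v_isometry G_mem mult v_G_one)
    then show "v (g, \<one>\<^bsub>P\<^esub>) \<otimes>\<^bsub>B\<^esub> adj B (v (g, \<one>\<^bsub>P\<^esub>)) = \<one>\<^bsub>B\<^esub>"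
      using mult [of "inv\<^bsub>G\<^esub> g"] g by (simp add: v_G_one)
  next
    fix p assume p: "p \<in> carrier P"
    show "v (\<one>\<^bsub>G\<^esub>, p) \<in> carrier B" using p by (simp add: P_mem)
    show "adj B (v (\<one>\<^bsub>G\<^esub>, p)) \<otimes>\<^bsub>B\<^esub> v (\<one>\<^bsub>G\<^esub>, p) = \<one>\<^bsub>B\<^esub>"
      using p by (simp add: R.v_isometry P_mem)
    show "v (\<one>\<^bsub>G\<^esub>, p) \<otimes>\<^bsub>B\<^esub> v (\<one>\<^bsub>G\<^esub>, q) = v (\<one>\<^bsub>G\<^esub>, p \<otimes>\<^bsub>P\<^esub> q)" if "q \<in> carrier P" for q
      using p that by (simp add: R.v_mult P_mem) (simp add: semidirect_simps action_group_one)
    fix g assume g: "g \<in> carrier G"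
    show "v (\<one>\<^bsub>G\<^esub>, p) \<otimes>\<^bsub>B\<^esub> v (g, \<one>\<^bsub>P\<^esub>) = v (\<theta> p g, \<one>\<^bsub>P\<^esub>) \<otimes>\<^bsub>B\<^esub> v (\<one>\<^bsub>G\<^esub>, p)"
      using p g
      by (simp add: R.v_mult G_mem P_mem action_closed)
         (simp add: semidirect_simps action_closed action_one)
  next
    fix p q g assume c: "p \<in> carrier P" "q \<in> carrier P" "g \<in> carrier G"
    have mem: "(\<one>\<^bsub>G\<^esub>, p) \<in> carrier S" "(g, q) \<in> carrier S"
      using c by (simp_all add: semidirect_simps)
    have prod: "adj B (v (\<one>\<^bsub>G\<^esub>, p)) \<otimes>\<^bsub>B\<^esub> v (g, \<one>\<^bsub>P\<^esub>) \<otimes>\<^bsub>B\<^esub> v (\<one>\<^bsub>G\<^esub>, q)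
        = adj B (v (\<one>\<^bsub>G\<^esub>, p)) \<otimes>\<^bsub>B\<^esub> v (g, q)"
      using c by (simp add: R.B.m_assoc R.B.adj_closed G_mem P_mem v_pair)
    have g: "inv\<^bsub>G\<^esub> \<one>\<^bsub>G\<^esub> \<otimes>\<^bsub>G\<^esub> g = g" using c by simp
    {
      fix k p' q' l assume f: "lcm_factorization G P \<theta> p q g k p' q' l"
      then have c': "k \<in> carrier G" "p' \<in> carrier P" "q' \<in> carrier P" "l \<in> carrier G"
        by (simp_all add: lcm_factorization_def)
      have "adj B (v (\<one>\<^bsub>G\<^esub>, p)) \<otimes>\<^bsub>B\<^esub> v (g, q) = v (k, p') \<otimes>\<^bsub>B\<^esub> adj B (v (l, q'))"
        using c' semidirect_lcm [OF G.one_closed c(3,1,2), unfolded g, OF f]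
        by (intro R.adj_v_v_lcm mem) (simp_all add: semidirect_simps(1))
      also have "\<dots> = v (k, \<one>\<^bsub>P\<^esub>) \<otimes>\<^bsub>B\<^esub> v (\<one>\<^bsub>G\<^esub>, p') \<otimes>\<^bsub>B\<^esub> adj B (v (l, \<one>\<^bsub>P\<^esub>) \<otimes>\<^bsub>B\<^esub> v (\<one>\<^bsub>G\<^esub>, q'))"
        using c' by (simp add: v_pair)
      also have "\<dots> = v (k, \<one>\<^bsub>P\<^esub>) \<otimes>\<^bsub>B\<^esub> v (\<one>\<^bsub>G\<^esub>, p') \<otimes>\<^bsub>B\<^esub> adj B (v (\<one>\<^bsub>G\<^esub>, q')) \<otimes>\<^bsub>B\<^esub> adj B (v (l, \<one>\<^bsub>P\<^esub>))"
        using c' by (simp only: R.B.adj_mult R.v_closed G_mem P_mem)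
          (simp add: R.B.m_assoc R.B.adj_closed G_mem P_mem)
      finally show "adj B (v (\<one>\<^bsub>G\<^esub>, p)) \<otimes>\<^bsub>B\<^esub> v (g, \<one>\<^bsub>P\<^esub>) \<otimes>\<^bsub>B\<^esub> v (\<one>\<^bsub>G\<^esub>, q)
        = v (k, \<one>\<^bsub>P\<^esub>) \<otimes>\<^bsub>B\<^esub> v (\<one>\<^bsub>G\<^esub>, p') \<otimes>\<^bsub>B\<^esub> adj B (v (\<one>\<^bsub>G\<^esub>, q')) \<otimes>\<^bsub>B\<^esub> adj B (v (l, \<one>\<^bsub>P\<^esub>))"
        by (simp only: prod)
    }
    assume none: "\<nexists>k p' q' l. lcm_factorization G P \<theta> p q g k p' q' l"
    have "((\<one>\<^bsub>G\<^esub>, p) <#\<^bsub>S\<^esub> carrier S) \<inter> ((g, q) <#\<^bsub>S\<^esub> carrier S) = {}"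
      using semidirect_factorization_exists [OF G.one_closed c(3,1,2), unfolded g] none by blast
    then show "adj B (v (\<one>\<^bsub>G\<^esub>, p)) \<otimes>\<^bsub>B\<^esub> v (g, \<one>\<^bsub>P\<^esub>) \<otimes>\<^bsub>B\<^esub> v (\<one>\<^bsub>G\<^esub>, q) = \<zero>\<^bsub>B\<^esub>"
      unfolding prod by (rule R.adj_v_v_disjoint [OF mem])
  qed
qed

end


theorem theorem4p4:
  fixes G :: "('g, 'm) monoid_scheme" and P :: "('p, 'n) monoid_scheme"
    and \<theta> :: "'p \<Rightarrow> 'g \<Rightarrow> 'g"
  assumes "algebraic_dynamical_system G P \<theta>"
  shows "\<exists>\<phi> \<in> star_iso (ads_cstar G P \<theta>) (semigroup_cstar (semidirect G P \<theta>)).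
    (\<forall>g\<in>carrier G. \<phi> (ads_u G P \<theta> g) = semigroup_v (semidirect G P \<theta>) (g, \<one>\<^bsub>P\<^esub>)) \<and>
    (\<forall>p\<in>carrier P. \<phi> (ads_s G P \<theta> p) = semigroup_v (semidirect G P \<theta>) (\<one>\<^bsub>G\<^esub>, p))"
proof -
  interpret algebraic_dynamical_system G P \<theta> by fact
  let ?A = "ads_cstar G P \<theta>" and ?C = "semigroup_cstar S"
  let ?u = "ads_u G P \<theta>" and ?s = "ads_s G P \<theta>" and ?v = "semigroup_v S"
  let ?e = "\<lambda>X. universal_map (semigroup_gens S) (semigroup_relations S) (fe X)"
  interpret C: semigroup_representation S ?C ?v ?e
    by (rule semigroup_cstar_representation) (rule S.right_lcm_monoid_axioms)
  interpret D: ads_representation G P \<theta> ?C "\<lambda>g. ?v (g, \<one>\<^bsub>P\<^esub>)" "\<lambda>p. ?v (\<one>\<^bsub>G\<^esub>, p)"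
    by (rule ads_representation_v) (rule C.semigroup_representation_axioms)
  interpret A: ads_representation G P \<theta> ?A ?u ?s
    by (rule ads_cstar_representation)
  interpret W: semigroup_representation S ?A A.w A.ideal_proj
    by (rule A.semigroup_representation_w)
  obtain \<phi> where \<phi>: "\<phi> \<in> star_hom ?A ?C" "contractive ?A ?C \<phi>"
    and \<phi>_u: "\<And>g. g \<in> carrier G \<Longrightarrow> \<phi> (?u g) = ?v (g, \<one>\<^bsub>P\<^esub>)"
    and \<phi>_s: "\<And>p. p \<in> carrier P \<Longrightarrow> \<phi> (?s p) = ?v (\<one>\<^bsub>G\<^esub>, p)"
    using D.ads_hom by (elim bexE conjE) simp
  obtain \<psi> where \<psi>: "\<psi> \<in> star_hom ?C ?A" "contractive ?C ?A \<psi>"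
    and \<psi>_v: "\<And>x. x \<in> carrier S \<Longrightarrow> \<psi> (?v x) = A.w x"
    and \<psi>_e: "\<And>X. X \<in> constructible_ideals S \<Longrightarrow> \<psi> (?e X) = A.ideal_proj X"
    using W.semigroup_hom [OF S.right_lcm_monoid_axioms] by (elim bexE conjE) simp
  have \<phi>_w: "\<phi> (A.w x) = ?v x" if x: "x \<in> carrier S" for x
  proof -
    obtain g p where gp: "x = (g, p)" "g \<in> carrier G" "p \<in> carrier P"
      using x by (auto simp: semidirect_simps)
    have "\<phi> (A.w x) = \<phi> (?u g) \<otimes>\<^bsub>?C\<^esub> \<phi> (?s p)"
      using \<phi>(1) gp by (simp add: A.w_def star_hom_def ring_hom_def)
    also have "\<dots> = D.w x"
      by (simp add: \<phi>_u \<phi>_s gp D.w_def)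
    finally show ?thesis
      using gp C.v_mult [of "(g, \<one>\<^bsub>P\<^esub>)" "(\<one>\<^bsub>G\<^esub>, p)"]
      by (simp add: D.w_def semidirect_simps action_one)
  qed
  have "\<phi> \<in> star_iso ?A ?C"
    unfolding ads_cstar_def semigroup_cstar_def
  proof (rule universal_cstar_isoI)
    show "bounded_presentation (ads_gens G P) (ads_relations G P \<theta>)"
      "bounded_presentation (semigroup_gens S) (semigroup_relations S)"
      by (intro bounded_presentation.intro bounded_ads bounded_semigroup)+
  next
    fix x assume "x \<in> ads_gens G P"
    then consider g where "x = UGen g" "g \<in> carrier G" | p where "x = SGen p" "p \<in> carrier P"
      by (auto simp: ads_gens_def)
    then show "\<psi> (\<phi> (universal_map (ads_gens G P) (ads_relations G P \<theta>) (fgen x)))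
        = universal_map (ads_gens G P) (ads_relations G P \<theta>) (fgen x)"
    proof cases
      case 1
      then have "\<psi> (\<phi> (?u g)) = ?u g"
        by (simp add: \<phi>_u \<psi>_v semidirect_simps A.w_def A.s_one)
      then show ?thesis using 1 by (simp add: ads_u_def)
    next
      case 2
      then have "\<psi> (\<phi> (?s p)) = ?s p"
        by (simp add: \<phi>_s \<psi>_v semidirect_simps A.w_def A.u_one)
      then show ?thesis using 2 by (simp add: ads_s_def)
    qed
  next
    fix y assume "y \<in> semigroup_gens S"
    then consider x where "y = VGen x" "x \<in> carrier S"
      | X where "y = EGen X" "X \<in> constructible_ideals S"
      by (auto simp: semigroup_gens_def)
    then show "\<phi> (\<psi> (universal_map (semigroup_gens S) (semigroup_relations S) (fgen y)))
        = universal_map (semigroup_gens S) (semigroup_relations S) (fgen y)"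
    proof cases
      case 1
      then have "\<phi> (\<psi> (?v x)) = ?v x" by (simp add: \<psi>_v \<phi>_w)
      then show ?thesis using 1 by (simp add: semigroup_v_def)
    next
      case 2
      have "\<phi> (A.ideal_proj X) = ?e X"
        using S.constructible_ideals_principal [OF 2(2)]
      proof
        assume "X = {}"
        then show ?thesis
          using star_hom_zero [OF A.B.cstar_algebra_axioms C.B.cstar_algebra_axioms \<phi>(1)]
          by (simp add: A.ideal_proj_def C.e_empty)
      next
        assume "\<exists>x\<in>carrier S. X = x <#\<^bsub>S\<^esub> carrier S"
        then obtain x where x: "x \<in> carrier S" "X = x <#\<^bsub>S\<^esub> carrier S" by blast
        then have "\<phi> (A.ideal_proj X) = \<phi> (A.w x) \<otimes>\<^bsub>?C\<^esub> adj ?C (\<phi> (A.w x))"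
          using \<phi>(1) by (simp add: A.ideal_proj_principal A.w_proj_def A.B.adj_closed
              star_hom_def ring_hom_def)
        then show ?thesis
          using x by (simp add: \<phi>_w C.e_principal)
      qed
      then show ?thesis using 2 by (simp add: \<psi>_e)
    qed
  qed (use \<phi> \<psi> in \<open>simp_all add: ads_cstar_def semigroup_cstar_def\<close>)
  then show ?thesis
    using \<phi>_u \<phi>_s by (intro bexI conjI ballI)
qed

end
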